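(* There exist universal constants $C_1,C_2>0$ such that for every positive Borel measure $\mu$ on $\overline{\mathbb{D}}^2$, $$C_1[\mu]_{CM}\le\|\mathbb{I}\|^2_{\mathcal{B}(\ell^2(T^2),L^2(\Lambda^*\mu))}\le C_2[\mu]_{CM}.$$ Moreover, the same holds (with universal constants) if $[\mu]_{CM}$ is replaced by the larger quantity $$\sup_{\|f\|_{\mathcal{D}(\mathbb{D}^2)}=1}\|\mathrm{Var} f\|^2_{L^2(\overline{\mathbb{D}}^2,d\mu)}.$$
   Context: **Dirichlet space.** $\mathbb{D}$ is the open unit disc. $\mathcal{D}(\mathbb{D}^2)$ is the space of holomorphic $f(z_1,z_2)=\sum a_{mn}z_1^mz_2^n$ on $\mathbb{D}^2$ with $\|f\|^2_{\mathcal{D}(\mathbb{D}^2)}=\sum_{m,n\ge0}|a_{mn}|^2(m+1)(n+1)<\infty$. $[\mu]_{CM}\in[0,\infty]$ is the smallest $C$ such that $\sup_{R<1}\int_{\overline{\mathbb{D}}^2}|f(R\zeta_1,R\zeta_2)|^2d\mu(\zeta)\le C\|f\|^2_{\mathcal{D}(\mathbb{D}^2)}$ for all $f\in\mathcal{D}(\mathbb{D}^2)$. **Radial variation.** For $f$ holomorphic on $\mathbb{D}^2$ and $(\zeta_1,\zeta_2)\in\overline{\mathbb{D}}^2$, $$\mathrm{Var}f(\zeta_1,\zeta_2)=\int_0^{1}\!\!\int_0^{1}|\partial_{z_1z_2}f(p\zeta_1,q\zeta_2)||\zeta_1||\zeta_2|\,dp\,dq+\int_0^1|\partial_{z_1}f(p\zeta_1,0)||\zeta_1|\,dp+\int_0^1|\partial_{z_2}f(0,q\zeta_2)||\zeta_2|\,dq+|f(0,0)|.$$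 **Tree and bitree.** $T$ is (the vertex set of) the infinite rooted binary tree with root $o$; $\partial T$ is the set of infinite descending sequences $\omega=(\omega^j)_{j\ge0}$, $\omega^0=o$, $\omega^{j+1}$ a child of $\omega^j$; $\overline{T}=T\cup\partial T$. For $\alpha,\beta\in T$, $\alpha\le\beta$ means that $\beta$ lies on the path from $o$ to $\alpha$; also $\omega\le\omega^j$ for all $j$ and $\omega\le\omega$ when $\omega\in\partial T$. Vertices of generation $j$ are identified with the dyadic arcs $I_\alpha=\{e^{is}:2\pi(l-1)2^{-j}\le s\le 2\pi l2^{-j}\}$, $1\le l\le2^j$, so that $\alpha\le\beta$ iff $I_\alpha\subseteq I_\beta$. $\overline{T}$ carries its usual compact metrizable topology, given by the metric $\delta_0(\zeta,\xi)=2^{-d(\zeta\wedge\xi)}-\frac12(2^{-d(\zeta)}+2^{-d(\xi)})$, where $d(\zeta\wedge\xi)\in[1,\infty]$ is the number of common ancestors in $T$ of $\zeta,\xi$ (a vertex is its own ancestor) and $d(\zeta)=d(\zeta\wedge\zeta)$. $T^2=T\times T$, $\overline{T}^2=\overline{T}\times\overline{T}$, with product order and topology. **Hardy operator.** For $\varphi:T^2\to[0,\infty)$ and $\zeta\in\overline{T}^2$, $\mathbb{I}\varphi(\zeta)=\sum_{\alpha\in T^2,\ \alpha\ge\zeta}\varphi(\alpha)$. For a positive Borel measure $\nu$ on $\overline{T}^2$, $\|\mathbb{I}\|^2_{\mathcal{B}(\ell^2(T^2),L^2(\nu))}\in[0,\infty]$ is the smallest $C$ with $\int_{\overline{T}^2}(\mathbb{I}\varphi)^2d\nu\le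 C\sum_{\alpha\in T^2}\varphi(\alpha)^2$ for all $\varphi\ge0$. **Pull-back $\Lambda^*$.** For $\alpha\in T$ of generation $j$ let $Q_\alpha=\{\rho e^{is}:e^{is}\in I_\alpha,\ 2^{-j-1}\le1-\rho\le2^{-j}\}\subset\mathbb{D}$. Let $\Lambda_0:\partial T\to\partial\mathbb{D}$ send $\omega=(\omega^j)$ to the unique point of $\bigcap_jI_{\omega^j}$, and let $\Lambda=(\Lambda_0,\Lambda_0):(\partial T)^2\to(\partial\mathbb{D})^2$. For a positive Borel measure $\mu$ on $\overline{\mathbb{D}}^2$, $\Lambda^*\mu$ is the Borel measure on $\overline{T}^2$ determined by: - $(\Lambda^*\mu)(\{\alpha\})=\mu(Q_{\alpha_x}\times Q_{\alpha_y})$ for $\alpha=(\alpha_x,\alpha_y)\in T^2$; - for $\alpha_x\in T$ and Borel $E\subseteq\partial T$, $(\Lambda^*\mu)(\{\alpha_x\}\times E)=\int_{Q_{\alpha_x}\times\partial\mathbb{D}}\frac{\sharp(\Lambda_0^{-1}(z_2)\cap E)}{\sharp\Lambda_0^{-1}(z_2)}d\mu(z_1,z_2)$, and symmetrically for $E\times\{\alpha_y\}$; - for Borel $E\subseteq(\partial T)^2$, $(\Lambda^*\mu)(E)=\int_{(\partial\mathbb{D})^2}\frac{\sharp(\Lambda^{-1}(z)\cap E)}{\sharp\Lambda^{-1}(z)}d\mu(z)$. *)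

theory Defs
  imports "HOL-Complex_Analysis.Complex_Analysis" "HOL-Library.Sublist" "HOL-Library.Product_Order"
begin

section \<open>The Dirichlet space on the bidisc\<close>

definition bidisc_holomorphic :: "(complex \<Rightarrow> complex \<Rightarrow> complex) \<Rightarrow> bool" where
  "bidisc_holomorphic f \<longleftrightarrow>
     continuous_on (ball 0 1 \<times> ball 0 1) (\<lambda>(z1, z2). f z1 z2) \<and>
     (\<forall>z2\<in>ball 0 1. (\<lambda>z1. f z1 z2) holomorphic_on ball 0 1) \<and>
     (\<forall>z1\<in>ball 0 1. (\<lambda>z2. f z1 z2) holomorphic_on ball 0 1)"

definition bidisc_expansion ::
    "(complex \<Rightarrow> complex \<Rightarrow> complex) \<Rightarrow> (nat \<Rightarrow> nat \<Rightarrow> complex) \<Rightarrow> bool" where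
  "bidisc_expansion f a \<longleftrightarrow>
     (\<forall>z1\<in>ball 0 1. \<forall>z2\<in>ball 0 1.
        ((\<lambda>(m, n). a m n * z1 ^ m * z2 ^ n) has_sum f z1 z2) UNIV)"

definition taylor_coeff :: "(complex \<Rightarrow> complex \<Rightarrow> complex) \<Rightarrow> nat \<Rightarrow> nat \<Rightarrow> complex" where
  "taylor_coeff f = (THE a. bidisc_expansion f a)"

definition dirichlet_norm2 :: "(complex \<Rightarrow> complex \<Rightarrow> complex) \<Rightarrow> ennreal" where
  "dirichlet_norm2 f =
     (\<integral>\<^sup>+(m, n). ennreal ((cmod (taylor_coeff f m n))\<^sup>2 * (real m + 1) * (real n + 1))
        \<partial>count_space UNIV)"

text \<open>Values of \<open>f\<close> outside the open bidisc are irrelevant throughout: all integrals below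
  sample \<open>f\<close> and its derivatives only at points of the open bidisc.  The existence of an
  expansion is automatic for holomorphic \<open>f\<close>; it is recorded here for convenience.\<close>

definition dirichlet_bidisc :: "(complex \<Rightarrow> complex \<Rightarrow> complex) set" where
  "dirichlet_bidisc =
     {f. bidisc_holomorphic f \<and> (\<exists>a. bidisc_expansion f a) \<and> dirichlet_norm2 f < \<infinity>}"

definition carleson_const :: "(complex \<times> complex) measure \<Rightarrow> ennreal" where
  "carleson_const \<mu> = Inf {C. \<forall>f\<in>dirichlet_bidisc.
     (SUP R\<in>{0..<1::real}. \<integral>\<^sup>+(\<zeta>1, \<zeta>2).
        ennreal ((cmod (f (of_real R * \<zeta>1) (of_real R * \<zeta>2)))\<^sup>2) \<partial>\<mu>)
     \<le> C * dirichlet_norm2 f}"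

definition radial_variation :: "(complex \<Rightarrow> complex \<Rightarrow> complex) \<Rightarrow> complex \<times> complex \<Rightarrow> ennreal" where
  "radial_variation f = (\<lambda>(\<zeta>1, \<zeta>2).
     (\<integral>\<^sup>+q\<in>{0..<1}. (\<integral>\<^sup>+p\<in>{0..<1}.
        ennreal (cmod (deriv (\<lambda>w. deriv (\<lambda>z. f z w) (of_real p * \<zeta>1)) (of_real q * \<zeta>2))
                 * cmod \<zeta>1 * cmod \<zeta>2) \<partial>lborel) \<partial>lborel)
   + (\<integral>\<^sup>+p\<in>{0..<1}. ennreal (cmod (deriv (\<lambda>z. f z 0) (of_real p * \<zeta>1)) * cmod \<zeta>1) \<partial>lborel)
   + (\<integral>\<^sup>+q\<in>{0..<1}. ennreal (cmod (deriv (\<lambda>w. f 0 w) (of_real q * \<zeta>2)) * cmod \<zeta>2) \<partial>lborel)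
   + ennreal (cmod (f 0 0)))"

definition variation_const :: "(complex \<times> complex) measure \<Rightarrow> ennreal" where
  "variation_const \<mu> =
     (SUP f\<in>{f \<in> dirichlet_bidisc. dirichlet_norm2 f = 1}. \<integral>\<^sup>+\<zeta>. (radial_variation f \<zeta>)\<^sup>2 \<partial>\<mu>)"


section \<open>The tree with its boundary\<close>

text \<open>A vertex is the list of left (\<open>False\<close>) / right (\<open>True\<close>) turns on the path from the root;
  its children are obtained by appending one entry, and its generation is its length.
  A boundary point is an infinite sequence of turns.\<close>

type_synonym vertex = "bool list"

datatype cltree = Vertex vertex | End "nat \<Rightarrow> bool"

definition end_vertex :: "(nat \<Rightarrow> bool) \<Rightarrow> nat \<Rightarrow> vertex" where
  "end_vertex \<omega> j = map \<omega> [0..<j]"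

lemma length_end_vertex [simp]: "length (end_vertex \<omega> j) = j"
  by (simp add: end_vertex_def)

lemma take_end_vertex: "take i (end_vertex \<omega> j) = end_vertex \<omega> (min i j)"
  by (simp add: end_vertex_def take_map take_upt min_def)

lemma end_vertex_inject: "(\<And>j. end_vertex \<omega> j = end_vertex \<omega>' j) \<Longrightarrow> \<omega> = \<omega>'"
proof
  fix i assume "\<And>j. end_vertex \<omega> j = end_vertex \<omega>' j"
  from this[of "Suc i"] show "\<omega> i = \<omega>' i" by (simp add: end_vertex_def)
qed

instantiation cltree :: order
begin

fun less_eq_cltree :: "cltree \<Rightarrow> cltree \<Rightarrow> bool" where
  "Vertex \<alpha> \<le> Vertex \<beta> \<longleftrightarrow> prefix \<beta> \<alpha>"
| "End \<omega> \<le> Vertex \<beta> \<longleftrightarrow> (\<exists>j. \<beta> = end_vertex \<omega> j)"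
| "End \<omega> \<le> End \<omega>' \<longleftrightarrow> \<omega> = \<omega>'"
| "Vertex \<alpha> \<le> End \<omega> \<longleftrightarrow> False"

definition less_cltree :: "cltree \<Rightarrow> cltree \<Rightarrow> bool" where
  "less_cltree x y \<longleftrightarrow> x \<le> y \<and> \<not> y \<le> x"

instance
proof
  fix x y z :: cltree
  show "x < y \<longleftrightarrow> x \<le> y \<and> \<not> y \<le> x" by (fact less_cltree_def)
  show "x \<le> x" by (cases x) auto
  show "x \<le> z" if "x \<le> y" "y \<le> z"
  proof (cases x; cases y; cases z)
    fix \<omega> \<beta> \<gamma> assume eq: "x = End \<omega>" "y = Vertex \<beta>" "z = Vertex \<gamma>"
    with that obtain j where "\<beta> = end_vertex \<omega> j" "prefix \<gamma> \<beta>" by auto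
    then have "\<gamma> = end_vertex \<omega> (min (length \<gamma>) j)"
      by (metis append_eq_conv_conj prefix_def take_end_vertex)
    with eq show ?thesis by auto
  qed (use that in \<open>auto intro: prefix_order.trans\<close>)
  show "x = y" if "x \<le> y" "y \<le> x"
    using that by (cases x; cases y) auto
qed

end

definition common_ancestors :: "cltree \<Rightarrow> cltree \<Rightarrow> vertex set" where
  "common_ancestors \<zeta> \<xi> = {\<alpha>. \<zeta> \<le> Vertex \<alpha> \<and> \<xi> \<le> Vertex \<alpha>}"

text \<open>\<open>2\<^bsup>-d\<^esup>\<close> where \<open>d \<in> [1, \<infinity>]\<close> is the number of common ancestors.\<close>

definition confluent_weight :: "cltree \<Rightarrow> cltree \<Rightarrow> real" where
  "confluent_weight \<zeta> \<xi> =
     (if finite (common_ancestors \<zeta> \<xi>) then (1/2) ^ card (common_ancestors \<zeta> \<xi>) else 0)"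

lemma common_ancestors_commute: "common_ancestors \<zeta> \<xi> = common_ancestors \<xi> \<zeta>"
  by (auto simp: common_ancestors_def)

lemma ancestors_End: "common_ancestors (End \<omega>) (End \<omega>) = range (end_vertex \<omega>)"
  by (auto simp: common_ancestors_def)

lemma ancestors_Vertex: "common_ancestors (Vertex \<alpha>) (Vertex \<alpha>) = {\<beta>. prefix \<beta> \<alpha>}"
  by (auto simp: common_ancestors_def)

lemma finite_ancestors_Vertex: "finite (common_ancestors (Vertex \<alpha>) (Vertex \<alpha>))"
  by (rule finite_subset[of _ "set (prefixes \<alpha>)"]) (auto simp: ancestors_Vertex)

lemma ancestors_inject:
  assumes "common_ancestors x x = common_ancestors y y" shows "x = y"
proof (cases x; cases y)
  fix \<alpha> \<beta> assume "x = Vertex \<alpha>" "y = Vertex \<beta>"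
  then show ?thesis using assms unfolding ancestors_Vertex set_eq_iff mem_Collect_eq
    by (metis ancestors_Vertex assms mem_Collect_eq prefix_order.antisym prefix_order.refl)
next
  fix \<omega> \<omega>' assume eq: "x = End \<omega>" "y = End \<omega>'"
  have "end_vertex \<omega> j = end_vertex \<omega>' j" for j
  proof -
    have "end_vertex \<omega> j \<in> range (end_vertex \<omega>')" using assms eq by (auto simp: ancestors_End)
    then show ?thesis by (metis length_end_vertex rangeE)
  qed
  then show ?thesis using eq end_vertex_inject by blast
next
  have inf: "infinite (range (end_vertex \<omega>))" for \<omega>
    by (rule range_inj_infinite) (metis injI length_end_vertex)
  { fix \<alpha> \<omega> assume "x = Vertex \<alpha>" "y = End \<omega>"
    then show ?thesis using assms inf finite_ancestors_Vertex by (metis ancestors_End) }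
  { fix \<alpha> \<omega> assume "x = End \<omega>" "y = Vertex \<alpha>"
    then show ?thesis using assms inf finite_ancestors_Vertex by (metis ancestors_End) }
qed

lemma ancestor_closed:
  assumes "x \<le> Vertex \<alpha>" "prefix \<beta> \<alpha>" shows "x \<le> Vertex \<beta>"
  using assms by (meson less_eq_cltree.simps(1) order.trans)

lemma ancestor_linear:
  assumes "x \<le> Vertex \<alpha>" "x \<le> Vertex \<beta>" shows "prefix \<alpha> \<beta> \<or> prefix \<beta> \<alpha>"
proof (cases x)
  case (Vertex \<gamma>)
  then show ?thesis using assms prefix_same_cases[of \<alpha> \<gamma> \<beta>] by auto
next
  case (End \<omega>)
  then obtain i j where "\<alpha> = end_vertex \<omega> i" "\<beta> = end_vertex \<omega> j" using assms by auto
  then show ?thesis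
    by (metis min_def take_end_vertex take_is_prefix linear)
qed

lemma common_ancestors_nested:
  "common_ancestors x y \<subseteq> common_ancestors x z \<or> common_ancestors z y \<subseteq> common_ancestors x z"
proof (rule ccontr)
  assume "\<not> ?thesis"
  then obtain \<alpha> \<beta> where
    \<alpha>: "x \<le> Vertex \<alpha>" "y \<le> Vertex \<alpha>" "\<not> z \<le> Vertex \<alpha>" and
    \<beta>: "z \<le> Vertex \<beta>" "y \<le> Vertex \<beta>" "\<not> x \<le> Vertex \<beta>"
    by (auto simp: common_ancestors_def)
  from ancestor_linear[OF \<alpha>(2) \<beta>(2)] show False
    using \<alpha> \<beta> ancestor_closed by blast
qed

lemma confluent_weight_antimono:
  assumes "common_ancestors x y \<subseteq> common_ancestors u v"
  shows "confluent_weight u v \<le> confluent_weight x y"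
  using assms
  by (auto simp: confluent_weight_def finite_subset card_mono intro!: power_decreasing)

lemma confluent_weight_self_le: "confluent_weight x x \<le> confluent_weight x y"
  by (rule confluent_weight_antimono) (auto simp: common_ancestors_def)

lemma confluent_weight_eq_imp:
  assumes "confluent_weight x x = confluent_weight x y"
  shows "common_ancestors x y = common_ancestors x x"
proof (cases "finite (common_ancestors x x)")
  case True
  have sub: "common_ancestors x y \<subseteq> common_ancestors x x" by (auto simp: common_ancestors_def)
  with True have "finite (common_ancestors x y)" by (rule rev_finite_subset)
  with True assms have "card (common_ancestors x y) = card (common_ancestors x x)"
    by (simp add: confluent_weight_def power_inject_exp')
  with True sub show ?thesis by (simp add: card_subset_eq)
next
  case False
  with assms have inf: "infinite (common_ancestors x y)"
    by (auto simp: confluent_weight_def split: if_splits)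
  have "x \<le> Vertex \<beta> \<Longrightarrow> y \<le> Vertex \<beta>" for \<beta>
  proof -
    assume \<beta>: "x \<le> Vertex \<beta>"
    have "infinite (common_ancestors x y - set (prefixes \<beta>))"
      using inf by simp
    then obtain \<alpha> where "\<alpha> \<in> common_ancestors x y" "\<not> prefix \<alpha> \<beta>"
      by (metis Diff_iff finite.emptyI in_set_prefixes subsetI subset_empty)
    with \<beta> ancestor_linear have "prefix \<beta> \<alpha>" "y \<le> Vertex \<alpha>"
      by (auto simp: common_ancestors_def)
    then show ?thesis using ancestor_closed by blast
  qed
  then show ?thesis by (auto simp: common_ancestors_def)
qed

instantiation cltree :: metric_space
begin

definition dist_cltree :: "cltree \<Rightarrow> cltree \<Rightarrow> real" where
  "dist_cltree \<zeta> \<xi> =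
     confluent_weight \<zeta> \<xi> - (confluent_weight \<zeta> \<zeta> + confluent_weight \<xi> \<xi>) / 2"

definition uniformity_cltree :: "(cltree \<times> cltree) filter" where
  "uniformity_cltree = (INF e\<in>{0<..}. principal {(x, y). dist x y < e})"

definition open_cltree :: "cltree set \<Rightarrow> bool" where
  "open_cltree U \<longleftrightarrow> (\<forall>x\<in>U. eventually (\<lambda>(x', y). x' = x \<longrightarrow> y \<in> U) uniformity)"

instance
proof
  fix x y z :: cltree and U :: "cltree set"
  have sym: "confluent_weight u v = confluent_weight v u" for u v
    by (simp add: confluent_weight_def common_ancestors_commute)
  note le = confluent_weight_self_le
  show "uniformity = (INF e\<in>{0<..}. principal {(x :: cltree, y). dist x y < e})"
    by (fact uniformity_cltree_def)
  show "open U \<longleftrightarrow> (\<forall>x\<in>U. \<forall>\<^sub>F (x', y) in uniformity. x' = x \<longrightarrow> y \<in> U)"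
    by (fact open_cltree_def)
  show "dist x y = 0 \<longleftrightarrow> x = y"
  proof
    assume "dist x y = 0"
    with le[of x y] le[of y x] sym[of x y]
    have "confluent_weight x x = confluent_weight x y" "confluent_weight y y = confluent_weight y x"
      by (auto simp: dist_cltree_def)
    then show "x = y"
      by (metis ancestors_inject common_ancestors_commute confluent_weight_eq_imp)
  qed (simp add: dist_cltree_def)
  have "confluent_weight x y \<le> confluent_weight x z \<or> confluent_weight x y \<le> confluent_weight y z"
    using common_ancestors_nested[of x z y] confluent_weight_antimono sym by metis
  then show "dist x y \<le> dist x z + dist y z"
    using le[of z x] le[of z y] sym[of x z] sym[of y z] by (auto simp: dist_cltree_def field_simps)
qed

end


section \<open>The Hardy operator on the bitree\<close>

text \<open>The order on \<open>cltree \<times> cltree\<close> is the product order.\<close>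

definition hardy :: "(vertex \<times> vertex \<Rightarrow> real) \<Rightarrow> cltree \<times> cltree \<Rightarrow> ennreal" where
  "hardy \<phi> \<zeta> =
     (\<integral>\<^sup>+\<alpha>. ennreal (\<phi> \<alpha>) \<partial>count_space {(\<alpha>x, \<alpha>y). \<zeta> \<le> (Vertex \<alpha>x, Vertex \<alpha>y)})"

definition hardy_norm2 :: "(cltree \<times> cltree) measure \<Rightarrow> ennreal" where
  "hardy_norm2 \<nu> = Inf {C. \<forall>\<phi>. (\<forall>\<alpha>. 0 \<le> \<phi> \<alpha>) \<longrightarrow>
     (\<integral>\<^sup>+\<zeta>. (hardy \<phi> \<zeta>)\<^sup>2 \<partial>\<nu>) \<le> C * (\<integral>\<^sup>+\<alpha>. ennreal ((\<phi> \<alpha>)\<^sup>2) \<partial>count_space UNIV)}"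


section \<open>Pulling measures on the closed bidisc back to the bitree\<close>

text \<open>\<open>arc_index \<alpha>\<close> is \<open>l - 1\<close>, where \<open>1 \<le> l \<le> 2\<^sup>j\<close> is the position of \<open>\<alpha>\<close>, counted
  anticlockwise from angle 0, among the vertices of its generation \<open>j\<close>.\<close>

definition arc_index :: "vertex \<Rightarrow> nat" where
  "arc_index \<alpha> = foldl (\<lambda>n b. 2 * n + of_bool b) 0 \<alpha>"

definition arc :: "vertex \<Rightarrow> complex set" where
  "arc \<alpha> = {cis s | s. 2 * pi * real (arc_index \<alpha>) / 2 ^ length \<alpha> \<le> s \<and>
                        s \<le> 2 * pi * (real (arc_index \<alpha>) + 1) / 2 ^ length \<alpha>}"

definition whitney_box :: "vertex \<Rightarrow> complex set" where
  "whitney_box \<alpha> = {of_real \<rho> * u | \<rho> u. u \<in> arc \<alpha> \<and>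
                      1 / 2 ^ (length \<alpha> + 1) \<le> 1 - \<rho> \<and> 1 - \<rho> \<le> 1 / 2 ^ length \<alpha>}"

definition end_point :: "(nat \<Rightarrow> bool) \<Rightarrow> complex" where
  "end_point \<omega> = (THE z. \<forall>j. z \<in> arc (end_vertex \<omega> j))"

definition end_fibre :: "complex \<Rightarrow> cltree set" where
  "end_fibre z = {End \<omega> | \<omega>. end_point \<omega> = z}"

text \<open>The fibre of \<open>\<Lambda>\<close> over \<open>(z1, z2)\<close> is \<open>end_fibre z1 \<times> end_fibre z2\<close>.\<close>

definition share :: "'a set \<Rightarrow> 'a set \<Rightarrow> ennreal" where
  "share F E = ennreal (real (card (F \<inter> E)) / real (card F))"

definition is_pullback ::
    "(complex \<times> complex) measure \<Rightarrow> (cltree \<times> cltree) measure \<Rightarrow> bool" where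
  "is_pullback \<mu> \<nu> \<longleftrightarrow>
     sets \<nu> = sets borel \<and>
     (\<forall>\<alpha>x \<alpha>y. emeasure \<nu> {(Vertex \<alpha>x, Vertex \<alpha>y)} = emeasure \<mu> (whitney_box \<alpha>x \<times> whitney_box \<alpha>y)) \<and>
     (\<forall>\<alpha>x. \<forall>E\<in>sets borel. E \<subseteq> range End \<longrightarrow>
        emeasure \<nu> ({Vertex \<alpha>x} \<times> E) =
          (\<integral>\<^sup>+z\<in>whitney_box \<alpha>x \<times> sphere 0 1. share (end_fibre (snd z)) E \<partial>\<mu>)) \<and>
     (\<forall>\<alpha>y. \<forall>E\<in>sets borel. E \<subseteq> range End \<longrightarrow>
        emeasure \<nu> (E \<times> {Vertex \<alpha>y}) =
          (\<integral>\<^sup>+z\<in>sphere 0 1 \<times> whitney_box \<alpha>y. share (end_fibre (fst z)) E \<partial>\<mu>)) \<and>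
     (\<forall>E\<in>sets borel. E \<subseteq> range End \<times> range End \<longrightarrow>
        emeasure \<nu> E =
          (\<integral>\<^sup>+z\<in>sphere 0 1 \<times> sphere 0 1. share (end_fibre (fst z) \<times> end_fibre (snd z)) E \<partial>\<mu>))"

definition pullback :: "(complex \<times> complex) measure \<Rightarrow> (cltree \<times> cltree) measure" where
  "pullback \<mu> = (THE \<nu>. is_pullback \<mu> \<nu>)"

end

theory Submission
  imports Defs
begin

text \<open>
The map \<open>\<Lambda>\<^sub>0\<close> has two Borel sections over the circle, taking the lower and the upper end of a doubly covered
point, so \<open>\<Lambda>\<^sup>*\<mu>\<close> is a countable mixture of weighted images of \<open>\<mu>\<close>.

Variation by Hardy: a radial segment ending in the box of a vertex, or at an end below it, only crosses boxes of
ancestors, and it spends length at most \<open>2\<^sup>-\<^sup>j\<close> in a box of generation \<open>j\<close>.  Hence \<open>Var f \<le> \<I> \<phi>\<close> when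
\<open>\<phi>\<close> is a bound for the mixed derivative on a pair of boxes, rescaled by their sizes.  The mean value
inequality replaces such a bound by a quadratic mean over circles; the boxes of one generation are rotations of
each other, so discrete orthogonality of the powers of \<open>z\<close> bounds \<open>\<Sum> \<phi>\<^sup>2\<close> by the Dirichlet norm of \<open>f\<close>.

Hardy by Carleson: \<open>\<I> \<phi>\<close> is dominated by a combination of the indicators of the regions below the vertices, and by
duality it suffices to bound the quadratic form with kernel the product of the numbers of regions containing both
points.  This number is at most a constant times the real part of \<open>6 + \<Sum> t\<^sup>n / n\<close>, \<open>t\<close> close to
\<open>z \<cdot> cnj w\<close>, and the same holds for products because the imaginary part of the logarithm is bounded.
The form of the larger kernel, truncated to a polynomial, is evaluated by applying the
Carleson inequality to a polynomial with coefficients given by moments of the measure.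

Carleson by variation: this is the fundamental theorem of calculus.
\<close>

text \<open>Pointwise domination of kernels passes to quadratic forms only against nonnegative test
  functions, and the kernel on the bidisc is a product of two complex ones, so that
  \<open>Re (k * l)\<close> contains the term \<open>- Im k * Im l\<close> of unfavourable sign. The
  large constant 6 in the logarithmic kernel keeps both real parts above the imaginary parts by a
  margin that survives truncation of the series. Apart from it the coefficients 1/n are comparable
  to the reciprocals of the Dirichlet weights n + 1, as for the reproducing kernel of the Dirichlet
  space; this is why the test polynomial in the duality argument has a norm controlled by the form
  itself. Closed boxes overlap along their edges, so the passage between disc and tree is not a
  bijection; it costs a total weight between 1 and 6 in each coordinate. For the variation, the
  rescaled bounds on boxes have to be square summable over the tree: decay of the form
  \<open>(1 - \<delta> / 2 ^ j) ^ m\<close>, summed over the generations against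
  \<open>1 / 2 ^ j\<close>, recovers the weight 1 / (m + 1).\<close>

section \<open>Power series on the disc and double power series on the bidisc\<close>

lemma unit_disc_power_series:
  fixes c :: "nat \<Rightarrow> complex"
  assumes F: "\<And>z. z \<in> ball 0 1 \<Longrightarrow> ((\<lambda>n. c n * z ^ n) has_sum F z) (UNIV :: nat set)"
  shows unit_disc_power_series_holomorphic: "F holomorphic_on ball 0 1"
    and unit_disc_power_series_deriv:
      "z \<in> ball 0 1 \<Longrightarrow> ((\<lambda>n. of_nat (Suc n) * c (Suc n) * z ^ n) has_sum deriv F z) UNIV"
proof -
  have sums: "(\<lambda>n. c n * z ^ n) sums F z" if "norm z < 1" for z
    using F[of z] that has_sum_imp_sums by auto
  have D: "(F has_field_derivative (\<Sum>n. diffs c n * z ^ n)) (at z)" if "norm z < 1" for z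
  proof -
    have "((\<lambda>z. \<Sum>n. c n * z ^ n) has_field_derivative (\<Sum>n. diffs c n * z ^ n)) (at z)"
      by (rule termdiffs_strong'[where K = 1]) (use that sums in \<open>auto simp: sums_iff\<close>)
    then show ?thesis
      by (rule has_field_derivative_transform_within_open[where S = "ball 0 1"])
        (use that sums in \<open>auto simp: sums_iff\<close>)
  qed
  show "F holomorphic_on ball 0 1"
    unfolding holomorphic_on_open[OF open_ball] using D by (metis dist_0_norm mem_ball)
  assume z: "z \<in> ball 0 1"
  define r where "r = (norm z + 1) / 2"
  have r: "norm z < r" "r < 1" "0 \<le> r" using z by (auto simp: r_def)
  have "summable (\<lambda>n. diffs c n * (of_real r) ^ n)"
    by (rule termdiff_converges[where K = 1]) (use r sums in \<open>auto simp: sums_iff\<close>)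
  then have "summable (\<lambda>n. norm (diffs c n * z ^ n))"
    by (rule powser_insidea) (use r in auto)
  moreover from this have "(\<lambda>n. diffs c n * z ^ n) sums deriv F z"
    using D[of z] z DERIV_imp_deriv summable_norm_cancel summable_sums by fastforce
  ultimately have "((\<lambda>n. diffs c n * z ^ n) has_sum deriv F z) UNIV"
    by (rule norm_summable_imp_has_sum)
  then show "((\<lambda>n. of_nat (Suc n) * c (Suc n) * z ^ n) has_sum deriv F z) UNIV"
    by (simp add: diffs_def)
qed

lemma bidisc_expansionD:
  assumes "bidisc_expansion f a" "z \<in> ball 0 1" "w \<in> ball 0 1"
  shows "((\<lambda>(m, n). a m n * z ^ m * w ^ n) has_sum f z w) UNIV"
  using assms by (auto simp: bidisc_expansion_def)

lemma bidisc_expansion_swap: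
  assumes "bidisc_expansion f a"
  shows "bidisc_expansion (\<lambda>z w. f w z) (\<lambda>m n. a n m)"
  unfolding bidisc_expansion_def
proof (intro ballI)
  fix z w :: complex assume "z \<in> ball 0 1" "w \<in> ball 0 1"
  with bidisc_expansionD[OF assms, of w z]
  have "((\<lambda>(m, n). a m n * w ^ m * z ^ n) has_sum f w z) (UNIV \<times> UNIV)" by simp
  then show "((\<lambda>(m, n). a n m * z ^ m * w ^ n) has_sum f w z) UNIV"
    by (subst (asm) has_sum_swap) (simp add: case_prod_unfold mult_ac)
qed

lemma bidisc_expansion_cmult:
  assumes "bidisc_expansion f a"
  shows "bidisc_expansion (\<lambda>z w. c * f z w) (\<lambda>m n. c * a m n)"
  unfolding bidisc_expansion_def
proof (intro ballI)
  fix z w :: complex assume "z \<in> ball 0 1" "w \<in> ball 0 1"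
  from has_sum_cmult_right[OF bidisc_expansionD[OF assms this], of c]
  show "((\<lambda>(m, n). c * a m n * z ^ m * w ^ n) has_sum c * f z w) UNIV"
    by (simp add: case_prod_unfold mult_ac)
qed

text \<open>Unconditional summability of complex families is absolute, so evaluating the expansion
  at the real point \<open>(r, s)\<close> already gives absolute convergence.\<close>

lemma bidisc_expansion_abs_summable:
  assumes "bidisc_expansion f a" "0 \<le> r" "r < 1" "0 \<le> s" "s < 1"
  shows "(\<lambda>(m, n). cmod (a m n) * r ^ m * s ^ n) summable_on UNIV"
proof -
  have "(\<lambda>(m, n). a m n * of_real r ^ m * of_real s ^ n) summable_on UNIV"
    using bidisc_expansionD[OF assms(1), of "of_real r" "of_real s"] assms
    by (auto intro: has_sum_imp_summable)
  then show ?thesis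
    using assms by (auto simp: summable_on_iff_abs_summable_on_complex case_prod_unfold norm_mult norm_power)
qed

lemma bidisc_expansion_slices:
  assumes f: "bidisc_expansion f a" and w: "w \<in> ball 0 1"
  shows "(\<lambda>n. a m n * w ^ n) summable_on UNIV"
    and "z \<in> ball 0 1 \<Longrightarrow> ((\<lambda>m. (\<Sum>\<^sub>\<infinity>n. a m n * w ^ n) * z ^ m) has_sum f z w) UNIV"
    and "z \<in> ball 0 1 \<Longrightarrow>
      (\<lambda>(m, n). of_nat (Suc m) * a (Suc m) n * z ^ m * w ^ n) summable_on UNIV"
proof -
  have sw: "cmod w < 1" using w by simp
  have in1: "(\<lambda>n. cmod (a m n) * cmod w ^ n) summable_on UNIV" for m
  proof -
    \<comment> \<open>Any radius in (0, 1) would do in place of 1/2: the factor only has to be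
      invertible, so that it can be divided out of row \<open>m\<close>.\<close>
    have "(\<lambda>(m, n). cmod (a m n) * (1/2) ^ m * cmod w ^ n) summable_on UNIV \<times> UNIV"
      using bidisc_expansion_abs_summable[OF f, of "1/2" "cmod w"] sw by simp
    then have "(\<lambda>n. cmod (a m n) * (1/2) ^ m * cmod w ^ n) summable_on UNIV"
      by (rule summable_on_SigmaD1) auto
    then have "(\<lambda>n. 2 ^ m * (cmod (a m n) * (1/2) ^ m * cmod w ^ n)) summable_on UNIV"
      by (rule summable_on_cmult_right)
    moreover have "2 ^ m * (cmod (a m n) * (1/2) ^ m * cmod w ^ n) = cmod (a m n) * cmod w ^ n" for n
      by (simp add: power_one_over)
    ultimately show ?thesis by (simp only:)
  qed
  show in2: "(\<lambda>n. a m n * w ^ n) summable_on UNIV" for m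
    by (rule abs_summable_summable) (use in1[of m] in \<open>simp add: norm_mult norm_power\<close>)
  show "((\<lambda>m. (\<Sum>\<^sub>\<infinity>n. a m n * w ^ n) * z ^ m) has_sum f z w) UNIV" if z: "z \<in> ball 0 1" for z
  proof (rule has_sum_SigmaD)
    show "((\<lambda>(m, n). a m n * z ^ m * w ^ n) has_sum f z w) (UNIV \<times> UNIV)"
      using bidisc_expansionD[OF f z w] by simp
    show "((\<lambda>n. case (m, n) of (m, n) \<Rightarrow> a m n * z ^ m * w ^ n)
        has_sum (\<Sum>\<^sub>\<infinity>n. a m n * w ^ n) * z ^ m) UNIV" for m
      using has_sum_cmult_left[OF has_sum_infsum[OF in2[of m]], of "z ^ m"] by (simp add: mult_ac)
  qed
  assume z: "z \<in> ball 0 1"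
  \<comment> \<open>\<open>N m\<close> are the coefficients of a one-variable power series
    majorising the expansion. Its termwise derivative converges by the one-variable result, and this
    gives absolute summability of the differentiated double series.\<close>
  define N where "N m = (\<Sum>\<^sub>\<infinity>n. cmod (a m n) * cmod w ^ n)" for m
  have N: "((\<lambda>n. cmod (a m n) * cmod w ^ n) has_sum N m) UNIV" for m
    unfolding N_def by (rule has_sum_infsum[OF in1])
  have N0: "0 \<le> N m" for m unfolding N_def by (intro infsum_nonneg) auto
  have outer: "(\<lambda>m. N m * r ^ m) summable_on UNIV" if "0 \<le> r" "r < 1" for r
  proof -
    have "(\<lambda>(m, n). cmod (a m n) * r ^ m * cmod w ^ n) summable_on UNIV \<times> UNIV"
      using bidisc_expansion_abs_summable[OF f, of r "cmod w"] sw that by simp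
    then obtain S where "((\<lambda>(m, n). cmod (a m n) * r ^ m * cmod w ^ n) has_sum S) (UNIV \<times> UNIV)"
      by (auto simp: summable_on_def)
    then have "((\<lambda>m. N m * r ^ m) has_sum S) UNIV"
    proof (rule has_sum_SigmaD)
      show "((\<lambda>n. case (m, n) of (m, n) \<Rightarrow> cmod (a m n) * r ^ m * cmod w ^ n) has_sum N m * r ^ m) UNIV" for m
        using has_sum_cmult_left[OF N[of m], of "r ^ m"] by (simp add: mult_ac)
    qed
    then show ?thesis by (rule has_sum_imp_summable)
  qed
  have ps: "((\<lambda>m. of_real (N m) * x ^ m) has_sum (\<Sum>\<^sub>\<infinity>m. of_real (N m) * x ^ m)) UNIV"
    if "x \<in> ball 0 1" for x :: complex
    by (rule has_sum_infsum, rule abs_summable_summable)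
      (use outer[of "cmod x"] that N0 in \<open>simp add: norm_mult norm_power\<close>)
  have "cmod z \<in> {0..<1}" using z by auto
  then have "(\<lambda>m. of_nat (Suc m) * of_real (N (Suc m)) * complex_of_real (cmod z) ^ m) summable_on UNIV"
    using unit_disc_power_series_deriv[OF ps, of "of_real (cmod z)"]
    by (auto intro: has_sum_imp_summable)
  then have nn: "(\<lambda>m. real (Suc m) * N (Suc m) * cmod z ^ m) summable_on UNIV"
    using N0 by (simp add: summable_on_iff_abs_summable_on_complex norm_mult norm_power del: of_nat_Suc)
  have "(\<lambda>(m, n). real (Suc m) * cmod (a (Suc m) n) * cmod z ^ m * cmod w ^ n) summable_on (UNIV \<times> UNIV)"
  proof (rule summable_on_SigmaI[OF _ nn])
    show "((\<lambda>n. case (m, n) of (m, n) \<Rightarrow> real (Suc m) * cmod (a (Suc m) n) * cmod z ^ m * cmod w ^ n)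
      has_sum real (Suc m) * N (Suc m) * cmod z ^ m) UNIV" for m
      using has_sum_cmult_right[OF N[of "Suc m"], of "real (Suc m) * cmod z ^ m"]
      by (simp add: mult_ac del: of_nat_Suc)
  qed auto
  then show "(\<lambda>(m, n). of_nat (Suc m) * a (Suc m) n * z ^ m * w ^ n) summable_on UNIV"
    by (intro abs_summable_summable[where f = "\<lambda>(m, n). of_nat (Suc m) * a (Suc m) n * z ^ m * w ^ n"])
      (simp add: case_prod_unfold norm_mult norm_power del: of_nat_Suc)
qed

lemma bidisc_expansion_holomorphic:
  assumes "bidisc_expansion f a" "w \<in> ball 0 1"
  shows "(\<lambda>z. f z w) holomorphic_on ball 0 1"
  by (rule unit_disc_power_series_holomorphic[OF bidisc_expansion_slices(2)[OF assms]])

lemma bidisc_expansion_deriv: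
  assumes f: "bidisc_expansion f a"
  shows "bidisc_expansion (\<lambda>z w. deriv (\<lambda>z. f z w) z) (\<lambda>m n. of_nat (Suc m) * a (Suc m) n)"
  unfolding bidisc_expansion_def
proof (intro ballI)
  fix z w :: complex assume z: "z \<in> ball 0 1" and w: "w \<in> ball 0 1"
  have "((\<lambda>(m, n). of_nat (Suc m) * a (Suc m) n * z ^ m * w ^ n) has_sum deriv (\<lambda>z. f z w) z) (UNIV \<times> UNIV)"
  proof (rule has_sum_SigmaI)
    show "((\<lambda>m. of_nat (Suc m) * (\<Sum>\<^sub>\<infinity>n. a (Suc m) n * w ^ n) * z ^ m) has_sum deriv (\<lambda>z. f z w) z) UNIV"
      by (rule unit_disc_power_series_deriv[OF bidisc_expansion_slices(2)[OF f w] z])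
    show "((\<lambda>n. case (m, n) of (m, n) \<Rightarrow> of_nat (Suc m) * a (Suc m) n * z ^ m * w ^ n) has_sum
       of_nat (Suc m) * (\<Sum>\<^sub>\<infinity>n. a (Suc m) n * w ^ n) * z ^ m) UNIV" for m
      using has_sum_cmult_right[OF has_sum_infsum[OF bidisc_expansion_slices(1)[OF f w, of "Suc m"]],
          of "of_nat (Suc m) * z ^ m"]
      by (simp add: mult_ac del: of_nat_Suc)
    show "(\<lambda>(m, n). of_nat (Suc m) * a (Suc m) n * z ^ m * w ^ n) summable_on UNIV \<times> UNIV"
      using bidisc_expansion_slices(3)[OF f w z] by simp
  qed
  then show "((\<lambda>(m, n). of_nat (Suc m) * a (Suc m) n * z ^ m * w ^ n) has_sum deriv (\<lambda>z. f z w) z) UNIV"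
    by simp
qed

text \<open>A nonzero coefficient at a positive index would make the difference series nonvanishing
  on a punctured disc about 0, where it is zero by hypothesis; hence the contradictory
  \<open>0 \<noteq> 0\<close>. Index 0 is evaluation at the origin.\<close>

lemma unit_disc_power_series_unique:
  fixes c d :: "nat \<Rightarrow> complex"
  assumes c: "\<And>z. z \<in> ball 0 1 \<Longrightarrow> ((\<lambda>n. c n * z ^ n) has_sum F z) (UNIV :: nat set)"
    and d: "\<And>z. z \<in> ball 0 1 \<Longrightarrow> ((\<lambda>n. d n * z ^ n) has_sum F z) UNIV"
  shows "c = d"
proof -
  have sums: "(\<lambda>n. (c n - d n) * z ^ n) sums 0" if "norm z < 1" for z
    using sums_diff[OF has_sum_imp_sums[OF c[of z]] has_sum_imp_sums[OF d[of z]]] that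
    by (simp add: algebra_simps)
  have "c m - d m = 0" for m
  proof (rule ccontr)
    assume m: "c m - d m \<noteq> 0"
    show False
    proof (cases "m = 0")
      case True
      with m sums[of 0] show False by (auto simp: powser_sums_zero_iff)
    next
      case False
      have sm: "\<And>z. norm (z - 0) < 1 \<Longrightarrow> (\<lambda>n. (c n - d n) * (z - 0) ^ n) sums (0::complex)"
        using sums by simp
      obtain s where s: "0 < s" "\<And>z::complex. z \<in> cball 0 s - {0} \<Longrightarrow> (0::complex) \<noteq> 0"
        using powser_0_nonzero[OF zero_less_one sm refl m] False by (metis gr0I)
      from s(2)[of "of_real s"] s(1) show False by simp
    qed
  qed
  then show ?thesis by auto
qed

text \<open>One-variable uniqueness applied twice: first in \<open>z\<close>, with the row sums over
  \<open>n\<close> as coefficients, then to each row sum as a power series in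
  \<open>w\<close>.\<close>

lemma bidisc_expansion_unique:
  assumes a: "bidisc_expansion f a" and b: "bidisc_expansion f b"
  shows "a = b"
proof (intro ext)
  fix m n
  have "(\<Sum>\<^sub>\<infinity>n. a m n * w ^ n) = (\<Sum>\<^sub>\<infinity>n. b m n * w ^ n)" if "w \<in> ball 0 1" for w m
    using unit_disc_power_series_unique[OF bidisc_expansion_slices(2)[OF a that]
        bidisc_expansion_slices(2)[OF b that]]
    by (rule fun_cong)
  then have "((\<lambda>n. b m n * w ^ n) has_sum (\<Sum>\<^sub>\<infinity>n. a m n * w ^ n)) UNIV" if "w \<in> ball 0 1" for w
    using has_sum_infsum[OF bidisc_expansion_slices(1)[OF b that, of m]] that by simp
  then have "a m = b m"
    by (intro unit_disc_power_series_unique[OF has_sum_infsum[OF bidisc_expansion_slices(1)[OF a]]])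
  then show "a m n = b m n" by simp
qed

lemma taylor_coeff_eqI: "bidisc_expansion f a \<Longrightarrow> taylor_coeff f = a"
  unfolding taylor_coeff_def using bidisc_expansion_unique by blast

lemma bidisc_expansion_taylor_coeff:
  assumes "f \<in> dirichlet_bidisc" shows "bidisc_expansion f (taylor_coeff f)"
  using assms taylor_coeff_eqI by (auto simp: dirichlet_bidisc_def)

definition mixed_deriv :: "(complex \<Rightarrow> complex \<Rightarrow> complex) \<Rightarrow> complex \<Rightarrow> complex \<Rightarrow> complex" where
  "mixed_deriv f z w = deriv (\<lambda>w. deriv (\<lambda>z. f z w) z) w"

lemma bidisc_expansion_mixed_deriv:
  assumes "bidisc_expansion f a"
  shows "bidisc_expansion (mixed_deriv f) (\<lambda>m n. of_nat (Suc m) * of_nat (Suc n) * a (Suc m) (Suc n))"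
proof -
  have "bidisc_expansion (\<lambda>z w. mixed_deriv f z w)
      (\<lambda>m n. of_nat (Suc n) * (of_nat (Suc m) * a (Suc m) (Suc n)))"
    unfolding mixed_deriv_def
    using bidisc_expansion_swap[OF bidisc_expansion_deriv[OF bidisc_expansion_swap[OF
      bidisc_expansion_deriv[OF assms]]]] by simp
  then show ?thesis by (simp add: mult_ac del: of_nat_Suc)
qed

text \<open>Both orders of differentiation lead to the same double series.\<close>

lemma mixed_deriv_swap:
  assumes f: "bidisc_expansion f a" and z: "z \<in> ball 0 1" "w \<in> ball 0 1"
  shows "mixed_deriv f z w = deriv (\<lambda>z. deriv (\<lambda>w. f z w) w) z"
proof -
  have "((\<lambda>(m, n). of_nat (Suc m) * of_nat (Suc n) * a (Suc m) (Suc n) * z ^ m * w ^ n)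
      has_sum mixed_deriv f z w) UNIV"
    using bidisc_expansionD[OF bidisc_expansion_mixed_deriv[OF f] z] .
  moreover have "((\<lambda>(m, n). of_nat (Suc m) * of_nat (Suc n) * a (Suc m) (Suc n) * z ^ m * w ^ n)
      has_sum deriv (\<lambda>z. deriv (\<lambda>w. f z w) w) z) UNIV"
    using bidisc_expansionD[OF bidisc_expansion_swap[OF
        bidisc_expansion_mixed_deriv[OF bidisc_expansion_swap[OF f]]] z]
    unfolding mixed_deriv_def by (simp add: mult_ac case_prod_unfold del: of_nat_Suc)
  ultimately show ?thesis by (rule has_sum_unique)
qed

text \<open>Nothing is known about \<open>f\<close> outside the open bidisc, so measurability is
  obtained for the composite, as a pointwise limit of polynomials in \<open>u\<close> and
  \<open>v\<close>.\<close>

lemma bidisc_expansion_borel_measurable: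
  assumes f: "bidisc_expansion f a"
    and u: "u \<in> borel_measurable M" "\<And>x. x \<in> space M \<Longrightarrow> u x \<in> ball 0 1"
    and v: "v \<in> borel_measurable M" "\<And>x. x \<in> space M \<Longrightarrow> v x \<in> ball 0 1"
  shows "(\<lambda>x. f (u x) (v x)) \<in> borel_measurable M"
proof (rule borel_measurable_LIMSEQ_metric)
  show "(\<lambda>x. \<Sum>(m, n)\<in>{..<N} \<times> {..<N}. a m n * u x ^ m * v x ^ n) \<in> borel_measurable M" for N
    using u(1) v(1) by (simp add: case_prod_unfold)
  fix x assume x: "x \<in> space M"
  \<comment> \<open>The squares eventually contain any finite set of indices, so the unconditional
    sum is also the limit along this sequence.\<close>
  have "filterlim (\<lambda>N. {..<N} \<times> {..<N}) (finite_subsets_at_top (UNIV :: (nat \<times> nat) set)) sequentially"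
    unfolding filterlim_finite_subsets_at_top
  proof safe
    fix X :: "(nat \<times> nat) set" assume X: "finite X"
    then obtain K where K: "\<And>i. i \<in> fst ` X \<union> snd ` X \<Longrightarrow> i < K"
      using finite_nat_set_iff_bounded[of "fst ` X \<union> snd ` X"] by blast
    show "\<forall>\<^sub>F y in sequentially. finite ({..<y} \<times> {..<y}) \<and> X \<subseteq> {..<y} \<times> {..<y} \<and>
        {..<y} \<times> {..<y} \<subseteq> UNIV"
      using eventually_ge_at_top[of K]
    proof eventually_elim
      case (elim y)
      with K show ?case by (force simp: subset_iff)
    qed
  qed
  then show "(\<lambda>N. \<Sum>(m, n)\<in>{..<N} \<times> {..<N}. a m n * u x ^ m * v x ^ n) \<longlonglongrightarrow> f (u x) (v x)"
    using bidisc_expansionD[OF f u(2)[OF x] v(2)[OF x]]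
    unfolding has_sum_def by (rule filterlim_compose[rotated])
qed

subsection \<open>Dyadic arcs\<close>

lemma arc_index_Nil [simp]: "arc_index [] = 0"
  by (simp add: arc_index_def)

lemma arc_index_snoc [simp]: "arc_index (\<alpha> @ [b]) = 2 * arc_index \<alpha> + of_bool b"
  by (simp add: arc_index_def)

lemma arc_index_less: "arc_index \<alpha> < 2 ^ length \<alpha>"
  by (induction \<alpha> rule: rev_induct) auto

lemma inj_on_arc_index: "inj_on arc_index {\<alpha>. length \<alpha> = j}"
proof (induction j)
  case (Suc j)
  show ?case
  proof (rule inj_onI, clarsimp)
    fix \<alpha> \<beta> :: vertex
    assume len: "length \<alpha> = Suc j" "length \<beta> = Suc j" and eq: "arc_index \<alpha> = arc_index \<beta>"
    then obtain \<alpha>' b \<beta>' c where 1: "\<alpha> = \<alpha>' @ [b]" "\<beta> = \<beta>' @ [c]"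
      by (metis length_Suc_conv_rev)
    with eq have "2 * arc_index \<alpha>' + of_bool b = 2 * arc_index \<beta>' + of_bool c" by simp
    then have "b = c" "arc_index \<alpha>' = arc_index \<beta>'" by (cases b; cases c; simp; presburger)+
    with Suc len 1 show "\<alpha> = \<beta>" by (auto dest!: inj_onD)
  qed
qed auto

text \<open>Vertices of generation \<open>j\<close>, read as binary numerals, exhaust the numbers
  below \<open>2 ^ j\<close>; a sum over a generation thereby becomes a sum over roots of unity of
  that order.\<close>

lemma bij_betw_arc_index: "bij_betw arc_index {\<alpha>. length \<alpha> = j} {..<2 ^ j}"
proof -
  have fin: "finite {\<alpha> :: vertex. length \<alpha> = j}" and card: "card {\<alpha> :: vertex. length \<alpha> = j} = 2 ^ j"
    using finite_lists_length_eq[of "UNIV :: bool set" j] card_lists_length_eq[of "UNIV :: bool set" j]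
    by auto
  have "arc_index ` {\<alpha>. length \<alpha> = j} \<subseteq> {..<2 ^ j}" using arc_index_less by auto
  then have "arc_index ` {\<alpha>. length \<alpha> = j} = {..<2 ^ j}"
    by (rule card_subset_eq[rotated]) (simp_all add: card_image inj_on_arc_index card)
  then show ?thesis by (simp add: bij_betw_def inj_on_arc_index)
qed

text \<open>Arcs measured in full turns: intervals of the line instead of the circle, so that the
  identification of 0 with 1 is the only wrap-around left to treat.\<close>

definition dyadic_interval :: "vertex \<Rightarrow> real set" where
  "dyadic_interval \<alpha> = {real (arc_index \<alpha>) / 2 ^ length \<alpha> .. (real (arc_index \<alpha>) + 1) / 2 ^ length \<alpha>}"

lemma arc_eq: "arc \<alpha> = (\<lambda>x. cis (2 * pi * x)) ` dyadic_interval \<alpha>"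
proof -
  have "s \<in> {2 * pi * a .. 2 * pi * b} \<longleftrightarrow> (\<exists>x\<in>{a..b}. s = 2 * pi * x)" for s a b :: real
  proof
    assume "s \<in> {2 * pi * a .. 2 * pi * b}"
    then show "\<exists>x\<in>{a..b}. s = 2 * pi * x"
      by (intro bexI[of _ "s / (2 * pi)"]) (auto simp: field_simps)
  qed auto
  from this[of _ "real (arc_index \<alpha>) / 2 ^ length \<alpha>" "(real (arc_index \<alpha>) + 1) / 2 ^ length \<alpha>"]
  show ?thesis by (fastforce simp: arc_def dyadic_interval_def image_def)
qed

lemma mem_dyadic_interval_iff:
  "x \<in> dyadic_interval \<alpha> \<longleftrightarrow> real (arc_index \<alpha>) \<le> 2 ^ length \<alpha> * x \<and> 2 ^ length \<alpha> * x \<le> real (arc_index \<alpha>) + 1"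
  by (auto simp: dyadic_interval_def field_simps)

lemma dyadic_interval_subset: "dyadic_interval \<alpha> \<subseteq> {0..1}"
proof -
  have "real (arc_index \<alpha>) + 1 \<le> 2 ^ length \<alpha>"
    using arc_index_less[of \<alpha>] by (metis Suc_eq_plus1 Suc_leI of_nat_1 of_nat_add of_nat_le_iff of_nat_numeral of_nat_power)
  then have "(real (arc_index \<alpha>) + 1) / 2 ^ length \<alpha> \<le> 1" by simp
  then show ?thesis unfolding dyadic_interval_def by (auto intro: order_trans)
qed

lemma dyadic_interval_append: "dyadic_interval (\<alpha> @ \<beta>) \<subseteq> dyadic_interval \<alpha>"
proof (induction \<beta> rule: rev_induct)
  case (snoc b \<beta>)
  have "dyadic_interval ((\<alpha> @ \<beta>) @ [b]) \<subseteq> dyadic_interval (\<alpha> @ \<beta>)"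
    unfolding mem_dyadic_interval_iff subset_iff arc_index_snoc by (cases b) auto
  with snoc show ?case by simp
qed auto

lemma dyadic_interval_antimono: "prefix \<beta> \<alpha> \<Longrightarrow> dyadic_interval \<alpha> \<subseteq> dyadic_interval \<beta>"
  by (metis dyadic_interval_append prefixE)

lemma arc_antimono: "prefix \<beta> \<alpha> \<Longrightarrow> arc \<alpha> \<subseteq> arc \<beta>"
  unfolding arc_eq using dyadic_interval_antimono by blast

lemma compact_arc: "compact (arc \<alpha>)"
  unfolding arc_eq dyadic_interval_def
  by (intro compact_continuous_image continuous_intros compact_Icc)

lemma arc_nonempty: "arc \<alpha> \<noteq> {}"
  unfolding arc_eq dyadic_interval_def by (auto simp: divide_right_mono)

lemma arc_subset_sphere: "arc \<alpha> \<subseteq> sphere 0 1"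
  by (auto simp: arc_eq)

lemma norm_cis_diff_le: "norm (cis s - cis t) \<le> \<bar>s - t\<bar>"
proof -
  have "cis s - cis t = cis t * (exp (\<i> * of_real (s - t)) - 1)"
    by (simp add: cis_conv_exp algebra_simps flip: exp_add)
  then have "norm (cis s - cis t) = norm (exp (\<i> * of_real (s - t)) - 1)"
    by (simp add: norm_mult)
  also have "\<dots> = 2 * \<bar>sin ((s - t) / 2)\<bar>" by (rule dist_exp_i_1)
  also have "\<dots> \<le> \<bar>s - t\<bar>" using abs_sin_x_le_abs_x[of "(s - t) / 2"] by simp
  finally show ?thesis .
qed

lemma norm_diff_arc_le:
  assumes "z \<in> arc \<alpha>" "w \<in> arc \<alpha>" shows "norm (z - w) \<le> 2 * pi / 2 ^ length \<alpha>"
proof -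
  obtain x y where x: "x \<in> dyadic_interval \<alpha>" "z = cis (2 * pi * x)"
    and y: "y \<in> dyadic_interval \<alpha>" "w = cis (2 * pi * y)"
    using assms by (auto simp: arc_eq)
  have "\<bar>x - y\<bar> \<le> 1 / 2 ^ length \<alpha>"
    using x(1) y(1) by (auto simp: dyadic_interval_def add_divide_distrib)
  moreover have "norm (z - w) \<le> 2 * pi * \<bar>x - y\<bar>"
    using norm_cis_diff_le[of "2 * pi * x" "2 * pi * y"] x y
    by (simp add: abs_mult flip: right_diff_distrib)
  ultimately show ?thesis
    using mult_left_mono[of "\<bar>x - y\<bar>" "1 / 2 ^ length \<alpha>" "2 * pi"] by simp
qed

definition turn :: "complex \<Rightarrow> real" where
  "turn z = Arg2pi z / (2 * pi)"

lemma turn_bounds: "0 \<le> turn z" "turn z < 1"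
  using Arg2pi[of z] by (auto simp: turn_def)

lemma cis_turn: "of_real (norm z) * cis (2 * pi * turn z) = z"
  using Arg2pi_eq[of z] by (simp add: turn_def cis_conv_exp)

text \<open>\<open>Arg2pi\<close> jumps across the nonnegative reals; it vanishes on this closed set
  and is continuous off it.\<close>

lemma borel_measurable_turn [measurable]: "turn \<in> borel_measurable borel"
proof -
  have eq: "Arg2pi = (\<lambda>z. if z \<in> \<real>\<^sub>\<ge>\<^sub>0 then 0 else Arg2pi z)"
    by (auto simp: fun_eq_iff Arg2pi_eq_0 complex_nonneg_Reals_iff complex_is_Real_iff)
  have "Arg2pi \<in> borel_measurable borel"
    by (subst eq, rule borel_measurable_continuous_on_if)
       (auto intro!: borel_closed continuous_at_imp_continuous_on continuous_at_Arg2pi closed_nonneg_Reals_complex)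
  then show ?thesis unfolding turn_def[abs_def] by measurable
qed

lemma cis_2pi_eq_iff:
  assumes "0 \<le> x" "x < 1" "0 \<le> y" "y \<le> 1"
  shows "cis (2 * pi * y) = cis (2 * pi * x) \<longleftrightarrow> y = x \<or> x = 0 \<and> y = 1"
proof
  assume "cis (2 * pi * y) = cis (2 * pi * x)"
  then obtain n :: int where "\<i> * of_real (2 * pi * y) = \<i> * of_real (2 * pi * x) + (of_int (2 * n) * pi) * \<i>"
    unfolding cis_conv_exp exp_eq by auto
  then have "\<i> * of_real (2 * pi * y) = \<i> * of_real (2 * pi * x + 2 * pi * n)"
    by (simp add: algebra_simps)
  then have "2 * pi * y = 2 * pi * x + 2 * pi * n"
    by (metis complex_i_not_zero mult_left_cancel of_real_eq_iff)
  then have "2 * pi * y = 2 * pi * (x + n)" by (simp add: algebra_simps)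
  then have y: "y = x + n" by simp
  with assms have "real_of_int n < 2" "-1 < real_of_int n" by linarith+
  then have "n = 0 \<or> n = 1" by linarith
  with y assms show "y = x \<or> x = 0 \<and> y = 1" by auto
qed auto

text \<open>\<open>turn\<close> takes values in [0, 1), so the last arc of a generation meets the
  angle 0 through its right end 1.\<close>

lemma mem_arc_iff:
  assumes "z \<in> sphere 0 1"
  shows "z \<in> arc \<alpha> \<longleftrightarrow> turn z \<in> dyadic_interval \<alpha> \<or> turn z = 0 \<and> 1 \<in> dyadic_interval \<alpha>"
proof -
  have z: "z = cis (2 * pi * turn z)" using cis_turn[of z] assms by simp
  have "z \<in> arc \<alpha> \<longleftrightarrow> (\<exists>y\<in>dyadic_interval \<alpha>. cis (2 * pi * y) = cis (2 * pi * turn z))"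
    unfolding arc_eq using z by auto
  also have "\<dots> \<longleftrightarrow> (\<exists>y\<in>dyadic_interval \<alpha>. y = turn z \<or> turn z = 0 \<and> y = 1)"
    by (intro bex_cong refl cis_2pi_eq_iff turn_bounds) (use dyadic_interval_subset in fastforce)+
  finally show ?thesis by auto
qed

subsection \<open>Boxes\<close>

lemma compact_box:
  "compact {of_real \<rho> * u | \<rho> u. u \<in> arc \<alpha> \<and> a \<le> \<rho> \<and> \<rho> \<le> (b :: real)}"
proof -
  have "{of_real \<rho> * u | \<rho> u. u \<in> arc \<alpha> \<and> a \<le> \<rho> \<and> \<rho> \<le> b} = (\<lambda>(\<rho>, u). of_real \<rho> * u) ` ({a..b} \<times> arc \<alpha>)"
    by (fastforce simp: image_def)
  then show ?thesis
    by (auto simp: case_prod_unfold intro!: compact_continuous_image compact_Times compact_arc continuous_intros)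
qed

lemma whitney_box_eq:
  "whitney_box \<alpha> = {of_real \<rho> * u | \<rho> u. u \<in> arc \<alpha> \<and> 1 - 1 / 2 ^ length \<alpha> \<le> \<rho> \<and> \<rho> \<le> 1 - 1 / 2 ^ Suc (length \<alpha>)}"
proof -
  have "1 / 2 ^ (length \<alpha> + 1) \<le> 1 - \<rho> \<and> 1 - \<rho> \<le> 1 / 2 ^ length \<alpha> \<longleftrightarrow>
      1 - 1 / 2 ^ length \<alpha> \<le> \<rho> \<and> \<rho> \<le> 1 - 1 / 2 ^ Suc (length \<alpha>)" for \<rho> :: real
    unfolding Suc_eq_plus1 by linarith
  then show ?thesis unfolding whitney_box_def by simp
qed

lemma compact_whitney_box: "compact (whitney_box \<alpha>)"
  unfolding whitney_box_eq by (rule compact_box)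

lemma norm_whitney_box:
  assumes "z \<in> whitney_box \<alpha>"
  shows "1 - 1 / 2 ^ length \<alpha> \<le> norm z" "norm z \<le> 1 - 1 / 2 ^ Suc (length \<alpha>)" "norm z < 1"
proof -
  obtain \<rho> u where z: "z = of_real \<rho> * u" "u \<in> arc \<alpha>" "1 - 1 / 2 ^ length \<alpha> \<le> \<rho>" "\<rho> \<le> 1 - 1 / 2 ^ Suc (length \<alpha>)"
    using assms by (auto simp: whitney_box_eq)
  have "(1::real) / 2 ^ length \<alpha> \<le> 1" by simp
  with z(3) have "0 \<le> \<rho>" by linarith
  moreover have "norm u = 1" using arc_subset_sphere z(2) by force
  ultimately have "norm z = \<rho>" using z(1) by (simp add: norm_mult)
  with z show "1 - 1 / 2 ^ length \<alpha> \<le> norm z" "norm z \<le> 1 - 1 / 2 ^ Suc (length \<alpha>)" by auto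
  moreover have "(0::real) < 1 / 2 ^ Suc (length \<alpha>)" by simp
  ultimately show "norm z < 1" by linarith
qed

text \<open>The region below a vertex: the union of the boxes of its descendants, closed up at the circle.\<close>

definition carleson_box :: "vertex \<Rightarrow> complex set" where
  "carleson_box \<alpha> = {of_real \<rho> * u | \<rho> u. u \<in> arc \<alpha> \<and> 1 - 1 / 2 ^ length \<alpha> \<le> \<rho> \<and> \<rho> \<le> 1}"

lemma compact_carleson_box: "compact (carleson_box \<alpha>)"
  unfolding carleson_box_def by (rule compact_box)

lemma whitney_box_subset_carleson_box:
  assumes "prefix \<beta> \<alpha>" shows "whitney_box \<alpha> \<subseteq> carleson_box \<beta>"
proof
  fix z assume "z \<in> whitney_box \<alpha>"
  then obtain \<rho> u where z: "z = of_real \<rho> * u" "u \<in> arc \<alpha>" "1 - 1 / 2 ^ length \<alpha> \<le> \<rho>" "\<rho> \<le> 1 - 1 / 2 ^ Suc (length \<alpha>)"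
    by (auto simp: whitney_box_eq)
  have "(2::real) ^ length \<beta> \<le> 2 ^ length \<alpha>"
    using prefix_length_le[OF assms] by (intro power_increasing) auto
  then have "(1::real) / 2 ^ length \<alpha> \<le> 1 / 2 ^ length \<beta>" by (simp add: frac_le)
  moreover have "(0::real) < 1 / 2 ^ Suc (length \<alpha>)" by simp
  ultimately have "1 - 1 / 2 ^ length \<beta> \<le> \<rho>" "\<rho> \<le> 1" using z(3,4) by linarith+
  moreover have "u \<in> arc \<beta>" using z(2) arc_antimono[OF assms] by blast
  ultimately show "z \<in> carleson_box \<beta>" unfolding carleson_box_def z(1) by blast
qed

subsection \<open>Ends\<close>

lemma end_vertex_Suc: "end_vertex \<omega> (Suc j) = end_vertex \<omega> j @ [\<omega> j]"
  by (simp add: end_vertex_def)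

lemma end_vertex_0 [simp]: "end_vertex \<omega> 0 = []"
  by (simp add: end_vertex_def)

lemma prefix_end_vertex: "i \<le> j \<Longrightarrow> prefix (end_vertex \<omega> i) (end_vertex \<omega> j)"
  by (metis min.absorb1 take_end_vertex take_is_prefix)

text \<open>Nested compact arcs have a common point, and their diameters tend to 0, so the definite
  description in \<open>end_point\<close> denotes.\<close>

lemma end_point_eq_iff: "end_point \<omega> = z \<longleftrightarrow> (\<forall>j. z \<in> arc (end_vertex \<omega> j))"
proof -
  have "(\<Inter>j. arc (end_vertex \<omega> j)) \<noteq> {}"
    by (rule compact_nest) (auto simp: compact_arc arc_nonempty dest: set_mp[OF arc_antimono[OF prefix_end_vertex]])
  then obtain x where x: "\<And>j. x \<in> arc (end_vertex \<omega> j)" by auto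
  have unique: "y = x" if y: "\<And>j. y \<in> arc (end_vertex \<omega> j)" for y
  proof (rule ccontr)
    assume "y \<noteq> x"
    then have "0 < norm (y - x) / (2 * pi)" by simp
    then obtain j where "(1 / 2) ^ j < norm (y - x) / (2 * pi)"
      using real_arch_pow_inv[of "norm (y - x) / (2 * pi)" "1/2"] by auto
    moreover have "norm (y - x) \<le> 2 * pi / 2 ^ j"
      using norm_diff_arc_le[OF y x, of j] by simp
    ultimately show False by (simp add: power_one_over field_simps)
  qed
  have "end_point \<omega> = x"
    unfolding end_point_def by (rule the_equality) (use x unique in auto)
  then show ?thesis using x unique by metis
qed

text \<open>The two binary expansions of a number: \<open>floor_end\<close> follows dyadic intervals
  closed on the left, \<open>ceil_end\<close> those closed on the right. Inside (0, 1) they differ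
  exactly at the dyadic rationals.\<close>

definition floor_end :: "real \<Rightarrow> nat \<Rightarrow> bool" where
  "floor_end x i = odd \<lfloor>2 ^ Suc i * x\<rfloor>"

definition ceil_end :: "real \<Rightarrow> nat \<Rightarrow> bool" where
  "ceil_end x i = odd (\<lceil>2 ^ Suc i * x\<rceil> - 1)"

lemma arc_index_floor_end:
  assumes "0 \<le> x" "x < 1" shows "int (arc_index (end_vertex (floor_end x) j)) = \<lfloor>2 ^ j * x\<rfloor>"
proof (induction j)
  case 0
  then show ?case using assms by (simp add: floor_eq_iff)
next
  case (Suc j)
  have "\<lfloor>2 ^ Suc j * x\<rfloor> = 2 * \<lfloor>2 ^ j * x\<rfloor> + of_bool (odd \<lfloor>2 ^ Suc j * x\<rfloor>)"
  proof -
    have "\<lfloor>2 * (2 ^ j * x)\<rfloor> = 2 * \<lfloor>2 ^ j * x\<rfloor> \<or> \<lfloor>2 * (2 ^ j * x)\<rfloor> = 2 * \<lfloor>2 ^ j * x\<rfloor> + 1"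
      by linarith
    then show ?thesis by (auto simp: mult.assoc)
  qed
  then show ?case using Suc by (simp add: end_vertex_Suc floor_end_def)
qed

lemma arc_index_ceil_end:
  assumes "0 < x" "x \<le> 1" shows "int (arc_index (end_vertex (ceil_end x) j)) = \<lceil>2 ^ j * x\<rceil> - 1"
proof (induction j)
  case 0
  then show ?case using assms by (simp add: ceiling_eq_iff)
next
  case (Suc j)
  have "\<lceil>2 ^ Suc j * x\<rceil> - 1 = 2 * (\<lceil>2 ^ j * x\<rceil> - 1) + of_bool (odd (\<lceil>2 ^ Suc j * x\<rceil> - 1))"
  proof -
    have "\<lceil>2 * (2 ^ j * x)\<rceil> \<le> 2 * \<lceil>2 ^ j * x\<rceil>" "2 * \<lceil>2 ^ j * x\<rceil> - 1 \<le> \<lceil>2 * (2 ^ j * x)\<rceil>"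
      by linarith+
    moreover have "p - 1 = 2 * (q - 1) \<or> p - 1 = 2 * (q - 1) + 1" if "p \<le> 2 * q" "2 * q - 1 \<le> p" for p q :: int
      using that by presburger
    ultimately have "\<lceil>2 * (2 ^ j * x)\<rceil> - 1 = 2 * (\<lceil>2 ^ j * x\<rceil> - 1) \<or> \<lceil>2 * (2 ^ j * x)\<rceil> - 1 = 2 * (\<lceil>2 ^ j * x\<rceil> - 1) + 1"
      by blast
    then show ?thesis by (auto simp: mult.assoc)
  qed
  then show ?case using Suc by (simp add: end_vertex_Suc ceil_end_def)
qed

lemma end_eqI:
  assumes "\<And>j. arc_index (end_vertex \<omega> j) = arc_index (end_vertex \<omega>' j)"
  shows "\<omega> = \<omega>'"
proof (rule end_vertex_inject)
  fix j show "end_vertex \<omega> j = end_vertex \<omega>' j"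
    using inj_onD[OF inj_on_arc_index assms[of j]] by auto
qed

lemma floor_end_in_interval: "0 \<le> x \<Longrightarrow> x < 1 \<Longrightarrow> x \<in> dyadic_interval (end_vertex (floor_end x) j)"
  using arc_index_floor_end[of x j] unfolding mem_dyadic_interval_iff by simp linarith

lemma ceil_end_in_interval: "0 < x \<Longrightarrow> x \<le> 1 \<Longrightarrow> x \<in> dyadic_interval (end_vertex (ceil_end x) j)"
  using arc_index_ceil_end[of x j] unfolding mem_dyadic_interval_iff by simp linarith

text \<open>If \<open>x\<close> is never the right end of its intervals, the indices are forced to
  be floors. Otherwise it is a right end once, hence never a left end, and the indices are ceilings
  minus one.\<close>

lemma dyadic_intervals_imp_end:
  assumes x: "\<And>j. x \<in> dyadic_interval (end_vertex \<omega> j)"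
  shows "x < 1 \<and> \<omega> = floor_end x \<or> 0 < x \<and> \<omega> = ceil_end x"
proof -
  define k where "k j = arc_index (end_vertex \<omega> j)" for j
  have bounds: "0 \<le> x" "x \<le> 1" using x[of 0] by (auto simp: mem_dyadic_interval_iff)
  have k: "real (k j) \<le> 2 ^ j * x" "2 ^ j * x \<le> real (k j) + 1" for j
    using x[of j] by (auto simp: mem_dyadic_interval_iff k_def)
  have step: "real (k (Suc j)) \<le> 2 * real (k j) + 1" "2 * real (k j) \<le> real (k (Suc j))" for j
    by (auto simp: k_def end_vertex_Suc)
  show ?thesis
  proof (cases "\<forall>j. 2 ^ j * x < real (k j) + 1")
    case True
    have "k 0 = 0" by (simp add: k_def)
    with True have "x < 1" by (metis add_0 mult_1 of_nat_0 power_0)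
    moreover have "\<omega> = floor_end x"
    proof (rule end_eqI)
      fix j
      have "\<lfloor>2 ^ j * x\<rfloor> = int (k j)" using k[of j] True by (auto simp: floor_eq_iff)
      then show "arc_index (end_vertex \<omega> j) = arc_index (end_vertex (floor_end x) j)"
        using arc_index_floor_end[of x j] bounds \<open>x < 1\<close> by (simp add: k_def)
    qed
    ultimately show ?thesis by simp
  next
    case False
    then obtain j0 where "2 ^ j0 * x = real (k j0) + 1" using k by (meson antisym not_le)
    \<comment> \<open>Being a left end, or a right end, is inherited by all later generations, so a
      left end at \<open>j\<close> and a right end at \<open>j0\<close> would clash at the later of
      the two.\<close>
    have ne: "2 ^ j * x \<noteq> real (k j)" for j
    proof
      assume e: "2 ^ j * x = real (k j)"
      show False
      proof (cases "j \<le> j0")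
        case True
        have "2 ^ i * x = real (k i)" if "j \<le> i" for i
          using that
        proof (induction i rule: dec_induct)
          case (step i)
          then have "2 ^ Suc i * x = 2 * real (k i)" by simp
          also have "\<dots> \<le> real (k (Suc i))" by fact
          finally show ?case using k(1)[of "Suc i"] by simp
        qed (fact e)
        from this[OF True] \<open>2 ^ j0 * x = real (k j0) + 1\<close> show False by simp
      next
        case False
        have "2 ^ i * x = real (k i) + 1" if "j0 \<le> i" for i
          using that
        proof (induction i rule: dec_induct)
          case (step i)
          then have "2 ^ Suc i * x = 2 * real (k i) + 2" by simp
          moreover have "real (k (Suc i)) \<le> 2 * real (k i) + 1" by fact
          ultimately show ?case using k(2)[of "Suc i"] by simp
        qed (fact)
        from this[of j] False e show False by simp
      qed
    qed
    have "0 < x" using ne[of 0] bounds by (simp add: k_def)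
    moreover have "\<omega> = ceil_end x"
    proof (rule end_eqI)
      fix j
      have "\<lceil>2 ^ j * x\<rceil> = int (k j) + 1" using k[of j] ne[of j] by (auto simp: ceiling_eq_iff)
      then show "arc_index (end_vertex \<omega> j) = arc_index (end_vertex (ceil_end x) j)"
        using arc_index_ceil_end[of x j] bounds \<open>0 < x\<close> by (simp add: k_def)
    qed
    ultimately show ?thesis by simp
  qed
qed

text \<open>Upper expansions live on (0, 1], so the point with angle 0 is given the angle 1 there;
  its two ends are the leftmost and the rightmost one.\<close>

definition end_section :: "bool \<Rightarrow> complex \<Rightarrow> cltree" where
  "end_section b z = End (if b then floor_end (turn z) else ceil_end (if turn z = 0 then 1 else turn z))"

lemma end_fibre_eq:
  assumes z: "z \<in> sphere 0 1"
  shows "end_fibre z = range (\<lambda>b. end_section b z)"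
proof -
  define x where "x = turn z"
  define y where "y = (if x = 0 then 1 else x)"
  have x: "0 \<le> x" "x < 1" using turn_bounds by (auto simp: x_def)
  then have y: "0 < y" "y \<le> 1" by (auto simp: y_def)
  have iff: "end_point \<omega> = z \<longleftrightarrow> \<omega> = floor_end x \<or> \<omega> = ceil_end y" for \<omega>
  proof
    assume "end_point \<omega> = z"
    then have *: "x \<in> dyadic_interval (end_vertex \<omega> j) \<or> x = 0 \<and> 1 \<in> dyadic_interval (end_vertex \<omega> j)" for j
      unfolding end_point_eq_iff mem_arc_iff[OF z] x_def by blast
    \<comment> \<open>At angle 0 each generation separately might use 0 or 1. Since a failure
      persists in later generations, the choice is uniform.\<close>
    have "(\<forall>j. x \<in> dyadic_interval (end_vertex \<omega> j)) \<or> x = 0 \<and> (\<forall>j. 1 \<in> dyadic_interval (end_vertex \<omega> j))"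
    proof (rule ccontr)
      assume "\<not> ?thesis"
      with * obtain i j where "x \<notin> dyadic_interval (end_vertex \<omega> i)" "x = 0" "1 \<notin> dyadic_interval (end_vertex \<omega> j)"
        by blast
      then have "x \<notin> dyadic_interval (end_vertex \<omega> (max i j))" "1 \<notin> dyadic_interval (end_vertex \<omega> (max i j))"
        using dyadic_interval_antimono[OF prefix_end_vertex] by (meson max.cobounded1 max.cobounded2 subsetD)+
      with * show False by blast
    qed
    with dyadic_intervals_imp_end show "\<omega> = floor_end x \<or> \<omega> = ceil_end y"
      unfolding y_def by (metis less_irrefl)
  next
    assume "\<omega> = floor_end x \<or> \<omega> = ceil_end y"
    then have "(\<forall>j. x \<in> dyadic_interval (end_vertex \<omega> j)) \<or> (\<forall>j. y \<in> dyadic_interval (end_vertex \<omega> j))"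
      using floor_end_in_interval[OF x] ceil_end_in_interval[OF y] by blast
    then show "end_point \<omega> = z"
      unfolding end_point_eq_iff mem_arc_iff[OF z] x_def[symmetric] y_def by (auto split: if_splits)
  qed
  show ?thesis
    unfolding end_fibre_def iff end_section_def x_def y_def by (auto simp: UNIV_bool)
qed

subsection \<open>Topology of the tree with its boundary\<close>

lemma confluent_weight_nonneg: "0 \<le> confluent_weight x y"
  by (simp add: confluent_weight_def)

lemma confluent_weight_below:
  assumes "x \<le> Vertex \<alpha>" "y \<le> Vertex \<alpha>"
  shows "confluent_weight x y \<le> (1/2) ^ Suc (length \<alpha>)"
proof -
  have "confluent_weight x y \<le> confluent_weight (Vertex \<alpha>) (Vertex \<alpha>)"
    using assms by (intro confluent_weight_antimono) (auto simp: common_ancestors_def intro: ancestor_closed)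
  also have "common_ancestors (Vertex \<alpha>) (Vertex \<alpha>) = set (prefixes \<alpha>)"
    by (auto simp: ancestors_Vertex)
  then have "confluent_weight (Vertex \<alpha>) (Vertex \<alpha>) = (1/2) ^ Suc (length \<alpha>)"
    by (simp add: confluent_weight_def)
  finally show ?thesis .
qed

lemma confluent_weight_separated:
  assumes "x \<le> Vertex \<alpha>" "\<not> y \<le> Vertex \<alpha>"
  shows "(1/2) ^ length \<alpha> \<le> confluent_weight x y"
proof -
  have sub: "common_ancestors x y \<subseteq> set (prefixes \<alpha>) - {\<alpha>}"
  proof
    fix \<beta> assume "\<beta> \<in> common_ancestors x y"
    then have \<beta>: "x \<le> Vertex \<beta>" "y \<le> Vertex \<beta>" by (auto simp: common_ancestors_def)
    with assms ancestor_linear[OF assms(1) \<beta>(1)] ancestor_closed[OF \<beta>(2)]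
    show "\<beta> \<in> set (prefixes \<alpha>) - {\<alpha>}" by auto
  qed
  then have fin: "finite (common_ancestors x y)" by (rule finite_subset) auto
  have "card (common_ancestors x y) \<le> card (set (prefixes \<alpha>) - {\<alpha>})"
    by (rule card_mono[OF _ sub]) auto
  then have "card (common_ancestors x y) \<le> length \<alpha>" by simp
  with fin show ?thesis by (simp add: confluent_weight_def power_decreasing)
qed

text \<open>The common weight of two points parted at \<open>\<alpha>\<close> is at least
  \<open>(1/2) ^ length \<alpha>\<close>, while the own weight of \<open>x\<close> is at most half
  of that. The uniform gap makes the set below a vertex both open and closed.\<close>

lemma dist_cltree_separated:
  assumes x: "x \<le> Vertex \<alpha>" and y: "\<not> y \<le> Vertex \<alpha>"
  shows "(1/2) ^ length \<alpha> / 4 \<le> dist x y"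
proof -
  have arith: "p / 4 \<le> c - (a + b) / 2" if "b \<le> c" "a \<le> p / 2" "p \<le> c" for a b c p :: real
    using that by argo
  have "confluent_weight y y \<le> confluent_weight x y"
    using confluent_weight_self_le[of y x] unfolding confluent_weight_def common_ancestors_commute[of y x] .
  moreover have "confluent_weight x x \<le> (1/2) ^ length \<alpha> / 2"
    using confluent_weight_below[OF x x] by simp
  ultimately show ?thesis
    using arith[OF _ _ confluent_weight_separated[OF x y]] unfolding dist_cltree_def by blast
qed

definition descendants :: "vertex \<Rightarrow> cltree set" where
  "descendants \<alpha> = {x. x \<le> Vertex \<alpha>}"

lemma open_descendants: "open (descendants \<alpha>)"
  unfolding open_dist descendants_def
  by (intro ballI exI[of _ "(1/2) ^ length \<alpha> / 4"])
     (use dist_cltree_separated in \<open>fastforce simp: dist_commute\<close>)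

lemma closed_descendants: "closed (descendants \<alpha>)"
  unfolding closed_def open_dist descendants_def
  by (intro ballI exI[of _ "(1/2) ^ length \<alpha> / 4"])
     (use dist_cltree_separated in \<open>fastforce simp: dist_commute\<close>)

text \<open>A point strictly below a vertex, be it a vertex or an end, lies below one of its two
  children. Vertices are therefore isolated points.\<close>

lemma singleton_Vertex: "{Vertex \<alpha>} = descendants \<alpha> - (descendants (\<alpha> @ [False]) \<union> descendants (\<alpha> @ [True]))"
proof -
  have "x = Vertex \<alpha> \<or> x \<le> Vertex (\<alpha> @ [b])" if "x \<le> Vertex \<alpha>" "\<not> x \<le> Vertex (\<alpha> @ [\<not> b])" for x b
  proof (cases x)
    case (Vertex \<beta>)
    with that obtain \<gamma> where "\<beta> = \<alpha> @ \<gamma>" by (auto elim: prefixE)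
    with that Vertex show ?thesis by (cases \<gamma>) (auto simp: prefix_def)
  next
    case (End \<omega>)
    with that obtain j where "\<alpha> = end_vertex \<omega> j" by auto
    then have *: "\<alpha> @ [\<omega> j] = end_vertex \<omega> (Suc j)" by (simp add: end_vertex_Suc)
    then have "x \<le> Vertex (\<alpha> @ [\<omega> j])" unfolding End by auto
    with that show ?thesis by (cases b; cases "\<omega> j") auto
  qed
  from this[of _ True] show ?thesis by (auto simp: descendants_def)
qed

lemma open_singleton_Vertex: "open {Vertex \<alpha>}"
  by (subst singleton_Vertex) (rule open_Diff[OF open_descendants closed_Un[OF closed_descendants closed_descendants]])

definition cltree_basis :: "cltree set set" where
  "cltree_basis = range descendants \<union> range (\<lambda>\<alpha>. {Vertex \<alpha>})"

lemma topological_basis_cltree: "topological_basis cltree_basis"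
proof (rule topological_basisI)
  show "open B" if "B \<in> cltree_basis" for B
    using that open_descendants open_singleton_Vertex by (auto simp: cltree_basis_def)
  fix U :: "cltree set" and x assume U: "open U" "x \<in> U"
  show "\<exists>B\<in>cltree_basis. x \<in> B \<and> B \<subseteq> U"
  proof (cases x)
    case (Vertex \<alpha>)
    with U show ?thesis by (intro bexI[of _ "{Vertex \<alpha>}"]) (auto simp: cltree_basis_def)
  next
    case (End \<omega>)
    obtain e where e: "0 < e" "\<And>y. dist y x < e \<Longrightarrow> y \<in> U"
      using U by (auto simp: open_dist)
    obtain j where j: "(1/2) ^ j < e" using real_arch_pow_inv[of e "1/2"] e by auto
    have "y \<in> U" if "y \<le> Vertex (end_vertex \<omega> j)" for y
    proof (rule e)
      have "x \<le> Vertex (end_vertex \<omega> j)" using End by auto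
      have arith: "c - (a + b) / 2 \<le> p" if "c \<le> p" "0 \<le> b" "0 \<le> a" for a b c p :: real
        using that by argo
      have "dist y x \<le> (1/2) ^ Suc j"
        using confluent_weight_below[OF that \<open>x \<le> _\<close>] confluent_weight_nonneg[of x x] confluent_weight_nonneg[of y y]
        using arith unfolding dist_cltree_def length_end_vertex by blast
      also have "\<dots> \<le> (1/2) ^ j" by simp
      finally show "dist y x < e" using j by simp
    qed
    then show ?thesis
      using End by (intro bexI[of _ "descendants (end_vertex \<omega> j)"]) (auto simp: cltree_basis_def descendants_def)
  qed
qed

lemma countable_cltree_basis: "countable cltree_basis"
  unfolding cltree_basis_def by simp

text \<open>Second countability makes a pair of Borel maps a Borel map into the product, as
  \<open>borel_measurable_Pair\<close> requires.\<close>

instance cltree :: second_countable_topology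
  using topological_basis_imp_subbasis[OF topological_basis_cltree] countable_cltree_basis
  by intro_classes blast

text \<open>The sets of descendants generate the Borel sets, because the remaining basic sets, the
  isolated vertices, are Boolean combinations of them.\<close>

lemma measurable_cltreeI:
  assumes "\<And>\<alpha>. {x \<in> space M. f x \<le> Vertex \<alpha>} \<in> sets M"
  shows "f \<in> borel_measurable M"
  unfolding borel_eq_countable_basis[OF countable_cltree_basis topological_basis_cltree]
proof (rule measurable_measure_of)
  have desc: "f -` descendants \<alpha> \<inter> space M \<in> sets M" for \<alpha>
    using assms[of \<alpha>] by (simp add: descendants_def vimage_def Int_def conj_commute)
  moreover have "f -` {Vertex \<alpha>} \<inter> space M \<in> sets M" for \<alpha>
  proof -
    have "f -` {Vertex \<alpha>} \<inter> space M = (f -` descendants \<alpha> \<inter> space M) -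
        ((f -` descendants (\<alpha> @ [False]) \<inter> space M) \<union> (f -` descendants (\<alpha> @ [True]) \<inter> space M))"
      unfolding singleton_Vertex by blast
    then show ?thesis by (simp only:) (intro sets.Diff sets.Un desc)
  qed
  ultimately show "f -` B \<inter> space M \<in> sets M" if "B \<in> cltree_basis" for B
    using that by (auto simp: cltree_basis_def)
qed auto

lemma range_End_borel [measurable]: "range End \<in> sets borel"
proof -
  have "range End = - (\<Union>\<alpha>. {Vertex \<alpha>})" by (auto, metis cltree.exhaust rangeI)
  then show ?thesis using open_singleton_Vertex by (auto intro!: borel_closed)
qed

lemma end_section_measurable [measurable]: "end_section b \<in> borel_measurable borel"
proof (rule measurable_cltreeI)
  fix \<alpha>
  \<comment> \<open>Lying below a vertex fixes finitely many turns, each of them a measurable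
    function of the angle.\<close>
  have le: "End \<omega> \<le> Vertex \<alpha> \<longleftrightarrow> (\<forall>i<length \<alpha>. \<omega> i = \<alpha> ! i)" for \<omega>
  proof -
    have "End \<omega> \<le> Vertex \<alpha> \<longleftrightarrow> \<alpha> = end_vertex \<omega> (length \<alpha>)" by auto
    also have "\<dots> \<longleftrightarrow> (\<forall>i<length \<alpha>. \<omega> i = \<alpha> ! i)"
      by (subst list_eq_iff_nth_eq) (auto simp: end_vertex_def)
    finally show ?thesis .
  qed
  define \<omega> where "\<omega> z = (if b then floor_end (turn z) else ceil_end (if turn z = 0 then 1 else turn z))" for z
  have [measurable]: "Measurable.pred borel (\<lambda>z. \<omega> z i)" for i
    unfolding \<omega>_def floor_end_def ceil_end_def by (cases b; simp only: if_True if_False; measurable)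
  have "{z \<in> space borel. end_section b z \<le> Vertex \<alpha>} = {z \<in> space borel. \<forall>i\<in>{..<length \<alpha>}. \<omega> z i = \<alpha> ! i}"
    unfolding end_section_def \<omega>_def[symmetric] le by auto
  also have "\<dots> \<in> sets borel" by measurable
  finally show "{z \<in> space borel. end_section b z \<le> Vertex \<alpha>} \<in> sets borel" .
qed

subsection \<open>Countable mixtures of weighted image measures\<close>

text \<open>The sum over \<open>k\<close> of the images under \<open>s k\<close> of the measures
  with density \<open>w k\<close>. As an integral over counting measure, the sum obeys the same
  linearity and monotone convergence rules as the inner integral.\<close>

definition image_mixture ::
    "'a measure \<Rightarrow> 'b measure \<Rightarrow> ('k \<Rightarrow> 'a \<Rightarrow> ennreal) \<Rightarrow> ('k \<Rightarrow> 'a \<Rightarrow> 'b) \<Rightarrow> 'b measure" where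
  "image_mixture M N w s = measure_of (space N) (sets N)
     (\<lambda>E. \<integral>\<^sup>+k. (\<integral>\<^sup>+x. w k x * indicator E (s k x) \<partial>M) \<partial>count_space UNIV)"

lemma sets_image_mixture [simp, measurable_cong]: "sets (image_mixture M N w s) = sets N"
  by (simp add: image_mixture_def)

lemma space_image_mixture [simp]: "space (image_mixture M N w s) = space N"
  by (simp add: image_mixture_def)

lemma emeasure_image_mixture:
  assumes w [measurable]: "\<And>k. w k \<in> borel_measurable M" and s [measurable]: "\<And>k. s k \<in> measurable M N"
    and E: "E \<in> sets N"
  shows "emeasure (image_mixture M N w s) E =
    (\<integral>\<^sup>+k. (\<integral>\<^sup>+x. w k x * indicator E (s k x) \<partial>M) \<partial>count_space UNIV)"
proof (rule emeasure_measure_of[OF image_mixture_def])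
  let ?f = "\<lambda>E. \<integral>\<^sup>+k. (\<integral>\<^sup>+x. w k x * indicator E (s k x) \<partial>M) \<partial>count_space UNIV"
  show "positive (sets (image_mixture M N w s)) ?f" by (simp add: positive_def)
  show "countably_additive (sets (image_mixture M N w s)) ?f"
  proof (rule countably_additiveI)
    fix A :: "nat \<Rightarrow> 'c set"
    assume A: "range A \<subseteq> sets (image_mixture M N w s)" and disj: "disjoint_family A"
    have [measurable]: "A n \<in> sets N" for n using A by auto
    have "(\<integral>\<^sup>+x. w k x * indicator (\<Union>(range A)) (s k x) \<partial>M) = (\<Sum>n. \<integral>\<^sup>+x. w k x * indicator (A n) (s k x) \<partial>M)" for k
      by (subst nn_integral_suminf[symmetric]) (auto simp: suminf_indicator[OF disj, symmetric])
    then show "(\<Sum>n. ?f (A n)) = ?f (\<Union>(range A))"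
      by (simp add: nn_integral_suminf)
  qed
qed (use E sets.space_closed in auto)

lemma nn_integral_image_mixture:
  assumes w [measurable]: "\<And>k. w k \<in> borel_measurable M" and s [measurable]: "\<And>k. s k \<in> measurable M N"
    and g: "g \<in> borel_measurable N"
  shows "(\<integral>\<^sup>+y. g y \<partial>image_mixture M N w s) =
    (\<integral>\<^sup>+k. (\<integral>\<^sup>+x. w k x * g (s k x) \<partial>M) \<partial>count_space UNIV)"
proof -
  have g': "g \<in> borel_measurable (image_mixture M N w s)" using g by measurable
  have sp: "s k x \<in> space N" if "x \<in> space M" for k x using s that by (rule measurable_space)
  show ?thesis using g'
  proof (induction rule: borel_measurable_induct)
    case (cong f g)
    have "(\<integral>\<^sup>+x. w k x * f (s k x) \<partial>M) = (\<integral>\<^sup>+x. w k x * g (s k x) \<partial>M)" for k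
      using sp cong(3) by (intro nn_integral_cong) auto
    moreover have "(\<integral>\<^sup>+y. f y \<partial>image_mixture M N w s) = (\<integral>\<^sup>+y. g y \<partial>image_mixture M N w s)"
      using cong(3) by (intro nn_integral_cong) auto
    ultimately show ?case using cong by simp
  next
    case (set A)
    then show ?case using emeasure_image_mixture[OF w s] by simp
  next
    case (mult u c)
    then have [measurable]: "u \<in> borel_measurable N" by simp
    have "(\<integral>\<^sup>+x. w k x * (c * u (s k x)) \<partial>M) = c * (\<integral>\<^sup>+x. w k x * u (s k x) \<partial>M)" for k
      by (subst nn_integral_cmult[symmetric]) (auto simp: mult_ac)
    with mult show ?case by (simp add: nn_integral_cmult)
  next
    case (add u v)
    then have [measurable]: "u \<in> borel_measurable N" "v \<in> borel_measurable N" by simp_all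
    have "(\<integral>\<^sup>+x. w k x * (v (s k x) + u (s k x)) \<partial>M) =
        (\<integral>\<^sup>+x. w k x * v (s k x) \<partial>M) + (\<integral>\<^sup>+x. w k x * u (s k x) \<partial>M)" for k
      by (subst nn_integral_add[symmetric]) (auto simp: distrib_left)
    with add show ?case by (simp add: nn_integral_add)
  next
    case (seq U)
    then have [measurable]: "U i \<in> borel_measurable N" for i by simp
    have inc: "incseq (\<lambda>i x. w k x * U i (s k x))" for k
      using \<open>incseq U\<close> by (auto simp: incseq_def le_fun_def intro!: mult_left_mono)
    have "(\<integral>\<^sup>+x. w k x * (SUP i. U i) (s k x) \<partial>M) = (SUP i. \<integral>\<^sup>+x. w k x * U i (s k x) \<partial>M)" for k
      by (subst nn_integral_monotone_convergence_SUP[OF inc, symmetric])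
         (auto simp: SUP_mult_left_ennreal image_comp)
    moreover have "incseq (\<lambda>i k. \<integral>\<^sup>+x. w k x * U i (s k x) \<partial>M)"
      using \<open>incseq U\<close> by (auto simp: incseq_def le_fun_def intro!: nn_integral_mono mult_left_mono)
    ultimately have "(\<integral>\<^sup>+k. (\<integral>\<^sup>+x. w k x * (SUP i. U i) (s k x) \<partial>M) \<partial>count_space UNIV) =
        (SUP i. \<integral>\<^sup>+k. (\<integral>\<^sup>+x. w k x * U i (s k x) \<partial>M) \<partial>count_space UNIV)"
      by (simp add: nn_integral_monotone_convergence_SUP)
    moreover have "(\<integral>\<^sup>+y. (SUP i. U i) y \<partial>image_mixture M N w s) = (SUP i. \<integral>\<^sup>+y. U i y \<partial>image_mixture M N w s)"
    proof -
      have "(SUP i. U i) = (\<lambda>y. SUP i. U i y)" by (auto simp: fun_eq_iff image_comp)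
      then show ?thesis using seq by (simp add: nn_integral_monotone_convergence_SUP)
    qed
    ultimately show ?case using seq by simp
  qed
qed

subsection \<open>The pull-back\<close>

text \<open>One index type for everything that can lie over a point in one coordinate: a vertex
  whose box contains it, or one of the two ends above a point of the circle. Pairs of indices then
  treat all four strata of the bitree at once.\<close>

fun cell_point :: "vertex + bool \<Rightarrow> complex \<Rightarrow> cltree" where
  "cell_point (Inl \<alpha>) z = Vertex \<alpha>"
| "cell_point (Inr b) z = end_section b z"

fun cell_weight :: "vertex + bool \<Rightarrow> complex \<Rightarrow> ennreal" where
  "cell_weight (Inl \<alpha>) z = indicator (whitney_box \<alpha>) z"
| "cell_weight (Inr b) z = ennreal (1/2) * indicator (sphere 0 1) z"

lemma cell_point_measurable [measurable]: "cell_point i \<in> borel_measurable borel"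
proof (cases i)
  case (Inl \<alpha>)
  then have "cell_point i = (\<lambda>_. Vertex \<alpha>)" by auto
  then show ?thesis by simp
next
  case (Inr b)
  then have "cell_point i = end_section b" by auto
  then show ?thesis by simp
qed

lemma whitney_box_borel [measurable]: "whitney_box \<alpha> \<in> sets borel"
  using compact_whitney_box by (intro borel_compact)

lemma cell_weight_measurable [measurable]: "cell_weight i \<in> borel_measurable borel"
proof (cases i)
  case (Inl \<alpha>)
  have "cell_weight (Inl \<alpha>) = indicator (whitney_box \<alpha>)" by (rule ext) (rule cell_weight.simps)
  then show ?thesis unfolding Inl by (simp only:) (rule borel_measurable_indicator[OF whitney_box_borel])
next
  case (Inr b)
  have "cell_weight (Inr b) = (\<lambda>z. ennreal (1/2) * indicator (sphere 0 1) z)"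
    by (rule ext) (rule cell_weight.simps)
  moreover have "sphere 0 1 \<in> sets (borel :: complex measure)" by (intro borel_closed closed_sphere)
  ultimately show ?thesis
    unfolding Inr
    by (simp only:) (intro borel_measurable_times_ennreal borel_measurable_indicator borel_measurable_const)
qed

text \<open>On the circle \<open>\<Lambda>\<^sub>0\<close> has the two (possibly equal) sections given by \<open>end_section\<close>, so that the share of the
  fibre lying in \<open>E\<close> is the average of the indicator of \<open>E\<close> over them.\<close>

definition tree_measure :: "(complex \<times> complex) measure \<Rightarrow> (cltree \<times> cltree) measure" where
  "tree_measure \<mu> = image_mixture \<mu> borel (\<lambda>(i, j) z. cell_weight i (fst z) * cell_weight j (snd z))
     (\<lambda>(i, j) z. (cell_point i (fst z), cell_point j (snd z)))"

text \<open>Weight 1/2 for each section is right in both cases: when the two sections agree, the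
  single point receives 1/2 + 1/2.\<close>

lemma average_pair:
  fixes g :: "'a \<Rightarrow> real"
  shows "(\<Sum>x\<in>range s. g x) / real (card (range s)) = (\<Sum>b\<in>UNIV. 1/2 * g (s (b :: bool)))"
proof -
  have "range s = {s True, s False}" by (auto simp: UNIV_bool)
  then show ?thesis
    by (cases "s True = s False") (auto simp: UNIV_bool add_divide_distrib)
qed

lemma share_eq: "finite F \<Longrightarrow> share F E = ennreal ((\<Sum>x\<in>F. indicator E x) / real (card F))"
  by (simp add: share_def indicator_def sum.If_cases Int_def)

lemma share_pair: "share (range s) E = (\<Sum>b\<in>UNIV. ennreal (1/2) * indicator E (s (b :: bool)))"
proof -
  have "share (range s) E = ennreal (\<Sum>b\<in>UNIV. 1/2 * indicator E (s b))"
    by (simp only: share_eq finite finite_imageI average_pair)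
  also have "\<dots> = (\<Sum>b\<in>UNIV. ennreal (1/2 * indicator E (s b)))"
    by (rule sum_ennreal[symmetric]) simp
  also have "\<dots> = (\<Sum>b\<in>UNIV. ennreal (1/2) * indicator E (s (b :: bool)))"
    by (intro sum.cong refl) (simp add: indicator_def)
  finally show ?thesis .
qed

lemma share_pair_times: "share (range s \<times> range t) E =
  (\<Sum>(b, c)\<in>UNIV. ennreal (1/2) * ennreal (1/2) * indicator E (s (b :: bool), t (c :: bool)))"
proof -
  have "(\<Sum>x\<in>range s \<times> range t. indicator E x :: real) / real (card (range s \<times> range t)) =
      (\<Sum>x\<in>range s. (\<Sum>y\<in>range t. indicator E (x, y)) / real (card (range t))) / real (card (range s))"
    by (simp add: sum.cartesian_product card_cartesian_product sum_divide_distrib case_prod_unfold mult.commute)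
  also have "\<dots> = (\<Sum>b\<in>UNIV. 1/2 * (\<Sum>c\<in>UNIV. 1/2 * indicator E (s b, t c)))"
    by (simp only: average_pair)
  also have "\<dots> = (\<Sum>(b, c)\<in>UNIV. 1/2 * (1/2) * indicator E (s b, t c))"
    by (simp add: sum_distrib_left sum.cartesian_product)
  finally have "share (range s \<times> range t) E = ennreal (\<Sum>(b, c)\<in>UNIV. 1/2 * (1/2) * indicator E (s b, t c))"
    by (simp only: share_eq finite finite_imageI finite_cartesian_product)
  also have "\<dots> = (\<Sum>(b, c)\<in>UNIV. ennreal (1/2 * (1/2) * indicator E (s b, t c)))"
    unfolding case_prod_unfold by (rule sum_ennreal[symmetric]) simp
  also have "\<dots> = (\<Sum>(b, c)\<in>UNIV. ennreal (1/2) * ennreal (1/2) * indicator E (s (b :: bool), t (c :: bool)))"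
  proof -
    have "ennreal (1/2 * (1/2) * indicator E x) = ennreal (1/2) * ennreal (1/2) * indicator E x" for x
      by (cases "x \<in> E") (simp_all only: indicator_simps mult_1_right mult_zero_right ennreal_0, rule ennreal_mult, auto)
    then show ?thesis by (simp only:)
  qed
  finally show ?thesis .
qed

definition pieces :: "vertex option \<Rightarrow> cltree set" where
  "pieces p = (case p of Some \<alpha> \<Rightarrow> {Vertex \<alpha>} | None \<Rightarrow> range End)"

lemma pieces_borel [measurable]: "pieces p \<in> sets borel"
  by (cases p) (auto simp: pieces_def intro!: borel_open open_singleton_Vertex)

text \<open>The bitree is a countable disjoint union of products whose factors are single vertices
  or the whole boundary, and the clauses of \<open>is_pullback\<close> prescribe the measure of
  every Borel subset of each product.\<close>

lemma is_pullback_unique: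
  assumes \<nu>: "is_pullback \<mu> \<nu>" and \<nu>': "is_pullback \<mu> \<nu>'"
  shows "\<nu> = \<nu>'"
proof (rule measure_eqI)
  show sets_eq: "sets \<nu> = sets \<nu>'" using \<nu> \<nu>' by (simp add: is_pullback_def)
  fix E assume "E \<in> sets \<nu>"
  then have E [measurable]: "E \<in> sets borel" using \<nu> by (simp add: is_pullback_def)
  let ?P = "\<lambda>(p, q). pieces p \<times> pieces q"
  have dec: "emeasure M E = (\<integral>\<^sup>+k. emeasure M (E \<inter> ?P k) \<partial>count_space UNIV)" if "sets M = sets borel" for M
  proof -
    have "x \<in> pieces (case x of Vertex \<alpha> \<Rightarrow> Some \<alpha> | End _ \<Rightarrow> None)" for x
      by (auto simp: pieces_def split: cltree.splits)
    then have un: "E = (\<Union>k. E \<inter> ?P k)" by auto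
    have disj: "disjoint_family (\<lambda>k. E \<inter> ?P k)"
      by (auto simp: disjoint_family_on_def pieces_def split: option.splits)
    have "E \<inter> ?P k \<in> sets M" for k
      unfolding that by (cases k) (auto intro!: sets.Int E borel_Times pieces_borel)
    with un disj show ?thesis
      using emeasure_UN_countable[of UNIV "\<lambda>k. E \<inter> ?P k" M] by simp
  qed
  have "emeasure \<nu> (E \<inter> ?P (p, q)) = emeasure \<nu>' (E \<inter> ?P (p, q))" for p q
  proof (cases p; cases q)
    fix \<alpha> \<beta> assume "p = Some \<alpha>" "q = Some \<beta>"
    then have "E \<inter> ?P (p, q) = {} \<or> E \<inter> ?P (p, q) = {(Vertex \<alpha>, Vertex \<beta>)}" by (auto simp: pieces_def)
    then show ?thesis using \<nu> \<nu>' by (auto simp: is_pullback_def)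
  next
    fix \<alpha> assume pq: "p = Some \<alpha>" "q = None"
    \<comment> \<open>The clause for a mixed stratum speaks of sets
      \<open>{Vertex \<alpha>} \<times> E'\<close>, so the section of \<open>E\<close> over the
      vertex has to be shown Borel.\<close>
    define E' where "E' = (\<lambda>y. (Vertex \<alpha>, y)) -` E \<inter> range End"
    have "(\<lambda>y :: cltree. (Vertex \<alpha>, y)) \<in> borel_measurable borel"
      using borel_measurable_Pair[OF borel_measurable_const measurable_ident_sets[OF refl]] .
    then have "E' \<in> sets borel"
      unfolding E'_def by (metis E measurable_sets_borel range_End_borel sets.Int)
    moreover have "E \<inter> ?P (p, q) = {Vertex \<alpha>} \<times> E'" "E' \<subseteq> range End" using pq by (auto simp: pieces_def E'_def)
    ultimately show ?thesis using \<nu> \<nu>' by (simp add: is_pullback_def)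
  next
    fix \<alpha> assume pq: "p = None" "q = Some \<alpha>"
    define E' where "E' = (\<lambda>x. (x, Vertex \<alpha>)) -` E \<inter> range End"
    have "(\<lambda>x :: cltree. (x, Vertex \<alpha>)) \<in> borel_measurable borel" by (intro borel_measurable_Pair) auto
    then have "E' \<in> sets borel"
      unfolding E'_def by (metis E measurable_sets_borel range_End_borel sets.Int)
    moreover have "E \<inter> ?P (p, q) = E' \<times> {Vertex \<alpha>}" "E' \<subseteq> range End" using pq by (auto simp: pieces_def E'_def)
    ultimately show ?thesis using \<nu> \<nu>' by (simp add: is_pullback_def)
  next
    assume "p = None" "q = None"
    then have "E \<inter> ?P (p, q) \<in> sets borel" "E \<inter> ?P (p, q) \<subseteq> range End \<times> range End"
      by (auto simp: pieces_def intro!: sets.Int E borel_Times)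
    then show ?thesis using \<nu> \<nu>' by (simp add: is_pullback_def)
  qed
  then have "emeasure \<nu> (E \<inter> ?P k) = emeasure \<nu>' (E \<inter> ?P k)" for k by (cases k) simp
  then show "emeasure \<nu> E = emeasure \<nu>' E"
    using dec[of \<nu>] dec[of \<nu>'] \<nu> \<nu>' unfolding is_pullback_def by (simp only:)
qed

section \<open>Borel measures on the closed bidisc and existence of the pull-back\<close>

definition closed_bidisc_measure :: "(complex \<times> complex) measure \<Rightarrow> bool" where
  "closed_bidisc_measure \<mu> \<longleftrightarrow> sets \<mu> = sets (restrict_space borel (cball 0 1 \<times> cball 0 1))"

lemma space_closed_bidisc_measure:
  assumes "closed_bidisc_measure \<mu>" shows "space \<mu> = cball 0 1 \<times> cball 0 1"
proof -
  have "space \<mu> = space (restrict_space borel (cball 0 1 \<times> cball 0 1))"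
    using assms unfolding closed_bidisc_measure_def by (rule sets_eq_imp_space_eq)
  then show ?thesis by (simp only: space_restrict_space space_borel) simp
qed

lemma measurable_closed_bidisc_measure:
  assumes "closed_bidisc_measure \<mu>" "f \<in> measurable borel N"
  shows "f \<in> measurable \<mu> N"
  using measurable_restrict_space1[OF assms(2)] assms(1)
  unfolding closed_bidisc_measure_def by (subst measurable_cong_sets[OF _ refl])

lemma sets_closed_bidisc_measure:
  assumes "closed_bidisc_measure \<mu>" "A \<in> sets borel" "A \<subseteq> cball 0 1 \<times> cball 0 1"
  shows "A \<in> sets \<mu>"
proof -
  have "(cball 0 1 \<times> cball 0 1) \<inter> space borel \<in> sets (borel :: (complex \<times> complex) measure)"
    by (auto intro!: borel_closed closed_Times)
  from sets_restrict_space_iff[OF this, of A] assms show ?thesis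
    unfolding closed_bidisc_measure_def by blast
qed

lemma measurable_fst_borel [measurable]: "fst \<in> borel_measurable borel"
  and measurable_snd_borel [measurable]: "snd \<in> borel_measurable borel"
  by (intro borel_measurable_continuous_onI continuous_intros)+

lemma cell_weight_pair_measurable [measurable]:
  "(\<lambda>z. cell_weight i (fst z) * cell_weight j (snd z)) \<in> borel_measurable borel"
  "(\<lambda>z. (cell_point i (fst z), cell_point j (snd z))) \<in> borel_measurable borel"
  by (intro borel_measurable_times_ennreal borel_measurable_Pair
      measurable_compose[OF measurable_fst_borel] measurable_compose[OF measurable_snd_borel]
      cell_weight_measurable cell_point_measurable)+

lemma nn_integral_tree_measure:
  assumes "closed_bidisc_measure \<mu>" "g \<in> borel_measurable borel"
  shows "(\<integral>\<^sup>+y. g y \<partial>tree_measure \<mu>) = (\<integral>\<^sup>+(i, j). (\<integral>\<^sup>+z. cell_weight i (fst z) * cell_weight j (snd z) *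
     g (cell_point i (fst z), cell_point j (snd z)) \<partial>\<mu>) \<partial>count_space UNIV)"
  unfolding tree_measure_def
proof (subst nn_integral_image_mixture[OF _ _ assms(2)], goal_cases)
  case (1 k)
  show ?case by (cases k; simp only: case_prod_conv) (intro measurable_closed_bidisc_measure[OF assms(1)] cell_weight_pair_measurable)
next
  case (2 k)
  show ?case by (cases k; simp only: case_prod_conv) (intro measurable_closed_bidisc_measure[OF assms(1)] cell_weight_pair_measurable)
qed (simp add: case_prod_unfold)

text \<open>On each type of set prescribed by the definition of the pull-back only finitely many
  index pairs contribute, so the sum can be moved inside the integral.\<close>

lemma emeasure_tree_measure_finite:
  assumes \<mu>: "closed_bidisc_measure \<mu>" and E: "E \<in> sets borel" and fin: "finite A"
    and zero: "\<And>i j z. (i, j) \<notin> A \<Longrightarrow> cell_weight i (fst z) * cell_weight j (snd z) *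
      indicator E (cell_point i (fst z), cell_point j (snd z)) = 0"
  shows "emeasure (tree_measure \<mu>) E = (\<integral>\<^sup>+z. (\<Sum>(i, j)\<in>A. cell_weight i (fst z) * cell_weight j (snd z) *
     indicator E (cell_point i (fst z), cell_point j (snd z))) \<partial>\<mu>)"
proof -
  let ?g = "\<lambda>k z. case k of (i, j) \<Rightarrow> cell_weight i (fst z) * cell_weight j (snd z) *
     indicator E (cell_point i (fst z), cell_point j (snd z))"
  have "emeasure (tree_measure \<mu>) E = (\<integral>\<^sup>+y. indicator E y \<partial>tree_measure \<mu>)"
    using E by (simp add: tree_measure_def)
  also have "\<dots> = (\<integral>\<^sup>+k. (\<integral>\<^sup>+z. ?g k z \<partial>\<mu>) \<partial>count_space UNIV)"
    by (subst nn_integral_tree_measure[OF \<mu>]) (use E in \<open>auto simp: case_prod_unfold\<close>)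
  also have "\<dots> = (\<Sum>k\<in>A. \<integral>\<^sup>+z. ?g k z \<partial>\<mu>)"
  proof (rule nn_integral_count_space'[OF fin])
    fix k assume "k \<notin> A"
    then have "?g k z = 0" for z using zero by (cases k) auto
    then show "(\<integral>\<^sup>+z. ?g k z \<partial>\<mu>) = 0" by simp
  qed auto
  also have "\<dots> = (\<integral>\<^sup>+z. (\<Sum>k\<in>A. ?g k z) \<partial>\<mu>)"
  proof (rule nn_integral_sum[symmetric])
    fix k
    have [measurable]: "indicator E \<in> borel_measurable borel" using E by simp
    have "?g k \<in> borel_measurable borel"
      by (cases k; simp only: case_prod_conv) (intro borel_measurable_times_ennreal cell_weight_pair_measurable
        measurable_compose[OF cell_weight_pair_measurable(2)] \<open>indicator E \<in> _\<close>)
    then show "?g k \<in> borel_measurable \<mu>" by (rule measurable_closed_bidisc_measure[OF \<mu>])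
  qed
  finally show ?thesis by (simp add: case_prod_unfold)
qed

lemma cell_point_eq_Vertex_iff: "cell_point i z = Vertex \<alpha> \<longleftrightarrow> i = Inl \<alpha>"
  by (cases i) (auto simp: end_section_def)

lemma cell_point_in_range_End_iff: "cell_point i z \<in> range End \<longleftrightarrow> i \<in> range Inr"
  by (cases i) (auto simp: end_section_def)

lemma whitney_box_subset_cball: "whitney_box \<alpha> \<subseteq> cball 0 1"
  using norm_whitney_box by (auto simp: less_imp_le)

lemma is_pullback_tree_measure:
  assumes \<mu>: "closed_bidisc_measure \<mu>"
  shows "is_pullback \<mu> (tree_measure \<mu>)"
  unfolding is_pullback_def
proof (intro conjI allI ballI impI)
  show "sets (tree_measure \<mu>) = sets borel" by (simp add: tree_measure_def)
next
  fix \<alpha> \<beta>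
  have V: "{(Vertex \<alpha>, Vertex \<beta>)} = {Vertex \<alpha>} \<times> {Vertex \<beta>}" by auto
  have "{(Vertex \<alpha>, Vertex \<beta>)} \<in> sets borel"
    unfolding V by (intro borel_open open_Times open_singleton_Vertex)
  then have "emeasure (tree_measure \<mu>) {(Vertex \<alpha>, Vertex \<beta>)} =
      (\<integral>\<^sup>+z. (\<Sum>(i, j)\<in>{(Inl \<alpha>, Inl \<beta>)}. cell_weight i (fst z) * cell_weight j (snd z) *
     indicator {(Vertex \<alpha>, Vertex \<beta>)} (cell_point i (fst z), cell_point j (snd z))) \<partial>\<mu>)"
    by (intro emeasure_tree_measure_finite[OF \<mu>]) (auto simp: indicator_def cell_point_eq_Vertex_iff)
  also have "\<dots> = (\<integral>\<^sup>+z. indicator (whitney_box \<alpha> \<times> whitney_box \<beta>) z \<partial>\<mu>)"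
    by (intro nn_integral_cong) (auto simp: indicator_def)
  also have "\<dots> = emeasure \<mu> (whitney_box \<alpha> \<times> whitney_box \<beta>)"
    by (intro nn_integral_indicator sets_closed_bidisc_measure[OF \<mu>] borel_Times)
       (use whitney_box_subset_cball in auto)
  finally show "emeasure (tree_measure \<mu>) {(Vertex \<alpha>, Vertex \<beta>)} = \<dots>" .
next
  fix \<alpha> and E :: "cltree set" assume E: "E \<in> sets borel" "E \<subseteq> range End"
  have "{Vertex \<alpha>} \<times> E \<in> sets borel"
    by (intro borel_Times E borel_open open_singleton_Vertex)
  then have "emeasure (tree_measure \<mu>) ({Vertex \<alpha>} \<times> E) =
      (\<integral>\<^sup>+z. (\<Sum>(i, j)\<in>{Inl \<alpha>} \<times> range Inr. cell_weight i (fst z) * cell_weight j (snd z) *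
     indicator ({Vertex \<alpha>} \<times> E) (cell_point i (fst z), cell_point j (snd z))) \<partial>\<mu>)"
    by (intro emeasure_tree_measure_finite[OF \<mu>])
       (use E(2) cell_point_in_range_End_iff in \<open>auto simp: indicator_def cell_point_eq_Vertex_iff\<close>)
  also have "\<dots> = (\<integral>\<^sup>+z. share (end_fibre (snd z)) E * indicator (whitney_box \<alpha> \<times> sphere 0 1) z \<partial>\<mu>)"
  proof (intro nn_integral_cong, goal_cases)
    case (1 z)
    have sets: "{Inl \<alpha>} \<times> range Inr = {(Inl \<alpha>, Inr True), (Inl \<alpha>, Inr False)}"
      by (auto simp: UNIV_bool)
    have "(\<Sum>(i, j)\<in>{Inl \<alpha>} \<times> range Inr. cell_weight i (fst z) * cell_weight j (snd z) *
       indicator ({Vertex \<alpha>} \<times> E) (cell_point i (fst z), cell_point j (snd z))) =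
      (\<Sum>b\<in>UNIV. ennreal (1/2) * indicator E (end_section b (snd z))) * indicator (whitney_box \<alpha> \<times> sphere 0 1) z"
      unfolding sets
      by (cases "fst z \<in> whitney_box \<alpha>"; cases "snd z \<in> sphere 0 1")
         (simp_all add: UNIV_bool indicator_def mem_Times_iff add_ac mult_2 del: mem_sphere mem_sphere_0)
    \<comment> \<open>\<open>end_fibre_eq\<close> describes fibres over the circle only; elsewhere
      the indicator annihilates both sides.\<close>
    moreover have "indicator (whitney_box \<alpha> \<times> sphere 0 1) z = (0 :: ennreal)" if "snd z \<notin> sphere 0 1"
      using that by (simp add: indicator_def mem_Times_iff del: mem_sphere mem_sphere_0)
    ultimately show ?case
      by (cases "snd z \<in> sphere 0 1") (simp_all only: end_fibre_eq share_pair mult_zero_right not_False_eq_True simp_thms)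
  qed
  finally show "emeasure (tree_measure \<mu>) ({Vertex \<alpha>} \<times> E) = \<dots>" .
next
  fix \<alpha> and E :: "cltree set" assume E: "E \<in> sets borel" "E \<subseteq> range End"
  have "E \<times> {Vertex \<alpha>} \<in> sets borel"
    by (intro borel_Times E borel_open open_singleton_Vertex)
  then have "emeasure (tree_measure \<mu>) (E \<times> {Vertex \<alpha>}) =
      (\<integral>\<^sup>+z. (\<Sum>(i, j)\<in>range Inr \<times> {Inl \<alpha>}. cell_weight i (fst z) * cell_weight j (snd z) *
     indicator (E \<times> {Vertex \<alpha>}) (cell_point i (fst z), cell_point j (snd z))) \<partial>\<mu>)"
    by (intro emeasure_tree_measure_finite[OF \<mu>])
       (use E(2) cell_point_in_range_End_iff in \<open>auto simp: indicator_def cell_point_eq_Vertex_iff\<close>)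
  also have "\<dots> = (\<integral>\<^sup>+z. share (end_fibre (fst z)) E * indicator (sphere 0 1 \<times> whitney_box \<alpha>) z \<partial>\<mu>)"
  proof (intro nn_integral_cong, goal_cases)
    case (1 z)
    have sets: "range Inr \<times> {Inl \<alpha>} = {(Inr True, Inl \<alpha>), (Inr False, Inl \<alpha>)}"
      by (auto simp: UNIV_bool)
    have "(\<Sum>(i, j)\<in>range Inr \<times> {Inl \<alpha>}. cell_weight i (fst z) * cell_weight j (snd z) *
       indicator (E \<times> {Vertex \<alpha>}) (cell_point i (fst z), cell_point j (snd z))) =
      (\<Sum>b\<in>UNIV. ennreal (1/2) * indicator E (end_section b (fst z))) * indicator (sphere 0 1 \<times> whitney_box \<alpha>) z"
      unfolding sets
      by (cases "snd z \<in> whitney_box \<alpha>"; cases "fst z \<in> sphere 0 1")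
         (simp_all add: UNIV_bool indicator_def mem_Times_iff add_ac mult_2 del: mem_sphere mem_sphere_0)
    moreover have "indicator (sphere 0 1 \<times> whitney_box \<alpha>) z = (0 :: ennreal)" if "fst z \<notin> sphere 0 1"
      using that by (simp add: indicator_def mem_Times_iff del: mem_sphere mem_sphere_0)
    ultimately show ?case
      by (cases "fst z \<in> sphere 0 1") (simp_all only: end_fibre_eq share_pair mult_zero_right not_False_eq_True simp_thms)
  qed
  finally show "emeasure (tree_measure \<mu>) (E \<times> {Vertex \<alpha>}) = \<dots>" .
next
  fix E :: "(cltree \<times> cltree) set" assume E: "E \<in> sets borel" "E \<subseteq> range End \<times> range End"
  have "emeasure (tree_measure \<mu>) E =
      (\<integral>\<^sup>+z. (\<Sum>(i, j)\<in>range Inr \<times> range Inr. cell_weight i (fst z) * cell_weight j (snd z) *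
     indicator E (cell_point i (fst z), cell_point j (snd z))) \<partial>\<mu>)"
    by (intro emeasure_tree_measure_finite[OF \<mu>] E)
       (use E(2) cell_point_in_range_End_iff in \<open>auto simp: indicator_def\<close>)
  also have "\<dots> = (\<integral>\<^sup>+z. share (end_fibre (fst z) \<times> end_fibre (snd z)) E * indicator (sphere 0 1 \<times> sphere 0 1) z \<partial>\<mu>)"
  proof (intro nn_integral_cong, goal_cases)
    case (1 z)
    have sets: "(range Inr \<times> range Inr :: ((vertex + bool) \<times> (vertex + bool)) set) =
        {(Inr True, Inr True), (Inr True, Inr False), (Inr False, Inr True), (Inr False, Inr False)}"
      by (auto simp: UNIV_bool)
    have U: "(UNIV :: (bool \<times> bool) set) = {(True, True), (True, False), (False, True), (False, False)}"
      by auto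
    have "(\<Sum>(i, j)\<in>range Inr \<times> range Inr. cell_weight i (fst z) * cell_weight j (snd z) *
       indicator E (cell_point i (fst z), cell_point j (snd z))) =
      (\<Sum>(b, c)\<in>UNIV. ennreal (1/2) * ennreal (1/2) * indicator E (end_section b (fst z), end_section c (snd z))) *
        indicator (sphere 0 1 \<times> sphere 0 1) z"
      unfolding sets U
      by (cases "fst z \<in> sphere 0 1"; cases "snd z \<in> sphere 0 1")
         (simp_all add: indicator_def mem_Times_iff add_ac mult_2 del: mem_sphere mem_sphere_0)
    moreover have "indicator (sphere 0 1 \<times> sphere 0 1) z = (0 :: ennreal)"
      if "\<not> (fst z \<in> sphere 0 1 \<and> snd z \<in> sphere 0 1)"
      using that by (simp add: indicator_def mem_Times_iff del: mem_sphere mem_sphere_0)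
    ultimately show ?case
      by (cases "fst z \<in> sphere 0 1 \<and> snd z \<in> sphere 0 1")
         (simp_all only: end_fibre_eq share_pair_times mult_zero_right not_False_eq_True simp_thms)
  qed
  finally show "emeasure (tree_measure \<mu>) E = \<dots>" .
qed

lemma pullback_eq_tree_measure:
  assumes "closed_bidisc_measure \<mu>" shows "pullback \<mu> = tree_measure \<mu>"
  unfolding pullback_def
  using is_pullback_tree_measure[OF assms] is_pullback_unique by (intro the_equality) auto

subsection \<open>Sampling power series along rotations\<close>

definition unit_root :: "nat \<Rightarrow> nat \<Rightarrow> complex" where
  "unit_root M l = cis (2 * pi * (real l / real M))"

lemma norm_unit_root [simp]: "norm (unit_root M l) = 1"
  by (simp add: unit_root_def)

lemma unit_root_power: "unit_root M l ^ k = unit_root M k ^ l"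
  unfolding unit_root_def Complex.DeMoivre by (simp add: mult_ac)

lemma unit_root_power_order: "0 < M \<Longrightarrow> unit_root M l ^ M = 1"
proof -
  assume "0 < M"
  then have "unit_root M l ^ M = cis (2 * pi * real l)"
    unfolding unit_root_def Complex.DeMoivre by (simp add: field_simps)
  then show ?thesis by (simp add: cis_multiple_2pi)
qed

lemma unit_root_inj:
  assumes "k < M" "k' < M" "unit_root M k = unit_root M k'" shows "k = k'"
proof -
  have eq: "unit_root M j = exp (2 * of_real pi * \<i> * of_nat j / of_nat M)" for j
    by (simp add: unit_root_def cis_conv_exp mult_ac)
  show ?thesis using assms complex_root_unity_eq[of M k k'] by (simp add: eq)
qed

lemma unit_root_orthogonal:
  assumes k: "k < M" "k' < M"
  shows "(\<Sum>l<M. unit_root M l ^ k * cnj (unit_root M l ^ k')) = (if k = k' then of_nat M else 0)"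
proof -
  define x where "x = unit_root M k * cnj (unit_root M k')"
  have "(\<Sum>l<M. unit_root M l ^ k * cnj (unit_root M l ^ k')) = (\<Sum>l<M. x ^ l)"
    unfolding unit_root_power[of M _ k] unit_root_power[of M _ k'] x_def by (simp add: power_mult_distrib)
  moreover have "x ^ M = 1"
    using k by (simp add: x_def power_mult_distrib unit_root_power_order flip: complex_cnj_power)
  moreover have "x = 1 \<longleftrightarrow> k = k'"
  proof
    assume "x = 1"
    then have "x * unit_root M k' = unit_root M k'" by simp
    moreover have "x * unit_root M k' = unit_root M k"
      unfolding x_def mult.assoc by (simp add: complex_norm_square[symmetric] mult.commute[of "cnj _"])
    ultimately show "k = k'" using unit_root_inj[OF k] by simp
  qed (simp add: x_def complex_norm_square[symmetric])
  ultimately show ?thesis by (simp add: sum_gp_strict)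
qed

lemma finite_parseval:
  "(\<Sum>l<M. (cmod (\<Sum>k<M. d k * unit_root M l ^ k))\<^sup>2) = real M * (\<Sum>k<M. (cmod (d k))\<^sup>2)"
proof -
  have "complex_of_real (\<Sum>l<M. (cmod (\<Sum>k<M. d k * unit_root M l ^ k))\<^sup>2) =
      (\<Sum>l<M. \<Sum>k<M. \<Sum>k'<M. (d k * cnj (d k')) * (unit_root M l ^ k * cnj (unit_root M l ^ k')))"
    unfolding of_real_sum complex_norm_square cnj_sum sum_product complex_cnj_mult
    by (intro sum.cong refl) (simp add: mult_ac)
  also have "\<dots> = (\<Sum>k<M. \<Sum>k'<M. (d k * cnj (d k')) * (\<Sum>l<M. unit_root M l ^ k * cnj (unit_root M l ^ k')))"
    by (subst sum.swap, rule sum.cong[OF refl], subst sum.swap) (simp add: sum_distrib_left)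
  also have "\<dots> = (\<Sum>k<M. \<Sum>k'<M. if k = k' then of_nat M * (d k * cnj (d k')) else 0)"
    by (intro sum.cong refl) (simp add: unit_root_orthogonal del: complex_cnj_power)
  also have "\<dots> = (\<Sum>k<M. of_nat M * (d k * cnj (d k)))"
    by (intro sum.cong refl) simp
  also have "\<dots> = complex_of_real (real M * (\<Sum>k<M. (cmod (d k))\<^sup>2))"
    unfolding of_real_mult of_real_sum complex_norm_square sum_distrib_left by simp
  finally show ?thesis by (simp only: of_real_eq_iff)
qed

lemma sum_blocks: "(\<Sum>m<I * M. f m) = (\<Sum>i<I. \<Sum>k<M. f (i * M + k))"
  for f :: "nat \<Rightarrow> 'a :: comm_monoid_add"
proof -
  have "(\<Sum>m<I * M. f m) = (\<Sum>i<I. sum f {i * M..<i * M + M})" by (rule sum.nat_group[symmetric])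
  also have "\<dots> = (\<Sum>i<I. \<Sum>k<M. f (i * M + k))"
  proof (rule sum.cong[OF refl])
    fix i
    show "sum f {i * M..<i * M + M} = (\<Sum>k<M. f (i * M + k))"
      using sum.shift_bounds_nat_ivl[of f 0 "i * M" M] by (simp add: lessThan_atLeast0 add.commute)
  qed
  finally show ?thesis .
qed

text \<open>Within a block of \<open>M\<close> consecutive powers the \<open>M\<close> sample points
  satisfy Parseval's identity exactly. The decay \<open>cmod u ^ M \<le> q\<close> makes the blocks
  summable, so Cauchy-Schwarz with geometric weights combines them at the cost of
  \<open>1 / (1 - q)\<close>.\<close>

lemma blocked_sampling_bound:
  assumes M: "0 < M" and q: "0 < q" "q < 1" and u: "cmod u \<le> 1" "cmod u ^ M \<le> q"
  shows "(\<Sum>l<M. (cmod (\<Sum>m<I * M. c m * (unit_root M l * u) ^ m))\<^sup>2) \<le>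
    real M / (1 - q) * (\<Sum>m<I * M. (cmod (c m))\<^sup>2 * cmod u ^ m)"
proof -
  define P where "P i l = (\<Sum>k<M. c (i * M + k) * u ^ (i * M + k) * unit_root M l ^ k)" for i l
  have geo: "(\<Sum>i<I. q ^ i) \<le> 1 / (1 - q)"
    using q by (simp add: sum_gp_strict divide_right_mono)
  have P: "(\<Sum>m<I * M. c m * (unit_root M l * u) ^ m) = (\<Sum>i<I. P i l)" for l
  proof -
    have "unit_root M l ^ (i * M) = 1" for i
      using unit_root_power_order[OF M, of l] by (metis power_mult power_one mult.commute)
    then show ?thesis
      unfolding sum_blocks P_def by (simp add: power_mult_distrib power_add mult_ac)
  qed
  have CS: "(cmod (\<Sum>i<I. P i l))\<^sup>2 \<le> 1 / (1 - q) * (\<Sum>i<I. (cmod (P i l))\<^sup>2 / q ^ i)" for l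
  proof -
    have "(cmod (\<Sum>i<I. P i l))\<^sup>2 \<le> (\<Sum>i<I. sqrt (q ^ i) * (cmod (P i l) / sqrt (q ^ i)))\<^sup>2"
      using q by (intro power_mono order_trans[OF norm_sum]) (simp_all add: less_imp_neq[symmetric])
    also have "\<dots> \<le> (\<Sum>i<I. (sqrt (q ^ i))\<^sup>2) * (\<Sum>i<I. (cmod (P i l) / sqrt (q ^ i))\<^sup>2)"
      by (rule Cauchy_Schwarz_ineq_sum)
    also have "\<dots> = (\<Sum>i<I. q ^ i) * (\<Sum>i<I. (cmod (P i l))\<^sup>2 / q ^ i)"
      using q by (simp add: power_divide)
    also have "\<dots> \<le> 1 / (1 - q) * (\<Sum>i<I. (cmod (P i l))\<^sup>2 / q ^ i)"
      using q by (intro mult_right_mono geo sum_nonneg) auto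
    finally show ?thesis .
  qed
  have "(\<Sum>l<M. (cmod (\<Sum>m<I * M. c m * (unit_root M l * u) ^ m))\<^sup>2) \<le>
      (\<Sum>l<M. 1 / (1 - q) * (\<Sum>i<I. (cmod (P i l))\<^sup>2 / q ^ i))"
    unfolding P by (rule sum_mono) (rule CS)
  also have "\<dots> = 1 / (1 - q) * (\<Sum>i<I. (\<Sum>l<M. (cmod (P i l))\<^sup>2) / q ^ i)"
    by (simp add: sum_distrib_left[symmetric] sum_divide_distrib) (subst sum.swap, simp)
  also have "\<dots> = 1 / (1 - q) * (\<Sum>i<I. real M * (\<Sum>k<M. (cmod (c (i * M + k) * u ^ (i * M + k)))\<^sup>2 / q ^ i))"
    unfolding P_def finite_parseval by (simp add: sum_divide_distrib sum_distrib_left)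
  also have "\<dots> \<le> 1 / (1 - q) * (\<Sum>i<I. real M * (\<Sum>k<M. (cmod (c (i * M + k)))\<^sup>2 * cmod u ^ (i * M + k)))"
  proof (intro mult_left_mono sum_mono)
    \<comment> \<open>The sampled terms carry \<open>cmod u ^ (2 * m)\<close>; one factor
      \<open>cmod u ^ m\<close> pays for the weight \<open>q ^ i\<close>, the other remains in the
      bound.\<close>
    fix i k
    have "cmod u ^ (i * M + k) = (cmod u ^ M) ^ i * cmod u ^ k"
      by (simp add: power_add power_mult mult.commute)
    also have "\<dots> \<le> q ^ i * 1"
      using u q by (intro mult_mono power_mono power_le_one) auto
    finally have "cmod u ^ (i * M + k) / q ^ i \<le> 1" using q by simp
    then have "(cmod (c (i * M + k)))\<^sup>2 * cmod u ^ (i * M + k) * (cmod u ^ (i * M + k) / q ^ i) \<le>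
        (cmod (c (i * M + k)))\<^sup>2 * cmod u ^ (i * M + k) * 1"
      by (intro mult_left_mono) auto
    then show "(cmod (c (i * M + k) * u ^ (i * M + k)))\<^sup>2 / q ^ i \<le> (cmod (c (i * M + k)))\<^sup>2 * cmod u ^ (i * M + k)"
      by (simp add: norm_mult norm_power power_mult_distrib power2_eq_square mult_ac)
  qed (use q in auto)
  also have "\<dots> = real M / (1 - q) * (\<Sum>m<I * M. (cmod (c m))\<^sup>2 * cmod u ^ m)"
    unfolding sum_blocks by (simp add: sum_distrib_left mult_ac)
  finally show ?thesis .
qed

lemma sampling_bound:
  assumes M: "0 < M" and q: "0 < q" "q < 1" and u: "cmod u \<le> 1" "cmod u ^ M \<le> q"
    and g: "\<And>l. l < M \<Longrightarrow> ((\<lambda>m. c m * (unit_root M l * u) ^ m) has_sum g l) (UNIV :: nat set)"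
  shows "(\<Sum>l<M. ennreal ((cmod (g l))\<^sup>2)) \<le>
    ennreal (real M / (1 - q)) * (\<integral>\<^sup>+m. ennreal ((cmod (c m))\<^sup>2 * cmod u ^ m) \<partial>count_space UNIV)"
proof -
  let ?T = "\<integral>\<^sup>+m. ennreal ((cmod (c m))\<^sup>2 * cmod u ^ m) \<partial>count_space UNIV"
  let ?S = "\<lambda>I. \<Sum>l<M. (cmod (\<Sum>m<I * M. c m * (unit_root M l * u) ^ m))\<^sup>2"
  have "(\<lambda>I. ennreal (?S I)) \<longlonglongrightarrow> ennreal (\<Sum>l<M. (cmod (g l))\<^sup>2)"
  proof (intro tendsto_ennrealI tendsto_sum tendsto_power tendsto_norm)
    fix l assume "l \<in> {..<M}"
    then have "(\<lambda>N. \<Sum>m<N. c m * (unit_root M l * u) ^ m) \<longlonglongrightarrow> g l"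
      using has_sum_imp_sums[OF g] by (simp add: sums_def)
    moreover have "filterlim (\<lambda>I. I * M) sequentially sequentially"
      using M by (intro filterlim_subseq) (auto simp: strict_mono_def)
    ultimately show "(\<lambda>I. \<Sum>m<I * M. c m * (unit_root M l * u) ^ m) \<longlonglongrightarrow> g l"
      by (rule filterlim_compose)
  qed
  moreover have "ennreal (?S I) \<le> ennreal (real M / (1 - q)) * ?T" for I
  proof -
    have "ennreal (?S I) \<le> ennreal (real M / (1 - q) * (\<Sum>m<I * M. (cmod (c m))\<^sup>2 * cmod u ^ m))"
      by (intro ennreal_leI blocked_sampling_bound assms)
    also have "\<dots> = ennreal (real M / (1 - q)) * (\<Sum>m<I * M. ennreal ((cmod (c m))\<^sup>2 * cmod u ^ m))"
      using q by (subst ennreal_mult) (auto simp: sum_nonneg)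
    also have "\<dots> \<le> ennreal (real M / (1 - q)) * ?T"
      unfolding nn_integral_count_space_nat by (intro mult_left_mono sum_le_suminf) auto
    finally show ?thesis .
  qed
  ultimately have "ennreal (\<Sum>l<M. (cmod (g l))\<^sup>2) \<le> ennreal (real M / (1 - q)) * ?T"
    by (intro LIMSEQ_le_const2) auto
  then show ?thesis by simp
qed

text \<open>At a sample point of the second variable the row sums are coefficients of a power series
  in the first. Sampling is applied to that series, and then to each row.\<close>

lemma bidisc_sampling_bound:
  assumes g: "bidisc_expansion g B" and M: "0 < M" "0 < M'" and q: "0 < q" "q < 1"
    and u: "cmod u < 1" "cmod u ^ M \<le> q" and v: "cmod v < 1" "cmod v ^ M' \<le> q"
  shows "(\<Sum>l<M. \<Sum>l'<M'. ennreal ((cmod (g (unit_root M l * u) (unit_root M' l' * v)))\<^sup>2)) \<le>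
    ennreal (real M / (1 - q)) * (ennreal (real M' / (1 - q)) *
    (\<integral>\<^sup>+m. \<integral>\<^sup>+n. ennreal ((cmod (B m n))\<^sup>2 * cmod u ^ m * cmod v ^ n) \<partial>count_space UNIV \<partial>count_space UNIV))"
proof -
  define b where "b m l' = (\<Sum>\<^sub>\<infinity>n. B m n * (unit_root M' l' * v) ^ n)" for m l'
  have in1: "unit_root M l * u \<in> ball 0 1" for l using u by (simp add: norm_mult)
  have in2: "unit_root M' l * v \<in> ball 0 1" for l using v by (simp add: norm_mult)
  have "(\<Sum>l<M. \<Sum>l'<M'. ennreal ((cmod (g (unit_root M l * u) (unit_root M' l' * v)))\<^sup>2)) =
      (\<Sum>l'<M'. \<Sum>l<M. ennreal ((cmod (g (unit_root M l * u) (unit_root M' l' * v)))\<^sup>2))"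
    by (rule sum.swap)
  also have "\<dots> \<le> (\<Sum>l'<M'. ennreal (real M / (1 - q)) *
      (\<integral>\<^sup>+m. ennreal ((cmod (b m l'))\<^sup>2 * cmod u ^ m) \<partial>count_space UNIV))"
    using u unfolding b_def
    by (intro sum_mono sampling_bound[OF M(1) q] bidisc_expansion_slices(2)[OF g in2 in1]) auto
  also have "\<dots> = ennreal (real M / (1 - q)) *
      (\<integral>\<^sup>+m. (\<Sum>l'<M'. ennreal ((cmod (b m l'))\<^sup>2)) * ennreal (cmod u ^ m) \<partial>count_space UNIV)"
    by (simp add: sum_distrib_left[symmetric] nn_integral_sum[symmetric] ennreal_mult sum_distrib_right del: sum_ennreal)
  also have "\<dots> \<le> ennreal (real M / (1 - q)) * (\<integral>\<^sup>+m. (ennreal (real M' / (1 - q)) *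
      (\<integral>\<^sup>+n. ennreal ((cmod (B m n))\<^sup>2 * cmod v ^ n) \<partial>count_space UNIV)) * ennreal (cmod u ^ m) \<partial>count_space UNIV)"
    using v unfolding b_def
    by (intro mult_left_mono nn_integral_mono mult_right_mono sampling_bound[OF M(2) q]
        has_sum_infsum[OF bidisc_expansion_slices(1)[OF g in2]]) auto
  also have "(\<integral>\<^sup>+m. (ennreal (real M' / (1 - q)) *
      (\<integral>\<^sup>+n. ennreal ((cmod (B m n))\<^sup>2 * cmod v ^ n) \<partial>count_space UNIV)) * ennreal (cmod u ^ m) \<partial>count_space UNIV) =
    ennreal (real M' / (1 - q)) *
    (\<integral>\<^sup>+m. \<integral>\<^sup>+n. ennreal ((cmod (B m n))\<^sup>2 * cmod u ^ m * cmod v ^ n) \<partial>count_space UNIV \<partial>count_space UNIV)"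
    by (subst nn_integral_cmult[symmetric], simp)
      (intro nn_integral_cong, simp add: nn_integral_cmult[symmetric] nn_integral_multc[symmetric] ennreal_mult mult_ac)
  finally show ?thesis .
qed

subsection \<open>A mean value inequality\<close>

text \<open>Cauchy's formula for the square of \<open>h\<close>: on the circle of radius
  \<open>2 * r\<close> the distance to \<open>z\<close> is at least half the radius, whence the
  factor 2. The circle does not depend on \<open>z\<close>, so one mean controls a whole disc of
  points.\<close>

lemma norm_square_le_circle_mean:
  assumes h: "h holomorphic_on ball 0 1" and r: "0 < r" "cmod c + 2 * r < 1" and z: "cmod (z - c) \<le> r"
  shows "ennreal ((cmod (h z))\<^sup>2) \<le>
    2 * (\<integral>\<^sup>+\<theta>\<in>{0..1}. ennreal ((cmod (h (c + of_real (2 * r) * cis (2 * pi * \<theta>))))\<^sup>2) \<partial>lborel)"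
proof -
  define \<gamma> where "\<gamma> \<theta> = c + of_real (2 * r) * cis (2 * pi * \<theta>)" for \<theta>
  have \<gamma>: "circlepath c (2 * r) \<theta> = \<gamma> \<theta>" for \<theta>
    by (simp add: circlepath \<gamma>_def cis_conv_exp mult_ac)
  have sub: "cball c (2 * r) \<subseteq> ball 0 1"
  proof
    fix x assume "x \<in> cball c (2 * r)"
    then have "cmod x \<le> cmod c + 2 * r"
      using norm_triangle_ineq[of c "x - c"] by (simp add: dist_norm norm_minus_commute)
    with r show "x \<in> ball 0 1" by simp
  qed
  have \<gamma>_in: "\<gamma> \<theta> \<in> ball 0 1" for \<theta>
    using r by (intro subsetD[OF sub]) (simp add: \<gamma>_def dist_norm norm_mult)
  have cont: "continuous_on {0..1} (\<lambda>\<theta>. (cmod (h (\<gamma> \<theta>)))\<^sup>2)"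
  proof (intro continuous_intros continuous_on_compose2[OF holomorphic_on_imp_continuous_on[OF h]])
    show "continuous_on {0..1} \<gamma>" unfolding \<gamma>_def by (intro continuous_intros)
  qed (use \<gamma>_in in auto)
  have "(\<lambda>w. (h w)\<^sup>2) holomorphic_on cball c (2 * r)"
    using holomorphic_on_subset[OF h sub] by (intro holomorphic_intros)
  then have "((\<lambda>w. (h w)\<^sup>2 / (w - z)) has_contour_integral (2 * of_real pi * \<i> * (h z)\<^sup>2)) (circlepath c (2 * r))"
    using z r by (intro Cauchy_integral_circlepath_simple) (auto simp: norm_minus_commute)
  then have I: "((\<lambda>\<theta>. (h (\<gamma> \<theta>))\<^sup>2 / (\<gamma> \<theta> - z) * vector_derivative (circlepath c (2 * r)) (at \<theta> within {0..1}))
      has_integral (2 * of_real pi * \<i> * (h z)\<^sup>2)) {0..1}"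
    by (simp add: has_contour_integral_def \<gamma>)
  let ?J = "integral {0..1} (\<lambda>\<theta>. (cmod (h (\<gamma> \<theta>)))\<^sup>2)"
  have J: "((\<lambda>\<theta>. (cmod (h (\<gamma> \<theta>)))\<^sup>2) has_integral ?J) {0..1}"
    by (intro integrable_integral integrable_continuous_real cont)
  have "norm (integral {0..1} (\<lambda>\<theta>. (h (\<gamma> \<theta>))\<^sup>2 / (\<gamma> \<theta> - z) * vector_derivative (circlepath c (2 * r)) (at \<theta> within {0..1})))
     \<le> integral {0..1} (\<lambda>\<theta>. 4 * pi * (cmod (h (\<gamma> \<theta>)))\<^sup>2)"
  proof (rule Henstock_Kurzweil_Integration.integral_norm_bound_integral)
    fix \<theta> :: real assume \<theta>: "\<theta> \<in> {0..1}"
    have "2 * r = cmod (\<gamma> \<theta> - c)" using r by (simp add: \<gamma>_def norm_mult)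
    also have "\<dots> \<le> cmod (\<gamma> \<theta> - z) + cmod (z - c)" using norm_triangle_ineq[of "\<gamma> \<theta> - z" "z - c"] by simp
    finally have rz: "r \<le> cmod (\<gamma> \<theta> - z)" using z by simp
    have vd: "norm (vector_derivative (circlepath c (2 * r)) (at \<theta> within {0..1})) = 4 * pi * r"
      using \<theta> r by (simp add: vector_derivative_circlepath01 norm_mult)
    have "r / cmod (\<gamma> \<theta> - z) \<le> 1"
      by (subst divide_le_eq_1_pos) (use rz r in linarith)+
    then have "(cmod (h (\<gamma> \<theta>)))\<^sup>2 * (r / cmod (\<gamma> \<theta> - z)) \<le> (cmod (h (\<gamma> \<theta>)))\<^sup>2 * 1"
      by (intro mult_left_mono) auto
    then have "4 * pi * ((cmod (h (\<gamma> \<theta>)))\<^sup>2 * (r / cmod (\<gamma> \<theta> - z))) \<le> 4 * pi * ((cmod (h (\<gamma> \<theta>)))\<^sup>2 * 1)"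
      by (rule mult_left_mono) auto
    moreover have "norm ((h (\<gamma> \<theta>))\<^sup>2 / (\<gamma> \<theta> - z) * vector_derivative (circlepath c (2 * r)) (at \<theta> within {0..1})) =
        4 * pi * ((cmod (h (\<gamma> \<theta>)))\<^sup>2 * (r / cmod (\<gamma> \<theta> - z)))"
      unfolding norm_mult norm_divide norm_power vd by simp
    ultimately show "norm ((h (\<gamma> \<theta>))\<^sup>2 / (\<gamma> \<theta> - z) * vector_derivative (circlepath c (2 * r)) (at \<theta> within {0..1}))
        \<le> 4 * pi * (cmod (h (\<gamma> \<theta>)))\<^sup>2"
      by (simp only: mult_1_right)
  qed (use I J in \<open>auto simp: has_integral_integrable_integral\<close>)
  then have "2 * pi * (cmod (h z))\<^sup>2 \<le> 4 * pi * ?J"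
    using integral_unique[OF I] by (simp add: norm_mult norm_power)
  then have "(cmod (h z))\<^sup>2 \<le> 2 * ?J" by simp
  then have "ennreal ((cmod (h z))\<^sup>2) \<le> 2 * ennreal ?J"
    by (metis ennreal_leI ennreal_mult' ennreal_numeral zero_le_numeral)
  also have "ennreal ?J = (\<integral>\<^sup>+\<theta>\<in>{0..1}. ennreal ((cmod (h (\<gamma> \<theta>)))\<^sup>2) \<partial>lborel)"
    by (rule nn_integral_has_integral_lebesgue'[OF _ J, symmetric]) simp
  finally show ?thesis unfolding \<gamma>_def .
qed

subsection \<open>A dyadic sum\<close>

text \<open>With \<open>s = m * \<delta> * y\<close> the difference \<open>F y - F (y / 2)\<close>
  equals \<open>(y / 2) / ((1 + s) * (1 + s / 2))\<close>, and the exponential bound on the power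
  decays faster than this. Over dyadic \<open>y\<close> the right side telescopes.\<close>

lemma dyadic_decay_step:
  fixes m :: nat
  assumes "0 \<le> \<delta>" "\<delta> * y \<le> 1" "0 \<le> y"
  defines "F \<equiv> \<lambda>y. y / (1 + real m * \<delta> * y)"
  shows "y * (1 - \<delta> * y) ^ m \<le> 3 * (F y - F (y / 2))"
proof -
  define s where "s = real m * \<delta> * y"
  have s: "0 \<le> s" using assms by (simp add: s_def)
  have "(1 - \<delta> * y) ^ m \<le> exp (- (\<delta> * y)) ^ m"
    using assms exp_ge_add_one_self[of "- (\<delta> * y)"] by (intro power_mono) auto
  also have "\<dots> = exp (real m * - (\<delta> * y))" by (rule exp_of_nat_mult[symmetric])
  also have "\<dots> = 1 / exp s" by (simp add: s_def exp_minus inverse_eq_divide mult_ac)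
  also have "\<dots> \<le> 3 / 2 / ((1 + s) * (1 + s / 2))"
  proof -
    have "(1 + s) * (1 + s / 2) \<le> 3 / 2 * (1 + s + s\<^sup>2 / 2)" using s by (simp add: power2_eq_square field_simps)
    also have "\<dots> \<le> 3 / 2 * exp s" using exp_lower_Taylor_quadratic[OF s] by simp
    finally have "(1 + s) * (1 + s / 2) \<le> 3 / 2 * exp s" .
    moreover have "0 < (1 + s) * (1 + s / 2)" using s by (intro mult_pos_pos) auto
    ultimately show ?thesis by (subst pos_le_divide_eq) (simp_all add: pos_divide_le_eq)
  qed
  finally have "y * (1 - \<delta> * y) ^ m \<le> y * (3 / 2 / ((1 + s) * (1 + s / 2)))"
    using assms by (intro mult_left_mono) auto
  also have "\<dots> = 3 * (y / (1 + s) - (y / 2) / (1 + s / 2))"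
    using s by (simp add: divide_simps add_pos_nonneg) (simp add: algebra_simps)
  also have "\<dots> = 3 * (F y - F (y / 2))" by (simp add: F_def s_def)
  finally show ?thesis .
qed

text \<open>Telescoping leaves at most \<open>3 * F 1\<close>, and \<open>\<delta> \<le> 1\<close>
  gives \<open>1 + m * \<delta> \<ge> \<delta> * (m + 1)\<close>. Summation over scales thus
  produces the weight of the \<open>m\<close>-th coefficient.\<close>

lemma dyadic_decay_sum:
  assumes \<delta>: "0 < \<delta>" "\<delta> \<le> 1"
  shows "(\<integral>\<^sup>+j. ennreal (1 / 2 ^ j * (1 - \<delta> * (1 / 2 ^ j)) ^ m) \<partial>count_space UNIV) \<le> ennreal (3 / (\<delta> * (real m + 1)))"
proof -
  define F where "F y = y / (1 + real m * \<delta> * y)" for y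
  have le1: "\<delta> * (1 / 2 ^ j) \<le> 1" for j :: nat
    using \<delta> by (simp add: divide_simps) (meson one_le_numeral one_le_power order_trans)
  have "(\<Sum>j<N. 1 / 2 ^ j * (1 - \<delta> * (1 / 2 ^ j)) ^ m) \<le> 3 / (\<delta> * (real m + 1))" for N
  proof -
    have "(\<Sum>j<N. 1 / 2 ^ j * (1 - \<delta> * (1 / 2 ^ j)) ^ m) \<le> (\<Sum>j<N. 3 * (F (1 / 2 ^ j) - F (1 / 2 ^ Suc j)))"
    proof (rule sum_mono)
      fix j
      show "1 / 2 ^ j * (1 - \<delta> * (1 / 2 ^ j)) ^ m \<le> 3 * (F (1 / 2 ^ j) - F (1 / 2 ^ Suc j))"
        using dyadic_decay_step[of \<delta> "1 / 2 ^ j" m] \<delta> le1[of j] unfolding F_def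
        by (simp add: mult.commute)
    qed
    also have "\<dots> = 3 * (F 1 - F (1 / 2 ^ N))"
      unfolding sum_distrib_left[symmetric] by (subst sum_lessThan_telescope') simp
    also have "\<dots> \<le> 3 * F 1" using \<delta> by (auto simp: F_def)
    also have "\<dots> \<le> 3 / (\<delta> * (real m + 1))"
      using \<delta> unfolding F_def by (auto simp: algebra_simps intro!: divide_left_mono mult_pos_pos add_pos_nonneg)
    finally show ?thesis .
  qed
  moreover have "0 \<le> 1 / 2 ^ j * (1 - \<delta> * (1 / 2 ^ j)) ^ m" for j :: nat
    using le1[of j] by simp
  ultimately show ?thesis
    unfolding nn_integral_count_space_nat suminf_eq_SUP
    by (intro SUP_least) (subst sum_ennreal; simp add: ennreal_leI)
qed

subsection \<open>Controlling a function on boxes by its coefficients\<close>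

text \<open>With \<open>t = 1 / 2 ^ j\<close> the centres have modulus \<open>1 - 3/4 * t\<close>,
  the radial middle of the box, and are 1/256 of its angle apart. A point of the box is within
  \<open>t / 4 + t / 32 \<le> 3/10 * t\<close> of a centre, and circles of twice the radius
  \<open>3/10 * t\<close> stay \<open>3/20 * t\<close> away from the unit circle.\<close>

definition grid_offset :: "nat \<Rightarrow> nat \<Rightarrow> real \<Rightarrow> complex" where
  "grid_offset j i \<theta> = of_real (1 - 3/4 * (1 / 2 ^ j)) * cis (2 * pi * (real i / (256 * 2 ^ j))) +
     of_real (2 * (3/10 * (1 / 2 ^ j))) * cis (2 * pi * \<theta>)"

text \<open>The circles \<open>\<theta> \<mapsto> grid_point \<alpha> i \<theta>\<close>, \<open>i \<le> 256\<close>, have radius comparable to their distance from the unit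
  circle and the discs of half the radius cover the box of \<open>\<alpha>\<close>.  For fixed \<open>i\<close> and \<open>\<theta>\<close> the points of one
  generation are rotations of each other.\<close>

definition grid_point :: "vertex \<Rightarrow> nat \<Rightarrow> real \<Rightarrow> complex" where
  "grid_point \<alpha> i \<theta> = unit_root (2 ^ length \<alpha>) (arc_index \<alpha>) * grid_offset (length \<alpha>) i \<theta>"

lemma norm_grid_offset: "cmod (grid_offset j i \<theta>) \<le> 1 - 3/20 * (1 / 2 ^ j)"
proof -
  have t: "(1::real) / 2 ^ j \<le> 1" "0 < (1::real) / 2 ^ j" by auto
  have "cmod (grid_offset j i \<theta>) \<le> \<bar>1 - 3/4 * (1 / 2 ^ j)\<bar> + \<bar>2 * (3/10 * (1 / 2 ^ j))\<bar>"
    unfolding grid_offset_def by (rule order_trans[OF norm_triangle_ineq]) (simp only: norm_mult norm_of_real norm_cis mult_1_right)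
  also have "\<dots> = 1 - 3/20 * (1 / 2 ^ j)"
  proof -
    have "\<bar>1 - 3/4 * t\<bar> + \<bar>2 * (3/10 * t)\<bar> = 1 - 3/20 * t" if "0 < t" "t \<le> 1" for t :: real
      using that by simp
    from this[OF t(2,1)] show ?thesis .
  qed
  finally show ?thesis .
qed

lemma norm_grid_offset_less: "cmod (grid_offset j i \<theta>) < 1"
proof -
  have "(0::real) < 3/20 * (1 / 2 ^ j)" by simp
  with norm_grid_offset[of j i \<theta>] show ?thesis by linarith
qed

lemma grid_point_in_ball: "grid_point \<alpha> i \<theta> \<in> ball 0 1"
  using norm_grid_offset_less by (simp add: grid_point_def norm_mult)

text \<open>The distance to the circle is proportional to \<open>1 / 2 ^ j\<close>, so the sampling
  bound with \<open>2 ^ j\<close> points holds with one \<open>q\<close> for all generations; the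
  power is at most \<open>exp (- (3/20))\<close>, and 20/23 is below 7/8.\<close>

lemma norm_grid_offset_power: "cmod (grid_offset j i \<theta>) ^ (2 ^ j) \<le> 7 / 8"
proof -
  define x :: real where "x = 3/20 * (1 / 2 ^ j)"
  have "(1::real) / 2 ^ j \<le> 1" by simp
  then have x: "0 \<le> 1 - x" unfolding x_def by linarith
  have "cmod (grid_offset j i \<theta>) ^ (2 ^ j) \<le> (1 - x) ^ (2 ^ j)"
    using norm_grid_offset[of j i \<theta>] by (intro power_mono) (auto simp: x_def)
  also have "\<dots> \<le> exp (- x) ^ (2 ^ j)"
    using x exp_ge_add_one_self[of "- x"] by (intro power_mono) auto
  also have "\<dots> = exp (real (2 ^ j) * - x)" by (rule exp_of_nat_mult[symmetric])
  also have "\<dots> = exp (- (3/20))" by (simp add: x_def)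
  also have "\<dots> = 1 / exp (3/20)" by (simp add: exp_minus inverse_eq_divide)
  also have "\<dots> \<le> 1 / (23/20)"
    using exp_ge_add_one_self[of "3/20"] by (intro divide_left_mono) auto
  finally show ?thesis by simp
qed

lemma grid_offset_measurable [measurable]: "grid_offset j i \<in> borel_measurable borel"
  unfolding grid_offset_def by (intro borel_measurable_continuous_onI continuous_intros)

lemma grid_point_measurable [measurable]: "grid_point \<alpha> i \<in> borel_measurable borel"
  unfolding grid_point_def by measurable

lemma whitney_box_near_grid:
  assumes z: "z \<in> whitney_box \<alpha>"
  obtains i where "i \<le> 256" and "cmod (cnj (unit_root (2 ^ length \<alpha>) (arc_index \<alpha>)) * z -
    of_real (1 - 3/4 * (1 / 2 ^ length \<alpha>)) * cis (2 * pi * (real i / (256 * 2 ^ length \<alpha>)))) \<le> 3/10 * (1 / 2 ^ length \<alpha>)"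
proof -
  define t :: real where "t = 1 / 2 ^ length \<alpha>"
  have t: "0 < t" "t \<le> 1" by (auto simp: t_def)
  obtain \<rho> x where z_eq: "z = of_real \<rho> * cis (2 * pi * x)" and x: "x \<in> dyadic_interval \<alpha>"
    and \<rho>: "1 - t \<le> \<rho>" "\<rho> \<le> 1 - t / 2"
    using z unfolding whitney_box_eq arc_eq t_def by auto
  define y where "y = x - arc_index \<alpha> / 2 ^ length \<alpha>"
  have y: "0 \<le> y" "y \<le> t" using x by (auto simp: dyadic_interval_def y_def t_def add_divide_distrib)
  \<comment> \<open>The arc is closed, so its right end gives \<open>i = 256\<close>: there are 257
    centres.\<close>
  define i where "i = nat \<lfloor>256 * 2 ^ length \<alpha> * y\<rfloor>"
  have pos: "(0::real) < 256 * 2 ^ length \<alpha>" by simp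
  have s: "0 \<le> 256 * 2 ^ length \<alpha> * y" "256 * 2 ^ length \<alpha> * y \<le> 256"
    using y by (auto simp: t_def field_simps)
  then have i: "real i \<le> 256 * 2 ^ length \<alpha> * y" "256 * 2 ^ length \<alpha> * y \<le> real i + 1"
    by (auto simp: i_def)
  then have "i \<le> 256" using s(2) by (simp flip: of_nat_le_iff)
  have "\<bar>256 * 2 ^ length \<alpha> * y - real i\<bar> \<le> 1" using i by linarith
  moreover have "256 * 2 ^ length \<alpha> * (y - real i / (256 * 2 ^ length \<alpha>)) = 256 * 2 ^ length \<alpha> * y - real i"
    by (simp add: field_simps)
  ultimately have "256 * 2 ^ length \<alpha> * \<bar>y - real i / (256 * 2 ^ length \<alpha>)\<bar> \<le> 1"
    by (metis abs_mult abs_of_pos pos)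
  then have yi: "\<bar>y - real i / (256 * 2 ^ length \<alpha>)\<bar> \<le> t / 256"
    by (simp add: t_def field_simps)
  have rot: "cnj (unit_root (2 ^ length \<alpha>) (arc_index \<alpha>)) * z = of_real \<rho> * cis (2 * pi * y)"
    unfolding z_eq unit_root_def y_def cis_cnj
    by (simp add: cis_mult mult.left_commute[of "cis _" "of_real _"] algebra_simps)
  let ?c = "cis (2 * pi * (real i / (256 * 2 ^ length \<alpha>)))"
  have "of_real \<rho> * cis (2 * pi * y) - of_real (1 - 3/4 * t) * ?c =
      of_real (\<rho> - (1 - 3/4 * t)) * cis (2 * pi * y) + of_real (1 - 3/4 * t) * (cis (2 * pi * y) - ?c)"
    by (simp add: algebra_simps)
  also have "cmod \<dots> \<le> cmod (of_real (\<rho> - (1 - 3/4 * t)) * cis (2 * pi * y)) +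
      cmod (of_real (1 - 3/4 * t) * (cis (2 * pi * y) - ?c))"
    by (rule norm_triangle_ineq)
  also have "\<dots> = \<bar>\<rho> - (1 - 3/4 * t)\<bar> + \<bar>1 - 3/4 * t\<bar> * cmod (cis (2 * pi * y) - ?c)"
    by (simp only: norm_mult norm_of_real norm_cis mult_1_right)
  also have "\<dots> \<le> t / 4 + 1 * (8 * (t / 256))"
  proof (intro add_mono mult_mono)
    show "\<bar>\<rho> - (1 - 3/4 * t)\<bar> \<le> t / 4" using \<rho> by linarith
    have "cmod (cis (2 * pi * y) - ?c) \<le> \<bar>2 * pi * y - 2 * pi * (real i / (256 * 2 ^ length \<alpha>))\<bar>"
      by (rule norm_cis_diff_le)
    also have "\<dots> = 2 * pi * \<bar>y - real i / (256 * 2 ^ length \<alpha>)\<bar>"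
      unfolding right_diff_distrib[symmetric] by (simp add: abs_mult)
    also have "\<dots> \<le> 8 * (t / 256)"
      using pi_less_4 by (intro mult_mono yi) auto
    finally show "cmod (cis (2 * pi * y) - ?c) \<le> 8 * (t / 256)" .
  qed (use t in auto)
  also have "\<dots> \<le> 3/10 * t" using t by simp
  finally have "cmod (cnj (unit_root (2 ^ length \<alpha>) (arc_index \<alpha>)) * z - of_real (1 - 3/4 * t) * ?c) \<le> 3/10 * t"
    unfolding rot .
  with \<open>i \<le> 256\<close> show ?thesis using that unfolding t_def by blast
qed

lemma whitney_box_mean:
  assumes h: "h holomorphic_on ball 0 1" and z: "z \<in> whitney_box \<alpha>"
  shows "ennreal ((cmod (h z))\<^sup>2) \<le>
    2 * (\<Sum>i\<le>256. \<integral>\<^sup>+\<theta>\<in>{0..1}. ennreal ((cmod (h (grid_point \<alpha> i \<theta>)))\<^sup>2) \<partial>lborel)"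
proof -
  define e where "e = unit_root (2 ^ length \<alpha>) (arc_index \<alpha>)"
  define t :: real where "t = 1 / 2 ^ length \<alpha>"
  have t: "0 < t" "t \<le> 1" by (auto simp: t_def)
  obtain i where i: "i \<le> 256" "cmod (cnj e * z - of_real (1 - 3/4 * t) * cis (2 * pi * (real i / (256 * 2 ^ length \<alpha>)))) \<le> 3/10 * t"
    using whitney_box_near_grid[OF z] unfolding e_def t_def by metis
  have e: "e * (cnj e * z) = z"
    unfolding mult.assoc[symmetric] by (simp add: e_def complex_norm_square[symmetric])
  have holo: "(\<lambda>w. h (e * w)) holomorphic_on ball 0 1"
    by (rule holomorphic_on_compose_gen[OF _ h, unfolded o_def])
       (auto simp: e_def norm_mult intro!: holomorphic_intros)
  have "ennreal ((cmod (h (e * (cnj e * z))))\<^sup>2) \<le>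
    2 * (\<integral>\<^sup>+\<theta>\<in>{0..1}. ennreal ((cmod (h (e * (of_real (1 - 3/4 * t) * cis (2 * pi * (real i / (256 * 2 ^ length \<alpha>)))
       + of_real (2 * (3/10 * t)) * cis (2 * pi * \<theta>)))))\<^sup>2) \<partial>lborel)"
  proof (rule norm_square_le_circle_mean[OF holo _ _ i(2)])
    have "cmod (of_real (1 - 3/4 * t) * cis (2 * pi * (real i / (256 * 2 ^ length \<alpha>)))) = \<bar>1 - 3/4 * t\<bar>"
      by (simp only: norm_mult norm_of_real norm_cis mult_1_right)
    then show "cmod (of_real (1 - 3/4 * t) * cis (2 * pi * (real i / (256 * 2 ^ length \<alpha>)))) + 2 * (3/10 * t) < 1"
      using t by simp
  qed (use t in simp)
  then have "ennreal ((cmod (h z))\<^sup>2) \<le>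
    2 * (\<integral>\<^sup>+\<theta>\<in>{0..1}. ennreal ((cmod (h (grid_point \<alpha> i \<theta>)))\<^sup>2) \<partial>lborel)"
    unfolding e unfolding e_def t_def grid_point_def grid_offset_def .
  also have "\<dots> \<le> 2 * (\<Sum>i\<le>256. \<integral>\<^sup>+\<theta>\<in>{0..1}. ennreal ((cmod (h (grid_point \<alpha> i \<theta>)))\<^sup>2) \<partial>lborel)"
    using i(1) by (intro mult_left_mono member_le_sum) auto
  finally show ?thesis .
qed

text \<open>A majorant of the squared supremum over a pair of boxes that is additive in the squared
  modulus of \<open>g\<close>, unlike the supremum itself. The 4 collects the factor 2 of the mean
  value inequality in each variable.\<close>

definition box_mean :: "(complex \<Rightarrow> complex \<Rightarrow> complex) \<Rightarrow> vertex \<Rightarrow> vertex \<Rightarrow> ennreal" where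
  "box_mean g \<alpha> \<beta> = 4 * (\<Sum>i\<le>256. \<Sum>i'\<le>256. \<integral>\<^sup>+\<theta>\<in>{0..1}. (\<integral>\<^sup>+\<theta>'\<in>{0..1}.
     ennreal ((cmod (g (grid_point \<alpha> i \<theta>) (grid_point \<beta> i' \<theta>')))\<^sup>2) \<partial>lborel) \<partial>lborel)"

lemma grid_integrand_measurable:
  assumes "bidisc_expansion g B"
  shows "(\<lambda>(\<theta>, \<theta>'). ennreal ((cmod (g (grid_point \<alpha> i \<theta>) (grid_point \<beta> i' \<theta>')))\<^sup>2)) \<in> borel_measurable (lborel \<Otimes>\<^sub>M lborel)"
proof -
  have "(\<lambda>x. g (grid_point \<alpha> i (fst x)) (grid_point \<beta> i' (snd x))) \<in> borel_measurable (lborel \<Otimes>\<^sub>M lborel)"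
    by (rule bidisc_expansion_borel_measurable[OF assms]) (auto simp: grid_point_in_ball simp del: mem_ball mem_ball_0)
  then show ?thesis by (simp add: case_prod_unfold)
qed

lemma box_mean_ge:
  assumes g: "bidisc_expansion g B" and z: "z \<in> whitney_box \<alpha>" and w: "w \<in> whitney_box \<beta>"
  shows "ennreal ((cmod (g z w))\<^sup>2) \<le> box_mean g \<alpha> \<beta>"
proof -
  note [measurable] = grid_integrand_measurable[OF g]
  have wb: "w \<in> ball 0 1" using norm_whitney_box[OF w] by simp
  have m1 [measurable]: "(\<lambda>\<theta>. \<integral>\<^sup>+\<theta>'\<in>{0..1}. ennreal ((cmod (g (grid_point \<alpha> i \<theta>) (grid_point \<beta> i' \<theta>')))\<^sup>2) \<partial>lborel)
      \<in> borel_measurable lborel" for i i'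
    by measurable
  have "ennreal ((cmod (g z w))\<^sup>2) \<le>
      2 * (\<Sum>i\<le>256. \<integral>\<^sup>+\<theta>\<in>{0..1}. ennreal ((cmod (g (grid_point \<alpha> i \<theta>) w))\<^sup>2) \<partial>lborel)"
    by (rule whitney_box_mean[OF bidisc_expansion_holomorphic[OF g wb] z])
  also have "\<dots> \<le> 2 * (\<Sum>i\<le>256. \<integral>\<^sup>+\<theta>\<in>{0..1}. (2 * (\<Sum>i'\<le>256. \<integral>\<^sup>+\<theta>'\<in>{0..1}.
      ennreal ((cmod (g (grid_point \<alpha> i \<theta>) (grid_point \<beta> i' \<theta>')))\<^sup>2) \<partial>lborel)) \<partial>lborel)"
    by (intro mult_left_mono sum_mono nn_integral_mono mult_right_mono
        whitney_box_mean[OF bidisc_expansion_holomorphic[OF bidisc_expansion_swap[OF g] grid_point_in_ball] w]) auto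
  also have "\<dots> = 2 * (\<Sum>i\<le>256. 2 * (\<Sum>i'\<le>256. \<integral>\<^sup>+\<theta>\<in>{0..1}. (\<integral>\<^sup>+\<theta>'\<in>{0..1}.
      ennreal ((cmod (g (grid_point \<alpha> i \<theta>) (grid_point \<beta> i' \<theta>')))\<^sup>2) \<partial>lborel) \<partial>lborel))"
    by (simp add: mult.assoc nn_integral_cmult sum_distrib_right nn_integral_sum del: sum_mult_indicator)
  also have "\<dots> = box_mean g \<alpha> \<beta>"
    unfolding box_mean_def sum_distrib_left[symmetric] by (simp add: mult.assoc[symmetric])
  finally show ?thesis .
qed

lemma finite_generation: "finite {\<alpha> :: vertex. length \<alpha> = j}"
  using finite_lists_length_eq[of "UNIV :: bool set" j] by simp

lemma nn_integral_generations:
  "(\<integral>\<^sup>+\<alpha>. F \<alpha> \<partial>count_space UNIV) = (\<integral>\<^sup>+j. (\<Sum>\<alpha> | length \<alpha> = j. F \<alpha>) \<partial>count_space UNIV)"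
  for F :: "vertex \<Rightarrow> ennreal"
proof -
  have "(\<integral>\<^sup>+j. F \<alpha> * indicator {length \<alpha>} j \<partial>count_space UNIV) = F \<alpha>" for \<alpha>
    by (subst nn_integral_cmult) auto
  then have "(\<integral>\<^sup>+\<alpha>. F \<alpha> \<partial>count_space UNIV) =
      (\<integral>\<^sup>+\<alpha>. \<integral>\<^sup>+j. F \<alpha> * indicator {length \<alpha>} j \<partial>count_space UNIV \<partial>count_space UNIV)" by simp
  also have "\<dots> = (\<integral>\<^sup>+j. \<integral>\<^sup>+\<alpha>. F \<alpha> * indicator {length \<alpha>} j \<partial>count_space UNIV \<partial>count_space UNIV)"
    by (rule nn_integral_count_space_nn_integral) auto
  also have "\<dots> = (\<integral>\<^sup>+j. (\<Sum>\<alpha> | length \<alpha> = j. F \<alpha>) \<partial>count_space UNIV)"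
  proof (intro nn_integral_cong)
    fix j
    have "(\<integral>\<^sup>+\<alpha>. F \<alpha> * indicator {length \<alpha>} j \<partial>count_space UNIV) = (\<Sum>\<alpha> | length \<alpha> = j. F \<alpha> * indicator {length \<alpha>} j)"
      by (rule nn_integral_count_space'[OF finite_generation]) auto
    then show "(\<integral>\<^sup>+\<alpha>. F \<alpha> * indicator {length \<alpha>} j \<partial>count_space UNIV) = (\<Sum>\<alpha> | length \<alpha> = j. F \<alpha>)"
      by simp
  qed
  finally show ?thesis .
qed

text \<open>For fixed \<open>i\<close>, \<open>i'\<close>, \<open>\<theta>\<close>,
  \<open>\<theta>'\<close> the grid points of generations \<open>j\<close> and \<open>k\<close> are
  full orbits under rotation by roots of unity, so sampling on the bidisc applies. The constant
  collects 4 from \<open>box_mean\<close>, 257 squared for the pairs of centres and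
  \<open>1 / (1 - 7/8)\<close> twice.\<close>

lemma box_mean_generation_sum:
  assumes g: "bidisc_expansion g B"
  defines "\<sigma> \<equiv> \<lambda>j. 1 - 3/20 * (1 / 2 ^ j) :: real"
  shows "(\<Sum>\<alpha> | length \<alpha> = j. \<Sum>\<beta> | length \<beta> = k. box_mean g \<alpha> \<beta>) \<le>
    ennreal (4 * 257 * 257 * 64) * (ennreal (2 ^ j) * (ennreal (2 ^ k) *
    (\<integral>\<^sup>+m. \<integral>\<^sup>+n. ennreal ((cmod (B m n))\<^sup>2 * \<sigma> j ^ m * \<sigma> k ^ n) \<partial>count_space UNIV \<partial>count_space UNIV)))"
    (is "_ \<le> ennreal (4 * 257 * 257 * 64) * (_ * (_ * ?S))")
proof -
  note [measurable] = grid_integrand_measurable[OF g]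
  let ?J = "{\<alpha> :: vertex. length \<alpha> = j}" and ?K = "{\<alpha> :: vertex. length \<alpha> = k}"
  have m1 [measurable]: "(\<lambda>\<theta>. \<integral>\<^sup>+\<theta>'\<in>{0..1}. ennreal ((cmod (g (grid_point \<alpha> i \<theta>) (grid_point \<beta> i' \<theta>')))\<^sup>2) \<partial>lborel)
      \<in> borel_measurable lborel" for i i' \<alpha> \<beta>
    by measurable
  have m2 [measurable]: "(\<lambda>\<theta>'. ennreal ((cmod (g (grid_point \<alpha> i \<theta>) (grid_point \<beta> i' \<theta>')))\<^sup>2)) \<in> borel_measurable lborel"
    for i i' \<alpha> \<beta> \<theta>
    by measurable
  define D where "D = ennreal (real (2 ^ j) / (1 - 7/8)) * (ennreal (real (2 ^ k) / (1 - 7/8)) * ?S)"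
  have point: "(\<Sum>\<alpha>\<in>?J. \<Sum>\<beta>\<in>?K. ennreal ((cmod (g (grid_point \<alpha> i \<theta>) (grid_point \<beta> i' \<theta>')))\<^sup>2)) \<le> D" for i i' \<theta> \<theta>'
  proof -
    let ?u = "grid_offset j i \<theta>" and ?v = "grid_offset k i' \<theta>'"
    have "(\<Sum>\<alpha>\<in>?J. \<Sum>\<beta>\<in>?K. ennreal ((cmod (g (grid_point \<alpha> i \<theta>) (grid_point \<beta> i' \<theta>')))\<^sup>2)) =
       (\<Sum>\<alpha>\<in>?J. \<Sum>\<beta>\<in>?K. ennreal ((cmod (g (unit_root (2 ^ j) (arc_index \<alpha>) * ?u) (unit_root (2 ^ k) (arc_index \<beta>) * ?v)))\<^sup>2))"
      by (intro sum.cong refl) (auto simp: grid_point_def)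
    also have "\<dots> = (\<Sum>l<2 ^ j. \<Sum>l'<2 ^ k. ennreal ((cmod (g (unit_root (2 ^ j) l * ?u) (unit_root (2 ^ k) l' * ?v)))\<^sup>2))"
      by (simp only: sum.reindex_bij_betw[OF bij_betw_arc_index[of k], of "\<lambda>l'. ennreal ((cmod (g _ (unit_root (2 ^ k) l' * ?v)))\<^sup>2)"]
          sum.reindex_bij_betw[OF bij_betw_arc_index[of j], of "\<lambda>l. \<Sum>l'<2 ^ k. ennreal ((cmod (g (unit_root (2 ^ j) l * ?u) (unit_root (2 ^ k) l' * ?v)))\<^sup>2)"])
    also have "\<dots> \<le> ennreal (real (2 ^ j) / (1 - 7/8)) * (ennreal (real (2 ^ k) / (1 - 7/8)) *
      (\<integral>\<^sup>+m. \<integral>\<^sup>+n. ennreal ((cmod (B m n))\<^sup>2 * cmod ?u ^ m * cmod ?v ^ n) \<partial>count_space UNIV \<partial>count_space UNIV))"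
      by (rule bidisc_sampling_bound[OF g _ _ _ _ norm_grid_offset_less norm_grid_offset_power
            norm_grid_offset_less norm_grid_offset_power]) auto
    also have "\<dots> \<le> D"
    proof -
      have le: "cmod (grid_offset j i \<theta>) \<le> \<sigma> j" for j i \<theta>
        unfolding \<sigma>_def by (rule norm_grid_offset)
      then have "0 \<le> \<sigma> j" for j by (rule order_trans[OF norm_ge_zero])
      then show ?thesis
        unfolding D_def
        by (intro mult_left_mono nn_integral_mono ennreal_leI mult_mono power_mono le) auto
    qed
    finally show ?thesis .
  qed
  have one: "(\<integral>\<^sup>+\<theta>\<in>{0..1::real}. c \<partial>lborel) = c" for c :: ennreal
    by (simp add: nn_integral_cmult_indicator)
  have "(\<Sum>\<alpha>\<in>?J. \<Sum>\<beta>\<in>?K. \<integral>\<^sup>+\<theta>\<in>{0..1}. (\<integral>\<^sup>+\<theta>'\<in>{0..1}.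
     ennreal ((cmod (g (grid_point \<alpha> i \<theta>) (grid_point \<beta> i' \<theta>')))\<^sup>2) \<partial>lborel) \<partial>lborel) \<le> D" for i i'
  proof -
    have "(\<Sum>\<alpha>\<in>?J. \<Sum>\<beta>\<in>?K. \<integral>\<^sup>+\<theta>\<in>{0..1}. (\<integral>\<^sup>+\<theta>'\<in>{0..1}.
       ennreal ((cmod (g (grid_point \<alpha> i \<theta>) (grid_point \<beta> i' \<theta>')))\<^sup>2) \<partial>lborel) \<partial>lborel) =
      (\<integral>\<^sup>+\<theta>\<in>{0..1}. (\<integral>\<^sup>+\<theta>'\<in>{0..1}. (\<Sum>\<alpha>\<in>?J. \<Sum>\<beta>\<in>?K.
       ennreal ((cmod (g (grid_point \<alpha> i \<theta>) (grid_point \<beta> i' \<theta>')))\<^sup>2)) \<partial>lborel) \<partial>lborel)"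
      by (simp add: nn_integral_sum[symmetric] sum_distrib_right[symmetric] del: sum_ennreal sum_mult_indicator)
    also have "\<dots> \<le> (\<integral>\<^sup>+\<theta>\<in>{0..1::real}. (\<integral>\<^sup>+\<theta>'\<in>{0..1::real}. D \<partial>lborel) \<partial>lborel)"
      by (intro nn_integral_mono mult_right_mono point) auto
    finally show ?thesis by (simp add: one)
  qed
  then have "(\<Sum>i\<le>256::nat. \<Sum>i'\<le>256::nat. \<Sum>\<alpha>\<in>?J. \<Sum>\<beta>\<in>?K. \<integral>\<^sup>+\<theta>\<in>{0..1}. (\<integral>\<^sup>+\<theta>'\<in>{0..1}.
     ennreal ((cmod (g (grid_point \<alpha> i \<theta>) (grid_point \<beta> i' \<theta>')))\<^sup>2) \<partial>lborel) \<partial>lborel) \<le> (\<Sum>i\<le>256::nat. \<Sum>i'\<le>256::nat. D)"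
    by (intro sum_mono)
  also have "\<dots> = ennreal (257 * 257) * D" by (simp add: mult.assoc[symmetric])
  finally have "4 * (\<Sum>i\<le>256::nat. \<Sum>i'\<le>256::nat. \<Sum>\<alpha>\<in>?J. \<Sum>\<beta>\<in>?K. \<integral>\<^sup>+\<theta>\<in>{0..1}. (\<integral>\<^sup>+\<theta>'\<in>{0..1}.
     ennreal ((cmod (g (grid_point \<alpha> i \<theta>) (grid_point \<beta> i' \<theta>')))\<^sup>2) \<partial>lborel) \<partial>lborel) \<le> 4 * (ennreal (257 * 257) * D)"
    by (rule mult_left_mono) simp
  also have "4 * (\<Sum>i\<le>256::nat. \<Sum>i'\<le>256::nat. \<Sum>\<alpha>\<in>?J. \<Sum>\<beta>\<in>?K. \<integral>\<^sup>+\<theta>\<in>{0..1}. (\<integral>\<^sup>+\<theta>'\<in>{0..1}.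
     ennreal ((cmod (g (grid_point \<alpha> i \<theta>) (grid_point \<beta> i' \<theta>')))\<^sup>2) \<partial>lborel) \<partial>lborel) =
     (\<Sum>\<alpha>\<in>?J. \<Sum>\<beta>\<in>?K. box_mean g \<alpha> \<beta>)"
    unfolding box_mean_def sum_distrib_left[symmetric]
    by (subst sum.swap, subst (2) sum.swap, subst (3) sum.swap, subst (2) sum.swap) (rule refl)
  also have "4 * (ennreal (257 * 257) * D) = ennreal (4 * 257 * 257 * 64) * (ennreal (2 ^ j) * (ennreal (2 ^ k) * ?S))"
  proof -
    have "D = ennreal 64 * (ennreal (2 ^ j) * (ennreal (2 ^ k) * ?S))"
    proof -
      have "ennreal (real (2 ^ i) / (1 - 7/8)) = ennreal 8 * ennreal (2 ^ i)" for i :: nat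
        by (subst ennreal_mult[symmetric]) auto
      moreover have "ennreal 64 = ennreal 8 * ennreal 8"
        by (subst ennreal_mult[symmetric]) auto
      ultimately show ?thesis unfolding D_def by (simp only: mult_ac)
    qed
    moreover have "4 * (ennreal (257 * 257) * ennreal 64) = ennreal (4 * 257 * 257 * 64)"
      by (subst ennreal_mult[symmetric]) (auto simp flip: ennreal_numeral ennreal_mult)
    ultimately show ?thesis by (simp only: mult.assoc[symmetric])
  qed
  finally show ?thesis .
qed

text \<open>Sampling costs \<open>2 ^ j\<close> and the rescaling contributes
  \<open>1 / 4 ^ j\<close>; the remaining \<open>1 / 2 ^ j\<close> times the powers of
  \<open>\<sigma> j\<close> is the dyadic sum with \<open>\<delta> = 3/20\<close>, at most
  \<open>20 / (m + 1)\<close>. Two variables give 400.\<close>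

lemma box_mean_sum:
  assumes g: "bidisc_expansion g B"
  shows "(\<integral>\<^sup>+\<alpha>. \<integral>\<^sup>+\<beta>. ennreal (1 / 4 ^ length \<alpha>) * (ennreal (1 / 4 ^ length \<beta>) * box_mean g \<alpha> \<beta>)
      \<partial>count_space UNIV \<partial>count_space UNIV) \<le>
    ennreal (4 * 257 * 257 * 64 * 400) *
      (\<integral>\<^sup>+m. \<integral>\<^sup>+n. ennreal ((cmod (B m n))\<^sup>2 / ((real m + 1) * (real n + 1))) \<partial>count_space UNIV \<partial>count_space UNIV)"
proof -
  define \<sigma> where "\<sigma> j = 1 - 3/20 * (1 / 2 ^ j :: real)" for j :: nat
  let ?c = "ennreal (4 * 257 * 257 * 64)"
  have \<sigma>: "0 \<le> \<sigma> j" for j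
  proof -
    have "(1::real) / 2 ^ j \<le> 1" by simp
    then show ?thesis unfolding \<sigma>_def by linarith
  qed
  have swap: "(\<integral>\<^sup>+x. \<integral>\<^sup>+y. f x y \<partial>count_space UNIV \<partial>count_space UNIV) =
      (\<integral>\<^sup>+y. \<integral>\<^sup>+x. f x y \<partial>count_space UNIV \<partial>count_space UNIV)" for f :: "nat \<Rightarrow> nat \<Rightarrow> ennreal"
    by (rule nn_integral_count_space_nn_integral) auto
  have "(\<integral>\<^sup>+\<alpha>. \<integral>\<^sup>+\<beta>. ennreal (1 / 4 ^ length \<alpha>) * (ennreal (1 / 4 ^ length \<beta>) * box_mean g \<alpha> \<beta>)
      \<partial>count_space UNIV \<partial>count_space UNIV) =
    (\<integral>\<^sup>+j. \<integral>\<^sup>+k. (\<Sum>\<alpha> | length \<alpha> = j. \<Sum>\<beta> | length \<beta> = k. ennreal (1 / 4 ^ j) * (ennreal (1 / 4 ^ k) * box_mean g \<alpha> \<beta>))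
      \<partial>count_space UNIV \<partial>count_space UNIV)"
    by (subst nn_integral_generations, subst nn_integral_generations)
       (simp add: nn_integral_sum[symmetric] del: sum_ennreal)
  also have "\<dots> \<le> (\<integral>\<^sup>+j. \<integral>\<^sup>+k. ennreal (1 / 4 ^ j) * (ennreal (1 / 4 ^ k) * (?c * (ennreal (2 ^ j) * (ennreal (2 ^ k) *
    (\<integral>\<^sup>+m. \<integral>\<^sup>+n. ennreal ((cmod (B m n))\<^sup>2 * \<sigma> j ^ m * \<sigma> k ^ n) \<partial>count_space UNIV \<partial>count_space UNIV)))))
      \<partial>count_space UNIV \<partial>count_space UNIV)"
    unfolding sum_distrib_left[symmetric] \<sigma>_def
    by (intro nn_integral_mono mult_left_mono box_mean_generation_sum[OF g]) auto
  also have "\<dots> = ?c * (\<integral>\<^sup>+j. \<integral>\<^sup>+k. \<integral>\<^sup>+m. \<integral>\<^sup>+n.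
      ennreal ((cmod (B m n))\<^sup>2) * (ennreal (1 / 2 ^ j * \<sigma> j ^ m) * ennreal (1 / 2 ^ k * \<sigma> k ^ n))
      \<partial>count_space UNIV \<partial>count_space UNIV \<partial>count_space UNIV \<partial>count_space UNIV)"
  proof -
    have "ennreal (1 / 4 ^ j) * (ennreal (1 / 4 ^ k) * (?c * (ennreal (2 ^ j) * (ennreal (2 ^ k) *
       ennreal ((cmod (B m n))\<^sup>2 * \<sigma> j ^ m * \<sigma> k ^ n))))) =
      ?c * (ennreal ((cmod (B m n))\<^sup>2) * (ennreal (1 / 2 ^ j * \<sigma> j ^ m) * ennreal (1 / 2 ^ k * \<sigma> k ^ n)))" for j k m n
    proof -
      have four: "(4::real) ^ i = 2 ^ i * 2 ^ i" for i :: nat by (simp flip: power_mult_distrib)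
      have ac: "a * (b * (c * (d * (e * f)))) = c * (a * (b * (d * (e * f))))" for a b c d e f :: ennreal
        by (simp add: mult_ac)
      have "ennreal (1 / 4 ^ j) * (ennreal (1 / 4 ^ k) * (ennreal (2 ^ j) * (ennreal (2 ^ k) *
          ennreal ((cmod (B m n))\<^sup>2 * \<sigma> j ^ m * \<sigma> k ^ n)))) =
        ennreal ((cmod (B m n))\<^sup>2) * (ennreal (1 / 2 ^ j * \<sigma> j ^ m) * ennreal (1 / 2 ^ k * \<sigma> k ^ n))"
        using \<sigma>[of j] \<sigma>[of k] by (simp add: four field_simps flip: ennreal_mult)
      then show ?thesis by (subst ac) (rule arg_cong[where f = "(*) ?c"])
    qed
    then show ?thesis by (simp add: nn_integral_cmult[symmetric])
  qed
  also have "(\<integral>\<^sup>+j. \<integral>\<^sup>+k. \<integral>\<^sup>+m. \<integral>\<^sup>+n.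
      ennreal ((cmod (B m n))\<^sup>2) * (ennreal (1 / 2 ^ j * \<sigma> j ^ m) * ennreal (1 / 2 ^ k * \<sigma> k ^ n))
      \<partial>count_space UNIV \<partial>count_space UNIV \<partial>count_space UNIV \<partial>count_space UNIV) =
    (\<integral>\<^sup>+m. \<integral>\<^sup>+n. \<integral>\<^sup>+j. \<integral>\<^sup>+k.
      ennreal ((cmod (B m n))\<^sup>2) * (ennreal (1 / 2 ^ j * \<sigma> j ^ m) * ennreal (1 / 2 ^ k * \<sigma> k ^ n))
      \<partial>count_space UNIV \<partial>count_space UNIV \<partial>count_space UNIV \<partial>count_space UNIV)"
    (is "(\<integral>\<^sup>+j. \<integral>\<^sup>+k. \<integral>\<^sup>+m. \<integral>\<^sup>+n. ?F j k m n \<partial>_ \<partial>_ \<partial>_ \<partial>_) = _")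
  proof -
    have "(\<integral>\<^sup>+j. \<integral>\<^sup>+k. \<integral>\<^sup>+m. \<integral>\<^sup>+n. ?F j k m n \<partial>count_space UNIV \<partial>count_space UNIV \<partial>count_space UNIV \<partial>count_space UNIV) =
       (\<integral>\<^sup>+j. \<integral>\<^sup>+m. \<integral>\<^sup>+n. \<integral>\<^sup>+k. ?F j k m n \<partial>count_space UNIV \<partial>count_space UNIV \<partial>count_space UNIV \<partial>count_space UNIV)"
      by (rule nn_integral_cong, subst swap, rule nn_integral_cong, rule swap)
    also have "\<dots> = (\<integral>\<^sup>+m. \<integral>\<^sup>+n. \<integral>\<^sup>+j. \<integral>\<^sup>+k. ?F j k m n \<partial>count_space UNIV \<partial>count_space UNIV \<partial>count_space UNIV \<partial>count_space UNIV)"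
      by (subst swap, rule nn_integral_cong, rule swap)
    finally show ?thesis .
  qed
  also have "\<dots> = (\<integral>\<^sup>+m. \<integral>\<^sup>+n. ennreal ((cmod (B m n))\<^sup>2) *
      ((\<integral>\<^sup>+j. ennreal (1 / 2 ^ j * \<sigma> j ^ m) \<partial>count_space UNIV) * (\<integral>\<^sup>+k. ennreal (1 / 2 ^ k * \<sigma> k ^ n) \<partial>count_space UNIV))
      \<partial>count_space UNIV \<partial>count_space UNIV)"
    by (simp add: nn_integral_cmult nn_integral_multc)
  also have "\<dots> \<le> (\<integral>\<^sup>+m. \<integral>\<^sup>+n. ennreal ((cmod (B m n))\<^sup>2) *
      (ennreal (3 / (3/20 * (real m + 1))) * ennreal (3 / (3/20 * (real n + 1)))) \<partial>count_space UNIV \<partial>count_space UNIV)"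
    unfolding \<sigma>_def
    by (intro nn_integral_mono mult_left_mono mult_mono dyadic_decay_sum) auto
  also have "\<dots> = ennreal 400 * (\<integral>\<^sup>+m. \<integral>\<^sup>+n. ennreal ((cmod (B m n))\<^sup>2 / ((real m + 1) * (real n + 1)))
      \<partial>count_space UNIV \<partial>count_space UNIV)"
  proof -
    have "ennreal ((cmod (B m n))\<^sup>2) * (ennreal (3 / (3/20 * (real m + 1))) * ennreal (3 / (3/20 * (real n + 1)))) =
       ennreal 400 * ennreal ((cmod (B m n))\<^sup>2 / ((real m + 1) * (real n + 1)))" for m n
    proof -
      have e: "3 / (3/20 * x) = 20 / x" for x :: real by simp
      have "ennreal b * (ennreal (20 / x) * ennreal (20 / y)) = ennreal 400 * ennreal (b / (x * y))"
        if "0 \<le> b" "0 \<le> x" "0 \<le> y" for b x y :: real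
      proof -
        have "ennreal (20 / x) * ennreal (20 / y) = ennreal (20 / x * (20 / y))"
          using that by (intro ennreal_mult[symmetric]) auto
        moreover have "ennreal b * ennreal (20 / x * (20 / y)) = ennreal (b * (20 / x * (20 / y)))"
          using that by (intro ennreal_mult[symmetric]) auto
        moreover have "ennreal 400 * ennreal (b / (x * y)) = ennreal (400 * (b / (x * y)))"
          using that by (intro ennreal_mult[symmetric]) auto
        ultimately show ?thesis by (simp only:) (simp add: mult.commute)
      qed
      then show ?thesis unfolding e by simp
    qed
    then show ?thesis by (simp add: nn_integral_cmult[symmetric])
  qed
  finally show ?thesis
    unfolding mult.assoc[symmetric] by (simp add: mult_left_mono ennreal_mult'[symmetric] mult.assoc)
qed

subsection \<open>Radial segments\<close>

lemma dyadic_scale: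
  fixes y :: real
  assumes "0 < y" "y \<le> 1"
  obtains j where "1 / 2 ^ Suc j \<le> y" "y \<le> 1 / 2 ^ j" "\<And>i. 1 / 2 ^ Suc i \<le> y \<Longrightarrow> j \<le> i"
proof -
  obtain n where "(1/2) ^ n < y" using real_arch_pow_inv[of y "1/2"] assms by auto
  then have ex: "1 / 2 ^ Suc n \<le> y" by (simp add: power_one_over field_simps)
  define j where "j = (LEAST j. 1 / 2 ^ Suc j \<le> y)"
  have j: "1 / 2 ^ Suc j \<le> y" unfolding j_def using ex by (rule LeastI)
  have min: "1 / 2 ^ Suc i \<le> y \<Longrightarrow> j \<le> i" for i unfolding j_def by (rule Least_le)
  have "y \<le> 1 / 2 ^ j"
  proof (cases j)
    case 0
    then show ?thesis using assms by simp
  next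
    case (Suc i)
    then show ?thesis using min[of i] by fastforce
  qed
  with j min that show ?thesis by blast
qed

lemma end_section_arc:
  assumes "z \<in> sphere 0 1" "end_section b z = End \<omega>"
  shows "z \<in> arc (end_vertex \<omega> j)"
proof -
  have "End \<omega> \<in> end_fibre z" using end_fibre_eq[OF assms(1)] assms(2) by (metis rangeI)
  then show ?thesis by (auto simp: end_fibre_def end_point_eq_iff)
qed

lemma radial_chain:
  assumes w: "cell_weight i z \<noteq> 0" and p: "0 \<le> p" "p < 1"
  shows "\<exists>\<alpha>. cell_point i z \<in> descendants \<alpha> \<and> of_real p * z \<in> whitney_box \<alpha>"
proof (cases i)
  case (Inl \<alpha>)
  with w have "z \<in> whitney_box \<alpha>" by (auto simp: indicator_def split: if_splits)
  then obtain \<rho> u where z: "z = of_real \<rho> * u" "u \<in> arc \<alpha>" "1 - 1 / 2 ^ length \<alpha> \<le> \<rho>" "\<rho> \<le> 1 - 1 / 2 ^ Suc (length \<alpha>)"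
    by (auto simp: whitney_box_eq)
  have "(1::real) / 2 ^ length \<alpha> \<le> 1" by simp
  with z have \<rho>: "0 \<le> \<rho>" by linarith
  have y: "p * \<rho> \<le> \<rho>" "0 \<le> p * \<rho>" using p \<rho> by (auto simp: mult_left_le_one_le)
  have "(0::real) < 1 / 2 ^ Suc (length \<alpha>)" by simp
  with y z(4) have "0 < 1 - p * \<rho>" "1 - p * \<rho> \<le> 1" by linarith+
  then obtain j where j: "1 / 2 ^ Suc j \<le> 1 - p * \<rho>" "1 - p * \<rho> \<le> 1 / 2 ^ j"
    "\<And>i. 1 / 2 ^ Suc i \<le> 1 - p * \<rho> \<Longrightarrow> j \<le> i"
    by (rule dyadic_scale) blast
  \<comment> \<open>Minimality of \<open>j\<close> bounds it by the generation of
    \<open>\<alpha>\<close>, so that \<open>take j \<alpha>\<close> is an ancestor of generation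
    exactly \<open>j\<close>.\<close>
  have "1 / 2 ^ Suc (length \<alpha>) \<le> 1 - p * \<rho>" using y z(4) by linarith
  then have len: "j \<le> length \<alpha>" by (rule j(3))
  have "u \<in> arc (take j \<alpha>)" using arc_antimono[OF take_is_prefix] z(2) by blast
  then have "of_real (p * \<rho>) * u \<in> whitney_box (take j \<alpha>)"
    unfolding whitney_box_def using j(1,2) len by (auto simp del: of_real_mult)
  moreover have "cell_point i z \<in> descendants (take j \<alpha>)"
    using Inl by (auto simp: descendants_def take_is_prefix)
  ultimately show ?thesis unfolding z(1) by (auto simp: mult.assoc)
next
  case (Inr b)
  with w have z: "z \<in> sphere 0 1" by (auto simp: indicator_def split: if_splits)
  have "0 < 1 - p" "1 - p \<le> 1" using p by auto
  then obtain j where j: "1 / 2 ^ Suc j \<le> 1 - p" "1 - p \<le> 1 / 2 ^ j" by (rule dyadic_scale) blast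
  obtain \<omega> where \<omega>: "end_section b z = End \<omega>" by (auto simp: end_section_def)
  have "z \<in> arc (end_vertex \<omega> j)" by (rule end_section_arc[OF z \<omega>])
  then have "of_real p * z \<in> whitney_box (end_vertex \<omega> j)"
    unfolding whitney_box_def using j by (auto simp del: mem_sphere)
  moreover have "cell_point i z \<in> descendants (end_vertex \<omega> j)"
    using Inr \<omega> by (auto simp: descendants_def)
  ultimately show ?thesis by blast
qed

text \<open>The parameter \<open>p\<close> measures length in units of \<open>cmod z\<close>, so a
  box of generation \<open>j\<close> is crossed within an interval of length
  \<open>1 / 2 ^ Suc j / cmod z\<close>, and the factor \<open>cmod z\<close> in the bound cancels
  this. At \<open>z = 0\<close> the same factor forces \<open>h\<close> to vanish.\<close>

lemma radial_integral_le:
  assumes w: "cell_weight i z \<noteq> 0"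
    and h: "\<And>p \<alpha>. 0 \<le> p \<Longrightarrow> p < 1 \<Longrightarrow> of_real p * z \<in> whitney_box \<alpha> \<Longrightarrow> h p \<le> \<Psi> \<alpha> * ennreal (cmod z)"
  shows "(\<integral>\<^sup>+p\<in>{0..<1}. h p \<partial>lborel) \<le>
    (\<integral>\<^sup>+\<alpha>. \<Psi> \<alpha> * ennreal (1 / 2 ^ length \<alpha>) * indicator (descendants \<alpha>) (cell_point i z) \<partial>count_space UNIV)"
proof (cases "z = 0")
  case True
  have "h p = 0" if "0 \<le> p" "p < 1" for p
    using radial_chain[OF w that] h[OF that] True by auto
  then have "h p * indicator {0..<1} p = 0" for p
    by (cases "p \<in> {0..<1}") auto
  then have "(\<lambda>p. h p * indicator {0..<1} p) = (\<lambda>_. 0)" by blast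
  then show ?thesis by (simp only:) simp
next
  case False
  define A where "A \<alpha> = {(1 - 1 / 2 ^ length \<alpha>) / cmod z .. (1 - 1 / 2 ^ Suc (length \<alpha>)) / cmod z}" for \<alpha> :: vertex
  let ?d = "\<lambda>\<alpha>. indicator (descendants \<alpha>) (cell_point i z) :: ennreal"
  have point: "h p * indicator {0..<1} p \<le> (\<integral>\<^sup>+\<alpha>. \<Psi> \<alpha> * ennreal (cmod z) * ?d \<alpha> * indicator (A \<alpha>) p \<partial>count_space UNIV)" for p
  proof (cases "p \<in> {0..<1}")
    case True
    then obtain \<alpha> where \<alpha>: "cell_point i z \<in> descendants \<alpha>" "of_real p * z \<in> whitney_box \<alpha>"
      using radial_chain[OF w] by auto
    have "p \<in> A \<alpha>"
    proof -
      have "1 - 1 / 2 ^ length \<alpha> \<le> p * cmod z" "p * cmod z \<le> 1 - 1 / 2 ^ Suc (length \<alpha>)"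
        using norm_whitney_box[OF \<alpha>(2)] True by (simp_all add: norm_mult)
      then show ?thesis
        using False by (simp add: A_def pos_divide_le_eq pos_le_divide_eq del: power_Suc)
    qed
    then have "h p \<le> \<Psi> \<alpha> * ennreal (cmod z) * ?d \<alpha> * indicator (A \<alpha>) p"
      using h[OF _ _ \<alpha>(2)] True \<alpha>(1) by simp
    also have "\<dots> \<le> (\<integral>\<^sup>+\<alpha>. \<Psi> \<alpha> * ennreal (cmod z) * ?d \<alpha> * indicator (A \<alpha>) p \<partial>count_space UNIV)"
      by (rule nn_integral_ge_point) simp
    finally show ?thesis using True by simp
  qed simp
  have "(\<integral>\<^sup>+p\<in>{0..<1}. h p \<partial>lborel) \<le>
      (\<integral>\<^sup>+p. \<integral>\<^sup>+\<alpha>. \<Psi> \<alpha> * ennreal (cmod z) * ?d \<alpha> * indicator (A \<alpha>) p \<partial>count_space UNIV \<partial>lborel)"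
    by (rule nn_integral_mono) (rule point)
  also have "\<dots> = (\<integral>\<^sup>+\<alpha>. \<integral>\<^sup>+p. \<Psi> \<alpha> * ennreal (cmod z) * ?d \<alpha> * indicator (A \<alpha>) p \<partial>lborel \<partial>count_space UNIV)"
    by (rule nn_integral_count_space_nn_integral) (auto simp: A_def)
  also have "\<dots> = (\<integral>\<^sup>+\<alpha>. \<Psi> \<alpha> * ?d \<alpha> * (ennreal (cmod z) * emeasure lborel (A \<alpha>)) \<partial>count_space UNIV)"
    by (intro nn_integral_cong, subst nn_integral_cmult_indicator) (auto simp: A_def mult_ac)
  also have "\<dots> \<le> (\<integral>\<^sup>+\<alpha>. \<Psi> \<alpha> * ?d \<alpha> * ennreal (1 / 2 ^ length \<alpha>) \<partial>count_space UNIV)"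
  proof (intro nn_integral_mono mult_left_mono)
    fix \<alpha> :: vertex
    have le: "(1 - 1 / 2 ^ length \<alpha>) / cmod z \<le> (1 - 1 / 2 ^ Suc (length \<alpha>)) / cmod z"
      by (intro divide_right_mono) (auto simp: field_simps)
    have "ennreal (cmod z) * emeasure lborel (A \<alpha>) =
        ennreal (cmod z * ((1 - 1 / 2 ^ Suc (length \<alpha>)) / cmod z - (1 - 1 / 2 ^ length \<alpha>) / cmod z))"
      unfolding A_def using le by (simp add: ennreal_mult')
    also have "cmod z * ((1 - 1 / 2 ^ Suc (length \<alpha>)) / cmod z - (1 - 1 / 2 ^ length \<alpha>) / cmod z) = 1 / 2 ^ Suc (length \<alpha>)"
      using False by (simp add: field_simps)
    also have "ennreal (1 / 2 ^ Suc (length \<alpha>)) \<le> ennreal (1 / 2 ^ length \<alpha>)"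
      by (intro ennreal_leI) (simp add: field_simps)
    finally show "ennreal (cmod z) * emeasure lborel (A \<alpha>) \<le> ennreal (1 / 2 ^ length \<alpha>)" .
  qed simp
  finally show ?thesis by (simp add: mult_ac)
qed

subsection \<open>The Hardy operator\<close>

lemma hardy_eq: "hardy \<phi> (x, y) =
  (\<integral>\<^sup>+\<beta>. \<integral>\<^sup>+\<alpha>. ennreal (\<phi> (\<alpha>, \<beta>)) * indicator (descendants \<alpha>) x * indicator (descendants \<beta>) y
    \<partial>count_space UNIV \<partial>count_space UNIV)"
proof -
  have "hardy \<phi> (x, y) = (\<integral>\<^sup>+\<alpha>. ennreal (\<phi> \<alpha>) * indicator (descendants (fst \<alpha>)) x * indicator (descendants (snd \<alpha>)) y
      \<partial>count_space UNIV)"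
    unfolding hardy_def
    by (subst nn_integral_count_space_indicator)
       (auto intro!: nn_integral_cong simp: indicator_def descendants_def less_eq_prod_def)
  also have "\<dots> = (\<integral>\<^sup>+\<beta>. \<integral>\<^sup>+\<alpha>. (\<lambda>\<alpha>. ennreal (\<phi> \<alpha>) * indicator (descendants (fst \<alpha>)) x * indicator (descendants (snd \<alpha>)) y) (\<alpha>, \<beta>)
      \<partial>count_space UNIV \<partial>count_space UNIV)"
    by (rule nn_integral_snd_count_space[symmetric])
  finally show ?thesis by simp
qed

lemma hardy_measurable [measurable]: "hardy \<phi> \<in> borel_measurable borel"
proof -
  have [measurable]: "descendants \<alpha> \<in> sets borel" for \<alpha> by (intro borel_open open_descendants)
  have "hardy \<phi> \<zeta> = (\<integral>\<^sup>+k. ennreal (\<phi> k) * indicator (descendants (fst k) \<times> descendants (snd k)) \<zeta> \<partial>count_space UNIV)" for \<zeta>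
    unfolding hardy_def
    by (subst nn_integral_count_space_indicator)
       (auto intro!: nn_integral_cong simp: indicator_def descendants_def less_eq_prod_def mem_Times_iff)
  moreover have "(\<lambda>\<zeta>. \<integral>\<^sup>+k. ennreal (\<phi> k) * indicator (descendants (fst k) \<times> descendants (snd k)) \<zeta> \<partial>count_space UNIV)
      \<in> borel_measurable borel"
  proof (rule sigma_finite_measure.borel_measurable_nn_integral[OF sigma_finite_measure_count_space])
    have "(\<lambda>\<zeta>. ennreal (\<phi> k) * indicator (descendants (fst k) \<times> descendants (snd k)) \<zeta>) \<in> borel_measurable borel" for k
      by (intro borel_measurable_times_ennreal borel_measurable_const borel_measurable_indicator borel_Times) measurable
    then show "(\<lambda>(\<zeta>, k). ennreal (\<phi> k) * indicator (descendants (fst k) \<times> descendants (snd k)) \<zeta>)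
        \<in> borel_measurable (borel \<Otimes>\<^sub>M count_space UNIV)"
      using measurable_pair_swap[OF measurable_pair_measure_countable1[of UNIV
          "\<lambda>(k, \<zeta>). ennreal (\<phi> k) * indicator (descendants (fst k) \<times> descendants (snd k)) \<zeta>" borel borel]]
      by (simp add: case_prod_unfold)
  qed
  ultimately show ?thesis by (simp cong: measurable_cong)
qed

lemma hardy_mono: "(\<And>\<alpha>. \<phi> \<alpha> \<le> \<psi> \<alpha>) \<Longrightarrow> hardy \<phi> \<zeta> \<le> hardy \<psi> \<zeta>"
  unfolding hardy_def by (intro nn_integral_mono ennreal_leI) auto

text \<open>Division by \<open>N\<close> shows that the infimum of the admissible constants is
  admissible. For \<open>N = top\<close> the infimum may be 0 without being admissible, and for
  \<open>N = 0\<close> the set may be empty.\<close>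

lemma le_Inf_mult_ennreal:
  fixes A N :: ennreal
  assumes "N \<noteq> 0" "N \<noteq> top" "\<And>C. C \<in> S \<Longrightarrow> A \<le> C * N"
  shows "A \<le> Inf S * N"
proof -
  have "A / N \<le> Inf S"
    using assms by (intro Inf_greatest divide_le_posI_ennreal) (auto simp: mult.commute zero_less_iff_neq_zero)
  then have "A / N * N \<le> Inf S * N" by (rule mult_right_mono) simp
  moreover have "A / N * N = A"
    using assms by (simp add: ennreal_divide_times ennreal_divide_self less_top)
  ultimately show ?thesis by simp
qed

lemma hardy_norm2_bound:
  assumes \<phi>: "\<And>\<alpha>. 0 \<le> \<phi> \<alpha>" and fin: "(\<integral>\<^sup>+\<alpha>. ennreal ((\<phi> \<alpha>)\<^sup>2) \<partial>count_space UNIV) \<noteq> top"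
  shows "(\<integral>\<^sup>+\<zeta>. (hardy \<phi> \<zeta>)\<^sup>2 \<partial>\<nu>) \<le> hardy_norm2 \<nu> * (\<integral>\<^sup>+\<alpha>. ennreal ((\<phi> \<alpha>)\<^sup>2) \<partial>count_space UNIV)"
proof (cases "(\<integral>\<^sup>+\<alpha>. ennreal ((\<phi> \<alpha>)\<^sup>2) \<partial>count_space UNIV) = 0")
  case True
  then have "\<phi> \<alpha> = 0" for \<alpha> by (cases \<alpha>) (auto simp: nn_integral_0_iff_AE AE_count_space)
  then have "hardy \<phi> \<zeta> = 0" for \<zeta> by (simp add: hardy_def)
  then show ?thesis by simp
next
  case False
  show ?thesis
    unfolding hardy_norm2_def using \<phi> by (intro le_Inf_mult_ennreal False fin) auto
qed

subsection \<open>Bounding the radial variation by the Hardy operator\<close>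

text \<open>Presents a function of one variable as one on the bidisc, so that a single majorant
  construction serves all four terms of the radial variation.\<close>

lemma bidisc_expansion_restrict:
  assumes g: "bidisc_expansion g B"
  shows "bidisc_expansion (\<lambda>z w. g z 0) (\<lambda>m n. if n = 0 then B m 0 else 0)"
  unfolding bidisc_expansion_def
proof (intro ballI)
  fix z w :: complex assume z: "z \<in> ball 0 1" "w \<in> ball 0 1"
  have "((\<lambda>(m, n). B m n * z ^ m * 0 ^ n) has_sum g z 0) UNIV"
    using bidisc_expansionD[OF g z(1), of 0] by simp
  moreover have "B m n * z ^ m * 0 ^ n = (if n = 0 then B m 0 else 0) * z ^ m * w ^ n" for m n
    by simp
  ultimately show "((\<lambda>(m, n). (if n = 0 then B m 0 else 0) * z ^ m * w ^ n) has_sum g z 0) UNIV"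
    by (simp only:)
qed

text \<open>The squared norm of the Bergman space of the bidisc with normalised area, in terms of
  coefficients: the natural norm for mixed derivatives of Dirichlet functions.\<close>

definition coeff_energy :: "(nat \<Rightarrow> nat \<Rightarrow> complex) \<Rightarrow> ennreal" where
  "coeff_energy B = (\<integral>\<^sup>+m. \<integral>\<^sup>+n. ennreal ((cmod (B m n))\<^sup>2 / ((real m + 1) * (real n + 1))) \<partial>count_space UNIV \<partial>count_space UNIV)"

lemma exists_hardy_majorant:
  assumes g: "bidisc_expansion g B" and fin: "coeff_energy B < top"
  obtains \<phi> where "\<And>\<alpha>. 0 \<le> \<phi> \<alpha>"
    and "(\<integral>\<^sup>+\<alpha>. ennreal ((\<phi> \<alpha>)\<^sup>2) \<partial>count_space UNIV) \<le> ennreal (4 * 257 * 257 * 64 * 400) * coeff_energy B"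
    and "\<And>\<alpha> \<beta> z w. z \<in> whitney_box \<alpha> \<Longrightarrow> w \<in> whitney_box \<beta> \<Longrightarrow> cmod (g z w) \<le> \<phi> (\<alpha>, \<beta>) * 2 ^ length \<alpha> * 2 ^ length \<beta>"
proof -
  define b where "b \<alpha> \<beta> = enn2real (box_mean g \<alpha> \<beta>)" for \<alpha> \<beta>
  have sum: "(\<integral>\<^sup>+\<alpha>. \<integral>\<^sup>+\<beta>. ennreal (1 / 4 ^ length \<alpha>) * (ennreal (1 / 4 ^ length \<beta>) * box_mean g \<alpha> \<beta>)
      \<partial>count_space UNIV \<partial>count_space UNIV) \<le> ennreal (4 * 257 * 257 * 64 * 400) * coeff_energy B"
    unfolding coeff_energy_def by (rule box_mean_sum[OF g])
  \<comment> \<open>The majorant has to be real-valued, so each mean must be finite; up to a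
    positive factor it is one term of a sum with finite value.\<close>
  have "box_mean g \<alpha> \<beta> < top" for \<alpha> \<beta>
  proof -
    have "ennreal (1 / 4 ^ length \<alpha>) * (ennreal (1 / 4 ^ length \<beta>) * box_mean g \<alpha> \<beta>) \<le>
        (\<integral>\<^sup>+\<beta>. ennreal (1 / 4 ^ length \<alpha>) * (ennreal (1 / 4 ^ length \<beta>) * box_mean g \<alpha> \<beta>) \<partial>count_space UNIV)"
      by (rule nn_integral_ge_point) simp
    also have "\<dots> \<le> (\<integral>\<^sup>+\<alpha>. \<integral>\<^sup>+\<beta>. ennreal (1 / 4 ^ length \<alpha>) * (ennreal (1 / 4 ^ length \<beta>) * box_mean g \<alpha> \<beta>)
        \<partial>count_space UNIV \<partial>count_space UNIV)"
      by (rule nn_integral_ge_point) simp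
    also note sum
    also have "ennreal (4 * 257 * 257 * 64 * 400) * coeff_energy B < top"
      using fin by (simp add: ennreal_mult_less_top)
    finally show ?thesis by (auto simp: ennreal_mult_less_top)
  qed
  then have b: "box_mean g \<alpha> \<beta> = ennreal (b \<alpha> \<beta>)" "0 \<le> b \<alpha> \<beta>" for \<alpha> \<beta>
    by (auto simp: b_def)
  define \<phi> where "\<phi> = (\<lambda>(\<alpha>, \<beta>). sqrt (b \<alpha> \<beta>) / 2 ^ length \<alpha> / 2 ^ length \<beta>)"
  show ?thesis
  proof
    show "0 \<le> \<phi> \<alpha>" for \<alpha> using b(2) by (auto simp: \<phi>_def split: prod.splits)
    have "ennreal ((\<phi> (\<alpha>, \<beta>))\<^sup>2) = ennreal (1 / 4 ^ length \<alpha>) * (ennreal (1 / 4 ^ length \<beta>) * box_mean g \<alpha> \<beta>)" for \<alpha> \<beta>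
    proof -
      have four: "(2 ^ i)\<^sup>2 = (4 :: real) ^ i" for i :: nat
        by (simp add: power2_eq_square flip: power_mult_distrib)
      have "(\<phi> (\<alpha>, \<beta>))\<^sup>2 = 1 / 4 ^ length \<alpha> * (1 / 4 ^ length \<beta> * b \<alpha> \<beta>)"
        using b(2) by (simp add: \<phi>_def power_divide power_mult_distrib four)
      moreover have "ennreal (1 / 4 ^ length \<beta>) * ennreal (b \<alpha> \<beta>) = ennreal (1 / 4 ^ length \<beta> * b \<alpha> \<beta>)"
        using b(2) by (intro ennreal_mult[symmetric]) auto
      moreover have "ennreal (1 / 4 ^ length \<alpha>) * ennreal (1 / 4 ^ length \<beta> * b \<alpha> \<beta>) =
          ennreal (1 / 4 ^ length \<alpha> * (1 / 4 ^ length \<beta> * b \<alpha> \<beta>))"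
        using b(2) by (intro ennreal_mult[symmetric]) auto
      ultimately show ?thesis unfolding b(1) by (simp only:)
    qed
    then have "(\<integral>\<^sup>+\<alpha>. ennreal ((\<phi> \<alpha>)\<^sup>2) \<partial>count_space UNIV) =
        (\<integral>\<^sup>+\<alpha>. \<integral>\<^sup>+\<beta>. ennreal (1 / 4 ^ length \<alpha>) * (ennreal (1 / 4 ^ length \<beta>) * box_mean g \<alpha> \<beta>) \<partial>count_space UNIV \<partial>count_space UNIV)"
      by (subst nn_integral_fst_count_space[symmetric]) simp
    with sum show "(\<integral>\<^sup>+\<alpha>. ennreal ((\<phi> \<alpha>)\<^sup>2) \<partial>count_space UNIV) \<le> ennreal (4 * 257 * 257 * 64 * 400) * coeff_energy B"
      by simp
    fix \<alpha> \<beta> z w assume zw: "z \<in> whitney_box \<alpha>" "w \<in> whitney_box \<beta>"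
    have "(cmod (g z w))\<^sup>2 \<le> b \<alpha> \<beta>"
      using box_mean_ge[OF g zw] b by simp
    then have "cmod (g z w) \<le> sqrt (b \<alpha> \<beta>)" by (rule real_le_rsqrt)
    then show "cmod (g z w) \<le> \<phi> (\<alpha>, \<beta>) * 2 ^ length \<alpha> * 2 ^ length \<beta>" by (simp add: \<phi>_def)
  qed
qed

text \<open>The bound for one segment is applied twice, in \<open>p\<close> for fixed
  \<open>q\<close> and then in \<open>q\<close>; the factor \<open>cmod \<zeta>2\<close> is carried
  through the first application to be cancelled in the second.\<close>

lemma double_radial_integral_le_hardy:
  assumes \<phi>: "\<And>\<alpha>. 0 \<le> \<phi> \<alpha>"
    and g: "\<And>\<alpha> \<beta> z w. z \<in> whitney_box \<alpha> \<Longrightarrow> w \<in> whitney_box \<beta> \<Longrightarrow> cmod (g z w) \<le> \<phi> (\<alpha>, \<beta>) * 2 ^ length \<alpha> * 2 ^ length \<beta>"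
    and i: "cell_weight i \<zeta>1 \<noteq> 0" and j: "cell_weight j \<zeta>2 \<noteq> 0"
  shows "(\<integral>\<^sup>+q\<in>{0..<1}. (\<integral>\<^sup>+p\<in>{0..<1}. ennreal (cmod (g (of_real p * \<zeta>1) (of_real q * \<zeta>2)) * cmod \<zeta>1 * cmod \<zeta>2)
     \<partial>lborel) \<partial>lborel) \<le> hardy \<phi> (cell_point i \<zeta>1, cell_point j \<zeta>2)"
proof -
  let ?d = "\<lambda>\<alpha>. indicator (descendants \<alpha>) (cell_point i \<zeta>1) :: ennreal"
  let ?e = "\<lambda>\<beta>. indicator (descendants \<beta>) (cell_point j \<zeta>2) :: ennreal"
  define \<Psi> where "\<Psi> \<beta> = (\<integral>\<^sup>+\<alpha>. ennreal (\<phi> (\<alpha>, \<beta>) * 2 ^ length \<beta>) * ?d \<alpha> \<partial>count_space UNIV)" for \<beta>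
  have "(\<integral>\<^sup>+q\<in>{0..<1}. (\<integral>\<^sup>+p\<in>{0..<1}. ennreal (cmod (g (of_real p * \<zeta>1) (of_real q * \<zeta>2)) * cmod \<zeta>1 * cmod \<zeta>2)
     \<partial>lborel) \<partial>lborel) \<le>
    (\<integral>\<^sup>+\<beta>. \<Psi> \<beta> * ennreal (1 / 2 ^ length \<beta>) * ?e \<beta> \<partial>count_space UNIV)"
  proof (rule radial_integral_le[OF j])
    fix q \<beta> assume q: "0 \<le> q" "q < 1" "of_real q * \<zeta>2 \<in> whitney_box \<beta>"
    have "(\<integral>\<^sup>+p\<in>{0..<1}. ennreal (cmod (g (of_real p * \<zeta>1) (of_real q * \<zeta>2)) * cmod \<zeta>1 * cmod \<zeta>2) \<partial>lborel) \<le>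
      (\<integral>\<^sup>+\<alpha>. ennreal (\<phi> (\<alpha>, \<beta>) * 2 ^ length \<alpha> * 2 ^ length \<beta> * cmod \<zeta>2) * ennreal (1 / 2 ^ length \<alpha>) * ?d \<alpha> \<partial>count_space UNIV)"
    proof (rule radial_integral_le[OF i])
      fix p \<alpha> assume "of_real p * \<zeta>1 \<in> whitney_box \<alpha>"
      then have "cmod (g (of_real p * \<zeta>1) (of_real q * \<zeta>2)) \<le> \<phi> (\<alpha>, \<beta>) * 2 ^ length \<alpha> * 2 ^ length \<beta>"
        using g q(3) by blast
      then have "cmod (g (of_real p * \<zeta>1) (of_real q * \<zeta>2)) * (cmod \<zeta>2 * cmod \<zeta>1) \<le>
          \<phi> (\<alpha>, \<beta>) * 2 ^ length \<alpha> * 2 ^ length \<beta> * (cmod \<zeta>2 * cmod \<zeta>1)"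
        by (rule mult_right_mono) simp
      then show "ennreal (cmod (g (of_real p * \<zeta>1) (of_real q * \<zeta>2)) * cmod \<zeta>1 * cmod \<zeta>2) \<le>
          ennreal (\<phi> (\<alpha>, \<beta>) * 2 ^ length \<alpha> * 2 ^ length \<beta> * cmod \<zeta>2) * ennreal (cmod \<zeta>1)"
        using \<phi> by (subst ennreal_mult[symmetric]) (auto simp: mult_ac intro!: ennreal_leI)
    qed
    also have "\<dots> = (\<integral>\<^sup>+\<alpha>. ennreal (\<phi> (\<alpha>, \<beta>) * 2 ^ length \<beta>) * ?d \<alpha> * ennreal (cmod \<zeta>2) \<partial>count_space UNIV)"
    proof (intro nn_integral_cong)
      fix \<alpha> :: vertex
      have "ennreal (\<phi> (\<alpha>, \<beta>) * 2 ^ length \<alpha> * 2 ^ length \<beta> * cmod \<zeta>2) * ennreal (1 / 2 ^ length \<alpha>) =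
          ennreal (\<phi> (\<alpha>, \<beta>) * 2 ^ length \<beta>) * ennreal (cmod \<zeta>2)"
        using \<phi> by (subst (1 2) ennreal_mult[symmetric]) auto
      then show "ennreal (\<phi> (\<alpha>, \<beta>) * 2 ^ length \<alpha> * 2 ^ length \<beta> * cmod \<zeta>2) * ennreal (1 / 2 ^ length \<alpha>) * ?d \<alpha> =
          ennreal (\<phi> (\<alpha>, \<beta>) * 2 ^ length \<beta>) * ?d \<alpha> * ennreal (cmod \<zeta>2)"
        by (simp add: mult_ac)
    qed
    also have "\<dots> = \<Psi> \<beta> * ennreal (cmod \<zeta>2)" unfolding \<Psi>_def by (rule nn_integral_multc) simp
    finally show "(\<integral>\<^sup>+p\<in>{0..<1}. ennreal (cmod (g (of_real p * \<zeta>1) (of_real q * \<zeta>2)) * cmod \<zeta>1 * cmod \<zeta>2) \<partial>lborel) \<le>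
      \<Psi> \<beta> * ennreal (cmod \<zeta>2)" .
  qed
  also have "\<dots> = hardy \<phi> (cell_point i \<zeta>1, cell_point j \<zeta>2)"
  proof -
    have "\<Psi> \<beta> * ennreal (1 / 2 ^ length \<beta>) * ?e \<beta> = (\<integral>\<^sup>+\<alpha>. ennreal (\<phi> (\<alpha>, \<beta>)) * ?d \<alpha> * ?e \<beta> \<partial>count_space UNIV)" for \<beta>
    proof -
      have "ennreal (\<phi> (\<alpha>, \<beta>) * 2 ^ length \<beta>) * ?d \<alpha> * (ennreal (1 / 2 ^ length \<beta>) * ?e \<beta>) = ennreal (\<phi> (\<alpha>, \<beta>)) * ?d \<alpha> * ?e \<beta>" for \<alpha>
      proof -
        have "ennreal (\<phi> (\<alpha>, \<beta>) * 2 ^ length \<beta>) * ennreal (1 / 2 ^ length \<beta>) = ennreal (\<phi> (\<alpha>, \<beta>))"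
          using \<phi> by (subst ennreal_mult[symmetric]) auto
        then show ?thesis by (metis mult.assoc mult.commute)
      qed
      then show ?thesis unfolding \<Psi>_def mult.assoc by (subst nn_integral_multc[symmetric]) (simp_all add: mult.assoc)
    qed
    then show ?thesis unfolding hardy_eq by simp
  qed
  finally show ?thesis .
qed

text \<open>A term in one variable is charged to the vertex pairs whose other component is the root,
  which lies above every \<open>y\<close>.\<close>

lemma single_radial_integral_le_hardy:
  assumes \<phi>: "\<And>\<alpha>. 0 \<le> \<phi> \<alpha>"
    and h: "\<And>\<alpha> z. z \<in> whitney_box \<alpha> \<Longrightarrow> cmod (h z) \<le> \<phi> (\<alpha>, []) * 2 ^ length \<alpha>"
    and i: "cell_weight i \<zeta> \<noteq> 0"
  shows "(\<integral>\<^sup>+p\<in>{0..<1}. ennreal (cmod (h (of_real p * \<zeta>)) * cmod \<zeta>) \<partial>lborel) \<le> hardy \<phi> (cell_point i \<zeta>, y)"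
proof -
  let ?d = "\<lambda>\<alpha>. indicator (descendants \<alpha>) (cell_point i \<zeta>) :: ennreal"
  have "(\<integral>\<^sup>+p\<in>{0..<1}. ennreal (cmod (h (of_real p * \<zeta>)) * cmod \<zeta>) \<partial>lborel) \<le>
      (\<integral>\<^sup>+\<alpha>. ennreal (\<phi> (\<alpha>, []) * 2 ^ length \<alpha>) * ennreal (1 / 2 ^ length \<alpha>) * ?d \<alpha> \<partial>count_space UNIV)"
  proof (rule radial_integral_le[OF i])
    fix p \<alpha> assume "of_real p * \<zeta> \<in> whitney_box \<alpha>"
    from h[OF this] show "ennreal (cmod (h (of_real p * \<zeta>)) * cmod \<zeta>) \<le> ennreal (\<phi> (\<alpha>, []) * 2 ^ length \<alpha>) * ennreal (cmod \<zeta>)"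
      using \<phi> by (subst ennreal_mult[symmetric]) (auto intro!: ennreal_leI mult_right_mono)
  qed
  also have "\<dots> = (\<integral>\<^sup>+\<alpha>. ennreal (\<phi> (\<alpha>, [])) * ?d \<alpha> * indicator (descendants []) y \<partial>count_space UNIV)"
  proof (intro nn_integral_cong)
    fix \<alpha> :: vertex
    have "y \<in> descendants []" by (cases y) (auto simp: descendants_def intro: exI[of _ 0])
    moreover have "ennreal (\<phi> (\<alpha>, []) * 2 ^ length \<alpha>) * ennreal (1 / 2 ^ length \<alpha>) = ennreal (\<phi> (\<alpha>, []))"
      using \<phi> by (subst ennreal_mult[symmetric]) auto
    ultimately show "ennreal (\<phi> (\<alpha>, []) * 2 ^ length \<alpha>) * ennreal (1 / 2 ^ length \<alpha>) * ?d \<alpha> =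
        ennreal (\<phi> (\<alpha>, [])) * ?d \<alpha> * indicator (descendants []) y"
      by simp
  qed
  also have "\<dots> \<le> hardy \<phi> (cell_point i \<zeta>, y)"
    unfolding hardy_eq by (rule nn_integral_ge_point) simp
  finally show ?thesis .
qed

lemma hardy_swap: "hardy \<phi> (x, y) = hardy (\<lambda>(\<alpha>, \<beta>). \<phi> (\<beta>, \<alpha>)) (y, x)"
proof -
  have "(\<integral>\<^sup>+\<beta>. \<integral>\<^sup>+\<alpha>. ennreal (\<phi> (\<alpha>, \<beta>)) * indicator (descendants \<alpha>) x * indicator (descendants \<beta>) y \<partial>count_space UNIV \<partial>count_space UNIV) =
     (\<integral>\<^sup>+\<alpha>. \<integral>\<^sup>+\<beta>. ennreal (\<phi> (\<alpha>, \<beta>)) * indicator (descendants \<alpha>) x * indicator (descendants \<beta>) y \<partial>count_space UNIV \<partial>count_space UNIV)"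
    by (rule nn_integral_count_space_nn_integral) auto
  then show ?thesis unfolding hardy_eq by (simp add: mult_ac)
qed

section \<open>Coefficient norms of a function and of its derivatives\<close>

lemma nn_integral_nat_shift_le: "(\<integral>\<^sup>+n. G (Suc n) \<partial>count_space UNIV) \<le> (\<integral>\<^sup>+n. G n \<partial>count_space UNIV)"
  for G :: "nat \<Rightarrow> ennreal"
proof -
  have "(\<integral>\<^sup>+n. G (Suc n) \<partial>count_space UNIV) = (\<integral>\<^sup>+n. G n \<partial>count_space (range Suc))"
    by (rule nn_integral_bij_count_space) (auto simp: bij_betw_def)
  also have "\<dots> = (\<integral>\<^sup>+n. G n * indicator (range Suc) n \<partial>count_space UNIV)"
    by (rule nn_integral_count_space_indicator) simp
  also have "\<dots> \<le> (\<integral>\<^sup>+n. G n \<partial>count_space UNIV)"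
    by (intro nn_integral_mono) (auto simp: indicator_def)
  finally show ?thesis .
qed

definition coeff_norm2 :: "(nat \<Rightarrow> nat \<Rightarrow> complex) \<Rightarrow> ennreal" where
  "coeff_norm2 a = (\<integral>\<^sup>+m. \<integral>\<^sup>+n. ennreal ((cmod (a m n))\<^sup>2 * (real m + 1) * (real n + 1)) \<partial>count_space UNIV \<partial>count_space UNIV)"

lemma dirichlet_norm2_eq: "dirichlet_norm2 f = coeff_norm2 (taylor_coeff f)"
proof -
  let ?h = "\<lambda>(m, n). ennreal ((cmod (taylor_coeff f m n))\<^sup>2 * (real m + 1) * (real n + 1))"
  have "dirichlet_norm2 f = (\<integral>\<^sup>+m. \<integral>\<^sup>+n. ?h (m, n) \<partial>count_space UNIV \<partial>count_space UNIV)"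
    unfolding dirichlet_norm2_def by (rule nn_integral_fst_count_space[symmetric])
  then show ?thesis by (simp add: coeff_norm2_def)
qed

lemma coeff_norm2_swap: "coeff_norm2 (\<lambda>m n. a n m) = coeff_norm2 a"
proof -
  have "coeff_norm2 (\<lambda>m n. a n m) =
      (\<integral>\<^sup>+n. \<integral>\<^sup>+m. ennreal ((cmod (a n m))\<^sup>2 * (real m + 1) * (real n + 1)) \<partial>count_space UNIV \<partial>count_space UNIV)"
    unfolding coeff_norm2_def by (rule nn_integral_count_space_nn_integral) auto
  then show ?thesis by (simp add: coeff_norm2_def mult_ac)
qed

text \<open>Squaring the factor \<open>(m + 1) * (n + 1)\<close> produced by differentiation and
  dividing by the Bergman weight leaves one copy of it, which is below the Dirichlet weight at the
  shifted indices; undoing the shift only adds terms.\<close>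

lemma coeff_energy_mixed_le:
  "coeff_energy (\<lambda>m n. of_nat (Suc m) * of_nat (Suc n) * a (Suc m) (Suc n)) \<le> coeff_norm2 a"
proof -
  let ?F = "\<lambda>m n. ennreal ((cmod (a m n))\<^sup>2 * (real m + 1) * (real n + 1))"
  have "coeff_energy (\<lambda>m n. of_nat (Suc m) * of_nat (Suc n) * a (Suc m) (Suc n)) \<le>
      (\<integral>\<^sup>+m. \<integral>\<^sup>+n. ?F (Suc m) (Suc n) \<partial>count_space UNIV \<partial>count_space UNIV)"
    unfolding coeff_energy_def
  proof (intro nn_integral_mono ennreal_leI)
    fix m n
    have e: "cmod (of_nat (Suc m) * of_nat (Suc n) * a (Suc m) (Suc n)) = (real m + 1) * (real n + 1) * cmod (a (Suc m) (Suc n))"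
      by (simp only: norm_mult norm_of_nat) (simp only: of_nat_Suc add.commute[of 1])
    have "(x * y * c)\<^sup>2 / (x * y) = c\<^sup>2 * x * y" if "0 < x" "0 < y" for x y c :: real
      using that by (simp add: power2_eq_square)
    then have "((real m + 1) * (real n + 1) * cmod (a (Suc m) (Suc n)))\<^sup>2 / ((real m + 1) * (real n + 1)) =
        (cmod (a (Suc m) (Suc n)))\<^sup>2 * (real m + 1) * (real n + 1)"
      by (simp add: add_nonneg_pos)
    also have "\<dots> \<le> (cmod (a (Suc m) (Suc n)))\<^sup>2 * (real (Suc m) + 1) * (real (Suc n) + 1)"
      by (intro mult_mono) auto
    finally show "(cmod (of_nat (Suc m) * of_nat (Suc n) * a (Suc m) (Suc n)))\<^sup>2 / ((real m + 1) * (real n + 1)) \<le>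
       (cmod (a (Suc m) (Suc n)))\<^sup>2 * (real (Suc m) + 1) * (real (Suc n) + 1)" unfolding e .
  qed
  also have "\<dots> \<le> (\<integral>\<^sup>+m. \<integral>\<^sup>+n. ?F (Suc m) n \<partial>count_space UNIV \<partial>count_space UNIV)"
    by (rule nn_integral_mono) (rule nn_integral_nat_shift_le)
  also have "\<dots> \<le> (\<integral>\<^sup>+m. \<integral>\<^sup>+n. ?F m n \<partial>count_space UNIV \<partial>count_space UNIV)"
    by (rule nn_integral_nat_shift_le)
  finally show ?thesis unfolding coeff_norm2_def .
qed

lemma coeff_energy_axis_le:
  "coeff_energy (\<lambda>m n. if n = 0 then of_nat (Suc m) * a (Suc m) 0 else 0) \<le> coeff_norm2 a"
proof -
  let ?F = "\<lambda>m n. ennreal ((cmod (a m n))\<^sup>2 * (real m + 1) * (real n + 1))"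
  have "coeff_energy (\<lambda>m n. if n = 0 then of_nat (Suc m) * a (Suc m) 0 else 0) \<le>
      (\<integral>\<^sup>+m. \<integral>\<^sup>+n. ?F (Suc m) n \<partial>count_space UNIV \<partial>count_space UNIV)"
    unfolding coeff_energy_def
  proof (intro nn_integral_mono ennreal_leI)
    fix m n :: nat
    have "(cmod (of_nat (Suc m) * a (Suc m) 0))\<^sup>2 / (real m + 1) = (cmod (a (Suc m) 0))\<^sup>2 * (real m + 1)"
    proof -
      have e: "cmod (of_nat (Suc m) * a (Suc m) 0) = (real m + 1) * cmod (a (Suc m) 0)"
        by (simp only: norm_mult norm_of_nat) (simp only: of_nat_Suc add.commute[of 1])
      have "(x * c)\<^sup>2 / x = c\<^sup>2 * x" if "0 < x" for x c :: real
        using that by (simp add: power2_eq_square)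
      then show ?thesis unfolding e by (simp add: add_nonneg_pos)
    qed
    moreover have "(cmod (a (Suc m) 0))\<^sup>2 * (real m + 1) \<le> (cmod (a (Suc m) 0))\<^sup>2 * (real (Suc m) + 1)"
      by (intro mult_left_mono) auto
    ultimately show "(cmod (if n = 0 then of_nat (Suc m) * a (Suc m) 0 else 0))\<^sup>2 / ((real m + 1) * (real n + 1)) \<le>
       (cmod (a (Suc m) n))\<^sup>2 * (real (Suc m) + 1) * (real n + 1)"
      by (cases "n = 0") (simp_all del: of_nat_Suc)
  qed
  also have "\<dots> \<le> (\<integral>\<^sup>+m. \<integral>\<^sup>+n. ?F m n \<partial>count_space UNIV \<partial>count_space UNIV)"
    by (rule nn_integral_nat_shift_le)
  finally show ?thesis unfolding coeff_norm2_def .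
qed

lemma coeff_energy_origin_le:
  "coeff_energy (\<lambda>m n. if m = 0 then if n = 0 then a 0 0 else 0 else 0) \<le> coeff_norm2 a"
  unfolding coeff_energy_def coeff_norm2_def
  by (intro nn_integral_mono ennreal_leI) auto

lemma hardy_add:
  assumes "\<And>\<alpha>. 0 \<le> \<phi> \<alpha>" "\<And>\<alpha>. 0 \<le> \<psi> \<alpha>"
  shows "hardy (\<lambda>\<alpha>. \<phi> \<alpha> + \<psi> \<alpha>) \<zeta> = hardy \<phi> \<zeta> + hardy \<psi> \<zeta>"
  unfolding hardy_def using assms by (simp add: nn_integral_add)

lemma hardy_root_ge: "ennreal (\<phi> ([], [])) \<le> hardy \<phi> (x, y)"
proof -
  have root: "x \<in> descendants []" for x by (cases x) (auto simp: descendants_def intro: exI[of _ 0])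
  have "ennreal (\<phi> ([], [])) = ennreal (\<phi> ([], [])) * indicator (descendants []) x * indicator (descendants []) y"
    using root by simp
  also have "\<dots> \<le> (\<integral>\<^sup>+\<alpha>. ennreal (\<phi> (\<alpha>, [])) * indicator (descendants \<alpha>) x * indicator (descendants []) y \<partial>count_space UNIV)"
    by (rule nn_integral_ge_point) simp
  also have "\<dots> \<le> hardy \<phi> (x, y)"
    unfolding hardy_eq by (rule nn_integral_ge_point) simp
  finally show ?thesis .
qed

lemma zero_in_root_box: "0 \<in> whitney_box []"
  unfolding whitney_box_def using arc_nonempty[of "[]"] by force

text \<open>Four majorants, one for each term of the variation, are added. The 16 is the 4 of
  \<open>sq\<close>, Cauchy-Schwarz for four summands, times the number of norms that are
  summed.\<close>

lemma radial_variation_le_hardy: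
  assumes f: "f \<in> dirichlet_bidisc"
  obtains \<phi> where "\<And>\<alpha>. 0 \<le> \<phi> \<alpha>"
    and "(\<integral>\<^sup>+\<alpha>. ennreal ((\<phi> \<alpha>)\<^sup>2) \<partial>count_space UNIV) \<le> ennreal (16 * (4 * 257 * 257 * 64 * 400)) * dirichlet_norm2 f"
    and "\<And>i j \<zeta>1 \<zeta>2. cell_weight i \<zeta>1 \<noteq> 0 \<Longrightarrow> cell_weight j \<zeta>2 \<noteq> 0 \<Longrightarrow>
      radial_variation f (\<zeta>1, \<zeta>2) \<le> hardy \<phi> (cell_point i \<zeta>1, cell_point j \<zeta>2)"
proof -
  define a where "a = taylor_coeff f"
  have exp: "bidisc_expansion f a" unfolding a_def by (rule bidisc_expansion_taylor_coeff[OF f])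
  have N: "dirichlet_norm2 f = coeff_norm2 a" unfolding a_def by (rule dirichlet_norm2_eq)
  have fin: "coeff_norm2 a < top" using f N by (simp add: dirichlet_bidisc_def)
  let ?K = "4 * 257 * 257 * 64 * 400 :: real"
  have majorant: "\<exists>\<phi>. (\<forall>\<alpha>. 0 \<le> \<phi> \<alpha>) \<and> (\<integral>\<^sup>+\<alpha>. ennreal ((\<phi> \<alpha>)\<^sup>2) \<partial>count_space UNIV) \<le> ennreal ?K * coeff_norm2 a \<and>
      (\<forall>\<alpha> \<beta>. \<forall>z\<in>whitney_box \<alpha>. \<forall>w\<in>whitney_box \<beta>. cmod (g z w) \<le> \<phi> (\<alpha>, \<beta>) * 2 ^ length \<alpha> * 2 ^ length \<beta>)"
    if g: "bidisc_expansion g B" and le: "coeff_energy B \<le> coeff_norm2 a" for g B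
  proof (rule exists_hardy_majorant[OF g le_less_trans[OF le fin]])
    fix \<phi> :: "vertex \<times> vertex \<Rightarrow> real"
    assume \<phi>: "\<And>\<alpha>. 0 \<le> \<phi> \<alpha>" "(\<integral>\<^sup>+\<alpha>. ennreal ((\<phi> \<alpha>)\<^sup>2) \<partial>count_space UNIV) \<le> ennreal ?K * coeff_energy B"
      "\<And>\<alpha> \<beta> z w. z \<in> whitney_box \<alpha> \<Longrightarrow> w \<in> whitney_box \<beta> \<Longrightarrow> cmod (g z w) \<le> \<phi> (\<alpha>, \<beta>) * 2 ^ length \<alpha> * 2 ^ length \<beta>"
    have "ennreal ?K * coeff_energy B \<le> ennreal ?K * coeff_norm2 a"
      by (rule mult_left_mono[OF le]) simp
    with \<phi>(2) have "(\<integral>\<^sup>+\<alpha>. ennreal ((\<phi> \<alpha>)\<^sup>2) \<partial>count_space UNIV) \<le> ennreal ?K * coeff_norm2 a"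
      by (rule order_trans)
    with \<phi>(1,3) show ?thesis by blast
  qed
  note expD = bidisc_expansion_deriv and expS = bidisc_expansion_swap and expR = bidisc_expansion_restrict
  obtain \<phi>0 where \<phi>0: "\<And>\<alpha>. 0 \<le> \<phi>0 \<alpha>"
    "(\<integral>\<^sup>+\<alpha>. ennreal ((\<phi>0 \<alpha>)\<^sup>2) \<partial>count_space UNIV) \<le> ennreal ?K * coeff_norm2 a"
    "\<And>\<alpha> \<beta> z w. z \<in> whitney_box \<alpha> \<Longrightarrow> w \<in> whitney_box \<beta> \<Longrightarrow>
      cmod (mixed_deriv f z w) \<le> \<phi>0 (\<alpha>, \<beta>) * 2 ^ length \<alpha> * 2 ^ length \<beta>"
    using majorant[OF bidisc_expansion_mixed_deriv[OF exp] coeff_energy_mixed_le] by blast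
  obtain \<phi>1 where \<phi>1: "\<And>\<alpha>. 0 \<le> \<phi>1 \<alpha>"
    "(\<integral>\<^sup>+\<alpha>. ennreal ((\<phi>1 \<alpha>)\<^sup>2) \<partial>count_space UNIV) \<le> ennreal ?K * coeff_norm2 a"
    "\<And>\<alpha> \<beta> z w. z \<in> whitney_box \<alpha> \<Longrightarrow> w \<in> whitney_box \<beta> \<Longrightarrow>
      cmod (deriv (\<lambda>z. f z 0) z) \<le> \<phi>1 (\<alpha>, \<beta>) * 2 ^ length \<alpha> * 2 ^ length \<beta>"
    using majorant[OF expR[OF expD[OF exp]] coeff_energy_axis_le] by blast
  have le': "coeff_energy (\<lambda>m n. if n = 0 then of_nat (Suc m) * a 0 (Suc m) else 0) \<le> coeff_norm2 a"
    using coeff_energy_axis_le[of "\<lambda>m n. a n m"] unfolding coeff_norm2_swap[of a] .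
  obtain \<phi>2' where \<phi>2': "\<And>\<alpha>. 0 \<le> \<phi>2' \<alpha>"
    "(\<integral>\<^sup>+\<alpha>. ennreal ((\<phi>2' \<alpha>)\<^sup>2) \<partial>count_space UNIV) \<le> ennreal ?K * coeff_norm2 a"
    "\<And>\<alpha> \<beta> z w. z \<in> whitney_box \<alpha> \<Longrightarrow> w \<in> whitney_box \<beta> \<Longrightarrow>
      cmod (deriv (\<lambda>z. f 0 z) z) \<le> \<phi>2' (\<alpha>, \<beta>) * 2 ^ length \<alpha> * 2 ^ length \<beta>"
    using majorant[OF expR[OF expD[OF expS[OF exp]]] le'] by blast
  obtain \<phi>3 where \<phi>3: "\<And>\<alpha>. 0 \<le> \<phi>3 \<alpha>"
    "(\<integral>\<^sup>+\<alpha>. ennreal ((\<phi>3 \<alpha>)\<^sup>2) \<partial>count_space UNIV) \<le> ennreal ?K * coeff_norm2 a"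
    "\<And>\<alpha> \<beta> z w. z \<in> whitney_box \<alpha> \<Longrightarrow> w \<in> whitney_box \<beta> \<Longrightarrow>
      cmod (f 0 0) \<le> \<phi>3 (\<alpha>, \<beta>) * 2 ^ length \<alpha> * 2 ^ length \<beta>"
    using majorant[OF expS[OF expR[OF expS[OF expR[OF exp]]]]] coeff_energy_origin_le by blast
  define \<phi>2 where "\<phi>2 = (\<lambda>(\<alpha>, \<beta>). \<phi>2' (\<beta>, \<alpha>))"
  have \<phi>2: "\<And>\<alpha>. 0 \<le> \<phi>2 \<alpha>" using \<phi>2'(1) by (auto simp: \<phi>2_def)
  have \<phi>2_norm: "(\<integral>\<^sup>+\<alpha>. ennreal ((\<phi>2 \<alpha>)\<^sup>2) \<partial>count_space UNIV) \<le> ennreal ?K * coeff_norm2 a"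
  proof -
    have "(\<integral>\<^sup>+\<alpha>. ennreal ((\<phi>2 \<alpha>)\<^sup>2) \<partial>count_space UNIV) = (\<integral>\<^sup>+\<alpha>. ennreal ((\<phi>2' \<alpha>)\<^sup>2) \<partial>count_space UNIV)"
      using nn_integral_fst_count_space[of "\<lambda>\<alpha>. ennreal ((\<phi>2 \<alpha>)\<^sup>2)"] nn_integral_snd_count_space[of "\<lambda>\<alpha>. ennreal ((\<phi>2' \<alpha>)\<^sup>2)"]
      by (simp add: \<phi>2_def)
    with \<phi>2'(2) show ?thesis by simp
  qed
  define \<phi> where "\<phi> \<alpha> = \<phi>0 \<alpha> + \<phi>1 \<alpha> + \<phi>2 \<alpha> + \<phi>3 \<alpha>" for \<alpha>
  show ?thesis
  proof
    show "0 \<le> \<phi> \<alpha>" for \<alpha> using \<phi>0(1) \<phi>1(1) \<phi>2 \<phi>3(1) by (simp add: \<phi>_def)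
    have sq: "(x + y + z + w)\<^sup>2 \<le> 4 * (x\<^sup>2 + y\<^sup>2 + z\<^sup>2 + w\<^sup>2)" for x y z w :: real
    proof -
      have "0 \<le> (x - y)\<^sup>2 + (x - z)\<^sup>2 + (x - w)\<^sup>2 + (y - z)\<^sup>2 + (y - w)\<^sup>2 + (z - w)\<^sup>2" by simp
      then show ?thesis by (simp add: power2_eq_square algebra_simps)
    qed
    have "(\<integral>\<^sup>+\<alpha>. ennreal ((\<phi> \<alpha>)\<^sup>2) \<partial>count_space UNIV) \<le>
        (\<integral>\<^sup>+\<alpha>. 4 * (ennreal ((\<phi>0 \<alpha>)\<^sup>2) + ennreal ((\<phi>1 \<alpha>)\<^sup>2) + ennreal ((\<phi>2 \<alpha>)\<^sup>2) + ennreal ((\<phi>3 \<alpha>)\<^sup>2)) \<partial>count_space UNIV)"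
    proof (rule nn_integral_mono)
      fix \<alpha>
      have "ennreal ((\<phi> \<alpha>)\<^sup>2) \<le> ennreal (4 * ((\<phi>0 \<alpha>)\<^sup>2 + (\<phi>1 \<alpha>)\<^sup>2 + (\<phi>2 \<alpha>)\<^sup>2 + (\<phi>3 \<alpha>)\<^sup>2))"
        unfolding \<phi>_def by (intro ennreal_leI sq)
      also have "\<dots> = 4 * (ennreal ((\<phi>0 \<alpha>)\<^sup>2) + ennreal ((\<phi>1 \<alpha>)\<^sup>2) + ennreal ((\<phi>2 \<alpha>)\<^sup>2) + ennreal ((\<phi>3 \<alpha>)\<^sup>2))"
        by (subst ennreal_mult) auto
      finally show "ennreal ((\<phi> \<alpha>)\<^sup>2) \<le> \<dots>" .
    qed
    also have "\<dots> = 4 * ((\<integral>\<^sup>+\<alpha>. ennreal ((\<phi>0 \<alpha>)\<^sup>2) \<partial>count_space UNIV) + (\<integral>\<^sup>+\<alpha>. ennreal ((\<phi>1 \<alpha>)\<^sup>2) \<partial>count_space UNIV) +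
        (\<integral>\<^sup>+\<alpha>. ennreal ((\<phi>2 \<alpha>)\<^sup>2) \<partial>count_space UNIV) + (\<integral>\<^sup>+\<alpha>. ennreal ((\<phi>3 \<alpha>)\<^sup>2) \<partial>count_space UNIV))"
      by (simp add: nn_integral_cmult nn_integral_add)
    also have "\<dots> \<le> 4 * (ennreal ?K * coeff_norm2 a + ennreal ?K * coeff_norm2 a + ennreal ?K * coeff_norm2 a + ennreal ?K * coeff_norm2 a)"
      by (intro mult_left_mono add_mono \<phi>0 \<phi>1 \<phi>2_norm \<phi>3) simp
    also have "\<dots> = ennreal (16 * ?K) * dirichlet_norm2 f"
    proof -
      have "4 * (x + x + x + x) = 16 * x" for x :: ennreal
        by (simp flip: distrib_right mult_2 add: mult.assoc[symmetric])
      moreover have "ennreal (16 * ?K) = 16 * ennreal ?K" by (subst ennreal_mult) auto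
      ultimately show ?thesis unfolding N by (simp only: mult.assoc)
    qed
    finally show "(\<integral>\<^sup>+\<alpha>. ennreal ((\<phi> \<alpha>)\<^sup>2) \<partial>count_space UNIV) \<le> ennreal (16 * ?K) * dirichlet_norm2 f" .
    fix i j \<zeta>1 \<zeta>2 assume ij: "cell_weight i \<zeta>1 \<noteq> 0" "cell_weight j \<zeta>2 \<noteq> 0"
    let ?s = "(cell_point i \<zeta>1, cell_point j \<zeta>2)"
    have "radial_variation f (\<zeta>1, \<zeta>2) \<le> hardy \<phi>0 ?s + hardy \<phi>1 ?s + hardy \<phi>2 ?s + hardy \<phi>3 ?s"
      unfolding radial_variation_def case_prod_conv
    proof (intro add_mono)
      show "(\<integral>\<^sup>+q\<in>{0..<1}. (\<integral>\<^sup>+p\<in>{0..<1}.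
        ennreal (cmod (deriv (\<lambda>w. deriv (\<lambda>z. f z w) (of_real p * \<zeta>1)) (of_real q * \<zeta>2))
                 * cmod \<zeta>1 * cmod \<zeta>2) \<partial>lborel) \<partial>lborel) \<le> hardy \<phi>0 ?s"
        using double_radial_integral_le_hardy[where g = "mixed_deriv f", OF \<phi>0(1) \<phi>0(3) ij] unfolding mixed_deriv_def .
      show "(\<integral>\<^sup>+p\<in>{0..<1}. ennreal (cmod (deriv (\<lambda>z. f z 0) (of_real p * \<zeta>1)) * cmod \<zeta>1) \<partial>lborel) \<le> hardy \<phi>1 ?s"
      proof (rule single_radial_integral_le_hardy[OF \<phi>1(1) _ ij(1)])
        show "cmod (deriv (\<lambda>z. f z 0) z) \<le> \<phi>1 (\<alpha>, []) * 2 ^ length \<alpha>" if "z \<in> whitney_box \<alpha>" for \<alpha> z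
          using \<phi>1(3)[OF that zero_in_root_box] by simp
      qed
      show "(\<integral>\<^sup>+p\<in>{0..<1}. ennreal (cmod (deriv (\<lambda>z. f 0 z) (of_real p * \<zeta>2)) * cmod \<zeta>2) \<partial>lborel) \<le> hardy \<phi>2 ?s"
        unfolding hardy_swap[of \<phi>2]
      proof (rule single_radial_integral_le_hardy[OF _ _ ij(2)])
        show "0 \<le> (case \<alpha> of (\<alpha>, \<beta>) \<Rightarrow> \<phi>2 (\<beta>, \<alpha>))" for \<alpha> using \<phi>2 by (cases \<alpha>) simp
        show "cmod (deriv (\<lambda>z. f 0 z) z) \<le> (case (\<alpha>, []) of (\<alpha>, \<beta>) \<Rightarrow> \<phi>2 (\<beta>, \<alpha>)) * 2 ^ length \<alpha>"
          if "z \<in> whitney_box \<alpha>" for \<alpha> z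
          using \<phi>2'(3)[OF that zero_in_root_box] by (simp add: \<phi>2_def)
      qed
      have "ennreal (cmod (f 0 0)) \<le> ennreal (\<phi>3 ([], []))"
        using \<phi>3(3)[OF zero_in_root_box zero_in_root_box] by (intro ennreal_leI) simp
      also have "\<dots> \<le> hardy \<phi>3 ?s" by (rule hardy_root_ge)
      finally show "ennreal (cmod (f 0 0)) \<le> hardy \<phi>3 ?s" .
    qed
    also have "\<dots> = hardy \<phi> ?s"
      unfolding \<phi>_def using \<phi>0(1) \<phi>1(1) \<phi>2 \<phi>3(1) by (simp add: hardy_add)
    finally show "radial_variation f (\<zeta>1, \<zeta>2) \<le> hardy \<phi> ?s" .
  qed
qed

section \<open>Integrals over the closed bidisc and over the bitree\<close>

text \<open>The cells cover the closed disc: every interior point lies in some box, and on the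
  circle the two halves add up to 1.\<close>

lemma cell_weight_sum_ge:
  assumes z: "z \<in> cball 0 1"
  shows "1 \<le> (\<integral>\<^sup>+i. cell_weight i z \<partial>count_space UNIV)"
proof (cases "cmod z = 1")
  case True
  have "1 = (\<Sum>i\<in>{Inr True, Inr False}. cell_weight i z * indicator {Inr True, Inr False} i)"
  proof -
    have "ennreal (1/2) + ennreal (1/2) = 1" by (subst ennreal_plus[symmetric]) auto
    then show ?thesis using True by (simp add: indicator_def)
  qed
  also have "\<dots> = (\<integral>\<^sup>+i. cell_weight i z * indicator {Inr True, Inr False} i \<partial>count_space UNIV)"
    by (rule nn_integral_count_space'[symmetric]) auto
  also have "\<dots> \<le> (\<integral>\<^sup>+i. cell_weight i z \<partial>count_space UNIV)"
    by (intro nn_integral_mono) (auto simp: indicator_def)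
  finally show ?thesis .
next
  case False
  with z have "0 < 1 - cmod z" "1 - cmod z \<le> 1" by auto
  then obtain j where j: "1 / 2 ^ Suc j \<le> 1 - cmod z" "1 - cmod z \<le> 1 / 2 ^ j" by (rule dyadic_scale) blast
  define \<alpha> where "\<alpha> = end_vertex (floor_end (turn z)) j"
  have "cis (2 * pi * turn z) \<in> arc \<alpha>"
    unfolding arc_eq \<alpha>_def using floor_end_in_interval[OF turn_bounds] by blast
  with j have "of_real (cmod z) * cis (2 * pi * turn z) \<in> whitney_box \<alpha>"
    unfolding whitney_box_def \<alpha>_def by (auto simp del: power_Suc)
  then have "1 = cell_weight (Inl \<alpha>) z" unfolding cis_turn by simp
  also have "\<dots> \<le> (\<integral>\<^sup>+i. cell_weight i z \<partial>count_space UNIV)"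
    by (rule nn_integral_ge_point) simp
  finally show ?thesis .
qed

lemma cell_weight_pair_sum:
  "(\<integral>\<^sup>+k. cell_weight (fst k) z * cell_weight (snd k) w \<partial>count_space UNIV) =
    (\<integral>\<^sup>+i. cell_weight i z \<partial>count_space UNIV) * (\<integral>\<^sup>+j. cell_weight j w \<partial>count_space UNIV)"
  by (subst nn_integral_fst_count_space[symmetric]) (simp add: nn_integral_cmult nn_integral_multc)

lemma nn_integral_tree_measure_swap:
  assumes \<mu>: "closed_bidisc_measure \<mu>" and g: "g \<in> borel_measurable borel"
  shows "(\<integral>\<^sup>+y. g y \<partial>tree_measure \<mu>) = (\<integral>\<^sup>+z. \<integral>\<^sup>+k. cell_weight (fst k) (fst z) * cell_weight (snd k) (snd z) *
     g (cell_point (fst k) (fst z), cell_point (snd k) (snd z)) \<partial>count_space UNIV \<partial>\<mu>)"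
proof -
  have "(\<lambda>z. cell_weight (fst k) (fst z) * cell_weight (snd k) (snd z) *
     g (cell_point (fst k) (fst z), cell_point (snd k) (snd z))) \<in> borel_measurable \<mu>" for k
    by (intro measurable_closed_bidisc_measure[OF \<mu>] borel_measurable_times_ennreal cell_weight_pair_measurable
        measurable_compose[OF cell_weight_pair_measurable(2) g])
  then show ?thesis
    unfolding nn_integral_tree_measure[OF \<mu> g] case_prod_unfold
    by (intro nn_integral_count_space_nn_integral[symmetric]) auto
qed

text \<open>The weights at a point sum to at least 1, so \<open>G z\<close> may be distributed over
  the points of the bitree above \<open>z\<close>. This is done pointwise, which admits the radial
  variation, about whose measurability nothing is proved.\<close>

lemma nn_integral_le_tree_measure:
  assumes \<mu>: "closed_bidisc_measure \<mu>" and g: "g \<in> borel_measurable borel"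
    and le: "\<And>i j z w. cell_weight i z \<noteq> 0 \<Longrightarrow> cell_weight j w \<noteq> 0 \<Longrightarrow> G (z, w) \<le> g (cell_point i z, cell_point j w)"
  shows "(\<integral>\<^sup>+z. G z \<partial>\<mu>) \<le> (\<integral>\<^sup>+y. g y \<partial>tree_measure \<mu>)"
  unfolding nn_integral_tree_measure_swap[OF \<mu> g]
proof (rule nn_integral_mono)
  fix z assume "z \<in> space \<mu>"
  then have z: "fst z \<in> cball 0 1" "snd z \<in> cball 0 1" by (auto simp: space_closed_bidisc_measure[OF \<mu>])
  have "G z * (1 * 1) \<le> G z * ((\<integral>\<^sup>+i. cell_weight i (fst z) \<partial>count_space UNIV) * (\<integral>\<^sup>+j. cell_weight j (snd z) \<partial>count_space UNIV))"
    by (intro mult_left_mono mult_mono cell_weight_sum_ge z) auto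
  also have "\<dots> = (\<integral>\<^sup>+k. G z * (cell_weight (fst k) (fst z) * cell_weight (snd k) (snd z)) \<partial>count_space UNIV)"
    unfolding cell_weight_pair_sum[symmetric] by (rule nn_integral_cmult[symmetric]) simp
  also have "\<dots> \<le> (\<integral>\<^sup>+k. cell_weight (fst k) (fst z) * cell_weight (snd k) (snd z) *
     g (cell_point (fst k) (fst z), cell_point (snd k) (snd z)) \<partial>count_space UNIV)"
  proof (rule nn_integral_mono)
    fix k :: "(vertex + bool) \<times> (vertex + bool)"
    show "G z * (cell_weight (fst k) (fst z) * cell_weight (snd k) (snd z)) \<le> cell_weight (fst k) (fst z) * cell_weight (snd k) (snd z) *
     g (cell_point (fst k) (fst z), cell_point (snd k) (snd z))"
    proof (cases "cell_weight (fst k) (fst z) = 0 \<or> cell_weight (snd k) (snd z) = 0")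
      case False
      then have "G z \<le> g (cell_point (fst k) (fst z), cell_point (snd k) (snd z))"
        using le[of "fst k" "fst z" "snd k" "snd z"] by simp
      then show ?thesis by (subst mult.commute) (rule mult_left_mono, simp_all)
    qed auto
  qed
  finally show "G z \<le> (\<integral>\<^sup>+k. cell_weight (fst k) (fst z) * cell_weight (snd k) (snd z) *
     g (cell_point (fst k) (fst z), cell_point (snd k) (snd z)) \<partial>count_space UNIV)" by simp
qed

theorem variation_const_le_hardy_norm2:
  assumes \<mu>: "closed_bidisc_measure \<mu>"
  shows "variation_const \<mu> \<le> ennreal (16 * (4 * 257 * 257 * 64 * 400)) * hardy_norm2 (tree_measure \<mu>)"
  unfolding variation_const_def
proof (rule SUP_least)
  let ?K = "16 * (4 * 257 * 257 * 64 * 400) :: real"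
  fix f assume "f \<in> {f \<in> dirichlet_bidisc. dirichlet_norm2 f = 1}"
  then have f: "f \<in> dirichlet_bidisc" and N: "dirichlet_norm2 f = 1" by auto
  obtain \<phi> where \<phi>: "\<And>\<alpha>. 0 \<le> \<phi> \<alpha>"
    "(\<integral>\<^sup>+\<alpha>. ennreal ((\<phi> \<alpha>)\<^sup>2) \<partial>count_space UNIV) \<le> ennreal ?K * dirichlet_norm2 f"
    "\<And>i j \<zeta>1 \<zeta>2. cell_weight i \<zeta>1 \<noteq> 0 \<Longrightarrow> cell_weight j \<zeta>2 \<noteq> 0 \<Longrightarrow>
      radial_variation f (\<zeta>1, \<zeta>2) \<le> hardy \<phi> (cell_point i \<zeta>1, cell_point j \<zeta>2)"
    using radial_variation_le_hardy[OF f] by blast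
  have le: "(\<integral>\<^sup>+\<alpha>. ennreal ((\<phi> \<alpha>)\<^sup>2) \<partial>count_space UNIV) \<le> ennreal ?K" using \<phi>(2) N by simp
  have "(\<integral>\<^sup>+\<zeta>. (radial_variation f \<zeta>)\<^sup>2 \<partial>\<mu>) \<le> (\<integral>\<^sup>+y. (hardy \<phi> y)\<^sup>2 \<partial>tree_measure \<mu>)"
    by (rule nn_integral_le_tree_measure[OF \<mu>]) (auto intro!: power_mono \<phi>(3))
  also have "\<dots> \<le> hardy_norm2 (tree_measure \<mu>) * (\<integral>\<^sup>+\<alpha>. ennreal ((\<phi> \<alpha>)\<^sup>2) \<partial>count_space UNIV)"
  proof (rule hardy_norm2_bound[OF \<phi>(1)])
    have "(\<integral>\<^sup>+\<alpha>. ennreal ((\<phi> \<alpha>)\<^sup>2) \<partial>count_space UNIV) < top" by (rule le_less_trans[OF le]) simp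
    then show "(\<integral>\<^sup>+\<alpha>. ennreal ((\<phi> \<alpha>)\<^sup>2) \<partial>count_space UNIV) \<noteq> top" by simp
  qed
  also have "\<dots> \<le> hardy_norm2 (tree_measure \<mu>) * ennreal ?K"
    by (rule mult_left_mono[OF le]) simp
  finally show "(\<integral>\<^sup>+\<zeta>. (radial_variation f \<zeta>)\<^sup>2 \<partial>\<mu>) \<le> ennreal ?K * hardy_norm2 (tree_measure \<mu>)"
    by (simp only: mult.commute)
qed

subsection \<open>The radial variation dominates the modulus\<close>

lemma scaled_in_ball:
  fixes p :: real
  assumes "0 \<le> p" "p < 1" "\<zeta> \<in> cball 0 1"
  shows "of_real p * \<zeta> \<in> ball (0 :: complex) 1"
proof -
  have "p * cmod \<zeta> \<le> p * 1" using assms by (intro mult_left_mono) auto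
  with assms show ?thesis by (simp add: norm_mult)
qed

lemma norm_increment_le_radial_integral:
  assumes h: "h holomorphic_on ball 0 1" and \<zeta>: "\<zeta> \<in> cball 0 1" and R: "0 \<le> R" "R < 1"
  shows "ennreal (cmod (h (of_real R * \<zeta>) - h 0)) \<le>
    (\<integral>\<^sup>+p\<in>{0..<1}. ennreal (cmod (deriv h (of_real p * \<zeta>)) * cmod \<zeta>) \<partial>lborel)"
proof -
  note in_ball = scaled_in_ball[OF _ _ \<zeta>]
  define D where "D p = deriv h (of_real p * \<zeta>) * \<zeta>" for p
  have deriv: "((\<lambda>p. h (of_real p * \<zeta>)) has_vector_derivative D p) (at p within {0..R})" if "p \<in> {0..R}" for p
  proof -
    have "(h has_field_derivative deriv h (of_real p * \<zeta>)) (at (of_real p * \<zeta>))"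
      using in_ball that R by (intro holomorphic_derivI[OF h open_ball]) auto
    moreover have "((\<lambda>p. of_real p * \<zeta>) has_vector_derivative \<zeta>) (at p within {0..R})"
      by (auto intro!: derivative_eq_intros)
    ultimately show ?thesis unfolding D_def
      using field_vector_diff_chain_within[of "\<lambda>p. of_real p * \<zeta>" \<zeta> p "{0..R}" h "deriv h (of_real p * \<zeta>)"]
      by (auto simp: o_def mult.commute has_field_derivative_at_within)
  qed
  have "(D has_integral (h (of_real R * \<zeta>) - h (of_real 0 * \<zeta>))) {0..R}"
    using R deriv by (intro fundamental_theorem_of_calculus) auto
  then have I: "(D has_integral (h (of_real R * \<zeta>) - h 0)) {0..R}" by simp
  have cont: "continuous_on {0..R} D"
    unfolding D_def
  proof (intro continuous_intros continuous_on_compose2[OF holomorphic_on_imp_continuous_on[OF holomorphic_deriv[OF h open_ball]]])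
    show "(\<lambda>p. of_real p * \<zeta>) ` {0..R} \<subseteq> ball 0 1" using in_ball R by (auto simp del: mem_ball mem_ball_0)
  qed
  let ?J = "integral {0..R} (\<lambda>p. cmod (D p))"
  have J: "((\<lambda>p. cmod (D p)) has_integral ?J) {0..R}"
    by (intro integrable_integral integrable_continuous_real continuous_intros cont)
  have "cmod (integral {0..R} D) \<le> ?J"
    by (rule Henstock_Kurzweil_Integration.integral_norm_bound_integral)
       (use I J in \<open>auto simp: has_integral_integrable_integral\<close>)
  then have "cmod (h (of_real R * \<zeta>) - h 0) \<le> ?J" using integral_unique[OF I] by simp
  then have "ennreal (cmod (h (of_real R * \<zeta>) - h 0)) \<le> ennreal ?J" by (rule ennreal_leI)
  also have "\<dots> = (\<integral>\<^sup>+p\<in>{0..R}. ennreal (cmod (D p)) \<partial>lborel)"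
    by (rule nn_integral_has_integral_lebesgue'[OF _ J, symmetric]) simp
  also have "\<dots> \<le> (\<integral>\<^sup>+p\<in>{0..<1}. ennreal (cmod (D p)) \<partial>lborel)"
    using R by (intro nn_integral_mono) (auto simp: indicator_def)
  finally show ?thesis by (simp add: D_def norm_mult)
qed

text \<open>The value \<open>f z w\<close> is a mixed second difference plus the two increments
  along the axes plus \<open>f 0 0\<close>, matching the four terms of the variation. The mixed
  difference takes the one-variable bound twice.\<close>

lemma norm_le_radial_variation:
  assumes f: "bidisc_expansion f a" and \<zeta>: "\<zeta>1 \<in> cball 0 1" "\<zeta>2 \<in> cball 0 1" and R: "0 \<le> R" "R < 1"
  shows "ennreal (cmod (f (of_real R * \<zeta>1) (of_real R * \<zeta>2))) \<le> radial_variation f (\<zeta>1, \<zeta>2)"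
proof -
  note in_ball = scaled_in_ball
  define z where "z = of_real R * \<zeta>1"
  define w where "w = of_real R * \<zeta>2"
  have z: "z \<in> ball 0 1" and w: "w \<in> ball 0 1" using in_ball R \<zeta> by (auto simp: z_def w_def simp del: mem_ball mem_ball_0)
  have o: "(0::complex) \<in> ball 0 1" by simp
  note holo = bidisc_expansion_holomorphic[OF f] bidisc_expansion_holomorphic[OF bidisc_expansion_swap[OF f]]
  \<comment> \<open>\<open>G w - G 0\<close> is the mixed second difference of \<open>f\<close>
    between the origin and \<open>(z, w)\<close>.\<close>
  define G where "G w = f z w - f 0 w" for w
  have G: "G holomorphic_on ball 0 1" unfolding G_def by (intro holomorphic_intros holo z o)
  have dG: "deriv G v = deriv (\<lambda>w. f z w) v - deriv (\<lambda>w. f 0 w) v" if "v \<in> ball 0 1" for v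
    unfolding G_def using that z o
    by (intro deriv_diff holomorphic_on_imp_differentiable_at[OF holo(2) open_ball]) auto
  have second: "bidisc_expansion (\<lambda>z w. deriv (\<lambda>w. f z w) w) (\<lambda>m n. of_nat (Suc n) * a m (Suc n))"
    using bidisc_expansion_swap[OF bidisc_expansion_deriv[OF bidisc_expansion_swap[OF f]]] .
  have inner: "ennreal (cmod (deriv G v) * cmod \<zeta>2) \<le>
      (\<integral>\<^sup>+p\<in>{0..<1}. ennreal (cmod (mixed_deriv f (of_real p * \<zeta>1) v) * cmod \<zeta>1 * cmod \<zeta>2) \<partial>lborel)"
    if v: "v \<in> ball 0 1" for v
  proof -
    \<comment> \<open>Here the derivative in the second variable comes first, so
      \<open>mixed_deriv_swap\<close> is called for; the factor \<open>cmod \<zeta>2\<close> is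
      built into \<open>h\<close> to match the integrand of the variation.\<close>
    define h where "h u = of_real (cmod \<zeta>2) * deriv (\<lambda>w. f u w) v" for u
    have h: "h holomorphic_on ball 0 1"
      unfolding h_def by (intro holomorphic_intros bidisc_expansion_holomorphic[OF second v])
    have dh: "deriv h u = of_real (cmod \<zeta>2) * mixed_deriv f u v" if "u \<in> ball 0 1" for u
      unfolding h_def mixed_deriv_swap[OF f that v]
      by (intro deriv_cmult holomorphic_on_imp_differentiable_at[OF bidisc_expansion_holomorphic[OF second v] open_ball that])
    have "ennreal (cmod (deriv G v) * cmod \<zeta>2) = ennreal (cmod (h (of_real R * \<zeta>1) - h 0))"
      unfolding dG[OF v] h_def z_def[symmetric] right_diff_distrib[symmetric] by (simp add: norm_mult mult.commute)
    also have "\<dots> \<le> (\<integral>\<^sup>+p\<in>{0..<1}. ennreal (cmod (deriv h (of_real p * \<zeta>1)) * cmod \<zeta>1) \<partial>lborel)"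
      by (rule norm_increment_le_radial_integral[OF h \<zeta>(1) R])
    also have "\<dots> = (\<integral>\<^sup>+p\<in>{0..<1}. ennreal (cmod (mixed_deriv f (of_real p * \<zeta>1) v) * cmod \<zeta>1 * cmod \<zeta>2) \<partial>lborel)"
    proof (intro nn_integral_cong)
      fix p :: real
      show "ennreal (cmod (deriv h (of_real p * \<zeta>1)) * cmod \<zeta>1) * indicator {0..<1} p =
          ennreal (cmod (mixed_deriv f (of_real p * \<zeta>1) v) * cmod \<zeta>1 * cmod \<zeta>2) * indicator {0..<1} p"
      proof (cases "p \<in> {0..<1}")
        case True
        then have "of_real p * \<zeta>1 \<in> ball 0 1" using in_ball \<zeta>(1) by auto
        then show ?thesis by (simp add: dh norm_mult mult_ac)
      qed simp
    qed
    finally show ?thesis .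
  qed
  have mixed: "ennreal (cmod (G w - G 0)) \<le>
      (\<integral>\<^sup>+q\<in>{0..<1}. (\<integral>\<^sup>+p\<in>{0..<1}. ennreal (cmod (mixed_deriv f (of_real p * \<zeta>1) (of_real q * \<zeta>2)) * cmod \<zeta>1 * cmod \<zeta>2)
       \<partial>lborel) \<partial>lborel)"
  proof -
    have "ennreal (cmod (G w - G 0)) \<le> (\<integral>\<^sup>+q\<in>{0..<1}. ennreal (cmod (deriv G (of_real q * \<zeta>2)) * cmod \<zeta>2) \<partial>lborel)"
      unfolding w_def by (rule norm_increment_le_radial_integral[OF G \<zeta>(2) R])
    also have "\<dots> \<le> (\<integral>\<^sup>+q\<in>{0..<1}. (\<integral>\<^sup>+p\<in>{0..<1}.
       ennreal (cmod (mixed_deriv f (of_real p * \<zeta>1) (of_real q * \<zeta>2)) * cmod \<zeta>1 * cmod \<zeta>2) \<partial>lborel) \<partial>lborel)"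
    proof (rule nn_integral_mono)
      fix q :: real
      show "ennreal (cmod (deriv G (of_real q * \<zeta>2)) * cmod \<zeta>2) * indicator {0..<1} q \<le>
        (\<integral>\<^sup>+p\<in>{0..<1}. ennreal (cmod (mixed_deriv f (of_real p * \<zeta>1) (of_real q * \<zeta>2)) * cmod \<zeta>1 * cmod \<zeta>2) \<partial>lborel) *
          indicator {0..<1} q"
        using inner[OF in_ball[OF _ _ \<zeta>(2), of q]] by (cases "q \<in> {0..<1}") auto
    qed
    finally show ?thesis .
  qed
  have first: "ennreal (cmod (f z 0 - f 0 0)) \<le>
      (\<integral>\<^sup>+p\<in>{0..<1}. ennreal (cmod (deriv (\<lambda>z. f z 0) (of_real p * \<zeta>1)) * cmod \<zeta>1) \<partial>lborel)"
    unfolding z_def by (rule norm_increment_le_radial_integral[OF holo(1)[OF o] \<zeta>(1) R])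
  have snd: "ennreal (cmod (f 0 w - f 0 0)) \<le>
      (\<integral>\<^sup>+q\<in>{0..<1}. ennreal (cmod (deriv (\<lambda>w. f 0 w) (of_real q * \<zeta>2)) * cmod \<zeta>2) \<partial>lborel)"
    unfolding w_def by (rule norm_increment_le_radial_integral[OF holo(2)[OF o] \<zeta>(2) R])
  have "f z w = (G w - G 0) + (f z 0 - f 0 0) + (f 0 w - f 0 0) + f 0 0" by (simp add: G_def)
  then have "cmod (f z w) \<le> cmod (G w - G 0) + cmod (f z 0 - f 0 0) + cmod (f 0 w - f 0 0) + cmod (f 0 0)"
    using norm_triangle_ineq[of "(G w - G 0) + (f z 0 - f 0 0) + (f 0 w - f 0 0)" "f 0 0"]
      norm_triangle_ineq[of "(G w - G 0) + (f z 0 - f 0 0)" "f 0 w - f 0 0"]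
      norm_triangle_ineq[of "G w - G 0" "f z 0 - f 0 0"] by (simp only:)
  then have "ennreal (cmod (f z w)) \<le> ennreal (cmod (G w - G 0) + cmod (f z 0 - f 0 0) + cmod (f 0 w - f 0 0) + cmod (f 0 0))"
    by (rule ennreal_leI)
  also have "\<dots> = ennreal (cmod (G w - G 0)) + ennreal (cmod (f z 0 - f 0 0)) + ennreal (cmod (f 0 w - f 0 0)) + ennreal (cmod (f 0 0))"
    by (simp add: ennreal_plus)
  also have "\<dots> \<le> radial_variation f (\<zeta>1, \<zeta>2)"
    unfolding radial_variation_def case_prod_conv using mixed first snd
    by (intro add_mono order_refl) (simp_all add: mixed_deriv_def)
  finally show ?thesis unfolding z_def w_def .
qed

section \<open>Normalisation in the Dirichlet space, and Carleson constant against variation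
  constant\<close>

lemma dirichlet_bidisc_cmult:
  assumes f: "f \<in> dirichlet_bidisc"
  shows "(\<lambda>z w. c * f z w) \<in> dirichlet_bidisc"
    and "dirichlet_norm2 (\<lambda>z w. c * f z w) = ennreal ((cmod c)\<^sup>2) * dirichlet_norm2 f"
proof -
  note exp = bidisc_expansion_taylor_coeff[OF f]
  have exp': "bidisc_expansion (\<lambda>z w. c * f z w) (\<lambda>m n. c * taylor_coeff f m n)"
    by (rule bidisc_expansion_cmult[OF exp])
  have "ennreal ((cmod (c * x))\<^sup>2 * y * w) = ennreal ((cmod c)\<^sup>2) * ennreal ((cmod x)\<^sup>2 * y * w)"
    for x and y w :: real
    by (simp add: norm_mult power_mult_distrib mult.assoc ennreal_mult')
  then show norm: "dirichlet_norm2 (\<lambda>z w. c * f z w) = ennreal ((cmod c)\<^sup>2) * dirichlet_norm2 f"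
    unfolding dirichlet_norm2_eq coeff_norm2_def taylor_coeff_eqI[OF exp'] by (simp add: nn_integral_cmult)
  have "bidisc_holomorphic (\<lambda>z w. c * f z w)"
    using f unfolding dirichlet_bidisc_def bidisc_holomorphic_def case_prod_unfold
    by (auto intro!: continuous_intros holomorphic_intros)
  moreover have "dirichlet_norm2 (\<lambda>z w. c * f z w) < \<infinity>"
    using f unfolding norm by (simp add: dirichlet_bidisc_def ennreal_mult_less_top)
  ultimately show "(\<lambda>z w. c * f z w) \<in> dirichlet_bidisc"
    using exp' by (auto simp: dirichlet_bidisc_def)
qed

lemma dirichlet_norm2_zero:
  assumes f: "f \<in> dirichlet_bidisc" and 0: "dirichlet_norm2 f = 0" and z: "z \<in> ball 0 1" "w \<in> ball 0 1"
  shows "f z w = 0"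
proof -
  have "taylor_coeff f m n = 0" for m n
  proof (rule ccontr)
    assume "taylor_coeff f m n \<noteq> 0"
    then have "0 < (cmod (taylor_coeff f m n))\<^sup>2 * (real m + 1) * (real n + 1)"
      by (intro mult_pos_pos) auto
    moreover have "ennreal ((cmod (taylor_coeff f m n))\<^sup>2 * (real m + 1) * (real n + 1)) \<le> dirichlet_norm2 f"
      unfolding dirichlet_norm2_def
      by (rule order_trans[OF _ nn_integral_ge_point[of "(m, n)"]]) auto
    ultimately show False using 0 by simp
  qed
  then show ?thesis
    using has_sum_unique[OF bidisc_expansionD[OF bidisc_expansion_taylor_coeff[OF f] z] has_sum_0] by auto
qed

lemma closed_bidisc_scaled_in_ball:
  assumes "closed_bidisc_measure \<mu>" "\<zeta> \<in> space \<mu>" "R \<in> {0..<1::real}"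
  shows "of_real R * fst \<zeta> \<in> ball 0 1" "of_real R * snd \<zeta> \<in> ball 0 1"
  using assms by (auto intro!: scaled_in_ball simp: space_closed_bidisc_measure simp del: mem_ball mem_ball_0)

lemma dilation_measurable:
  assumes \<mu>: "closed_bidisc_measure \<mu>" and f: "bidisc_expansion f a" and R: "R \<in> {0..<1::real}"
  shows "(\<lambda>\<zeta>. f (of_real R * fst \<zeta>) (of_real R * snd \<zeta>)) \<in> borel_measurable \<mu>"
proof (rule bidisc_expansion_borel_measurable[OF f])
  show "(\<lambda>\<zeta>. of_real R * fst \<zeta>) \<in> borel_measurable \<mu>" "(\<lambda>\<zeta>. of_real R * snd \<zeta>) \<in> borel_measurable \<mu>"
    by (intro measurable_closed_bidisc_measure[OF \<mu>]; measurable)+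
qed (use closed_bidisc_scaled_in_ball[OF \<mu> _ R] in auto)

theorem carleson_const_le_variation_const:
  assumes \<mu>: "closed_bidisc_measure \<mu>"
  shows "carleson_const \<mu> \<le> variation_const \<mu>"
  unfolding carleson_const_def
proof (rule Inf_lower, intro CollectI ballI SUP_least)
  fix f and R :: real assume f: "f \<in> dirichlet_bidisc" and R: "R \<in> {0..<1}"
  show "(\<integral>\<^sup>+(\<zeta>1, \<zeta>2). ennreal ((cmod (f (of_real R * \<zeta>1) (of_real R * \<zeta>2)))\<^sup>2) \<partial>\<mu>) \<le> variation_const \<mu> * dirichlet_norm2 f"
  \<comment> \<open>The supremum runs over functions of norm one. A function of norm zero cannot be
    normalised, but it vanishes on the bidisc.\<close>
  proof (cases "dirichlet_norm2 f = 0")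
    case True
    have "(\<integral>\<^sup>+(\<zeta>1, \<zeta>2). ennreal ((cmod (f (of_real R * \<zeta>1) (of_real R * \<zeta>2)))\<^sup>2) \<partial>\<mu>) = (\<integral>\<^sup>+\<zeta>. 0 \<partial>\<mu>)"
      using dirichlet_norm2_zero[OF f True] closed_bidisc_scaled_in_ball[OF \<mu> _ R]
      by (intro nn_integral_cong) (auto simp: case_prod_unfold)
    then show ?thesis by simp
  next
    case False
    define N where "N = enn2real (dirichlet_norm2 f)"
    have N: "dirichlet_norm2 f = ennreal N" "0 < N"
      using f False by (auto simp: N_def dirichlet_bidisc_def enn2real_positive_iff zero_less_iff_neq_zero)
    define c where "c = complex_of_real (1 / sqrt N)"
    have c: "(cmod c)\<^sup>2 = 1 / N" using N by (simp add: c_def power_divide norm_divide)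
    let ?g = "\<lambda>z w. c * f z w"
    have g: "?g \<in> dirichlet_bidisc" by (rule dirichlet_bidisc_cmult[OF f])
    have "dirichlet_norm2 ?g = 1"
      unfolding dirichlet_bidisc_cmult(2)[OF f] c N(1) using N(2) by (simp flip: ennreal_mult)
    with g have "(\<integral>\<^sup>+\<zeta>. (radial_variation ?g \<zeta>)\<^sup>2 \<partial>\<mu>) \<le> variation_const \<mu>"
      unfolding variation_const_def by (intro SUP_upper) auto
    moreover have "(\<integral>\<^sup>+\<zeta>. ennreal ((cmod (?g (of_real R * fst \<zeta>) (of_real R * snd \<zeta>)))\<^sup>2) \<partial>\<mu>) \<le>
        (\<integral>\<^sup>+\<zeta>. (radial_variation ?g \<zeta>)\<^sup>2 \<partial>\<mu>)"
    proof (rule nn_integral_mono)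
      fix \<zeta> assume "\<zeta> \<in> space \<mu>"
      then have "fst \<zeta> \<in> cball 0 1" "snd \<zeta> \<in> cball 0 1" by (auto simp: space_closed_bidisc_measure[OF \<mu>])
      from norm_le_radial_variation[OF bidisc_expansion_taylor_coeff[OF g] this, of R] R
      have "ennreal (cmod (?g (of_real R * fst \<zeta>) (of_real R * snd \<zeta>))) \<le> radial_variation ?g \<zeta>" by simp
      from power_mono[OF this, of 2]
      show "ennreal ((cmod (?g (of_real R * fst \<zeta>) (of_real R * snd \<zeta>)))\<^sup>2) \<le> (radial_variation ?g \<zeta>)\<^sup>2"
        by (simp add: ennreal_power)
    qed
    ultimately have le: "(\<integral>\<^sup>+\<zeta>. ennreal ((cmod (?g (of_real R * fst \<zeta>) (of_real R * snd \<zeta>)))\<^sup>2) \<partial>\<mu>) \<le> variation_const \<mu>"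
      by (rule order_trans[rotated])
    have [measurable]: "(\<lambda>\<zeta>. ?g (of_real R * fst \<zeta>) (of_real R * snd \<zeta>)) \<in> borel_measurable \<mu>"
      by (rule dilation_measurable[OF \<mu> bidisc_expansion_taylor_coeff[OF g] R])
    have "(\<integral>\<^sup>+(\<zeta>1, \<zeta>2). ennreal ((cmod (f (of_real R * \<zeta>1) (of_real R * \<zeta>2)))\<^sup>2) \<partial>\<mu>) =
        (\<integral>\<^sup>+\<zeta>. ennreal N * ennreal ((cmod (?g (of_real R * fst \<zeta>) (of_real R * snd \<zeta>)))\<^sup>2) \<partial>\<mu>)"
    proof (intro nn_integral_cong)
      fix \<zeta>
      have "(cmod (f x y))\<^sup>2 = N * (cmod (c * f x y))\<^sup>2" for x y
        using N c by (simp add: norm_mult power_mult_distrib)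
      then show "(case \<zeta> of (\<zeta>1, \<zeta>2) \<Rightarrow> ennreal ((cmod (f (of_real R * \<zeta>1) (of_real R * \<zeta>2)))\<^sup>2)) =
          ennreal N * ennreal ((cmod (?g (of_real R * fst \<zeta>) (of_real R * snd \<zeta>)))\<^sup>2)"
        using N by (simp add: case_prod_unfold ennreal_mult')
    qed
    also have "\<dots> = ennreal N * (\<integral>\<^sup>+\<zeta>. ennreal ((cmod (?g (of_real R * fst \<zeta>) (of_real R * snd \<zeta>)))\<^sup>2) \<partial>\<mu>)"
      by (rule nn_integral_cmult) measurable
    also have "\<dots> \<le> ennreal N * variation_const \<mu>" by (rule mult_left_mono[OF le]) simp
    finally show ?thesis unfolding N(1) by (simp add: mult.commute)
  qed
qed

subsection \<open>Overlap of boxes\<close>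

lemma carleson_box_direction:
  assumes z: "z \<in> carleson_box \<alpha>" "z \<noteq> 0"
  shows "sgn z \<in> arc \<alpha>"
proof -
  obtain \<rho> u where zu: "z = of_real \<rho> * u" "u \<in> arc \<alpha>" "1 - 1 / 2 ^ length \<alpha> \<le> \<rho>" "\<rho> \<le> 1"
    using z(1) by (auto simp: carleson_box_def)
  have "(1::real) / 2 ^ length \<alpha> \<le> 1" by simp
  with zu(3) have "0 \<le> \<rho>" by linarith
  with zu(1) z(2) have "0 < \<rho>" by (cases "\<rho> = 0") auto
  moreover have "norm u = 1" using zu(2) arc_subset_sphere by force
  moreover from calculation have "cmod z = \<rho>" unfolding zu(1) by (simp add: norm_mult)
  then have "sgn z = of_real \<rho> * u / of_real \<rho>" unfolding sgn_eq using zu(1) by simp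
  ultimately have "sgn z = u" by simp
  with zu(2) show ?thesis by simp
qed

lemma norm_carleson_box:
  assumes z: "z \<in> carleson_box \<alpha>"
  shows "1 - 1 / 2 ^ length \<alpha> \<le> cmod z" "cmod z \<le> 1"
proof -
  obtain \<rho> u where zu: "z = of_real \<rho> * u" "u \<in> arc \<alpha>" "1 - 1 / 2 ^ length \<alpha> \<le> \<rho>" "\<rho> \<le> 1"
    using z by (auto simp: carleson_box_def)
  have "(1::real) / 2 ^ length \<alpha> \<le> 1" by simp
  with zu(3) have "0 \<le> \<rho>" by linarith
  moreover have "norm u = 1" using zu(2) arc_subset_sphere by force
  ultimately have "cmod z = \<rho>" unfolding zu(1) by (simp add: norm_mult)
  with zu show "1 - 1 / 2 ^ length \<alpha> \<le> cmod z" "cmod z \<le> 1" by auto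
qed

text \<open>Closed arcs of one generation overlap only at common ends, so a direction meets at most
  two of them; the origin has no direction, but lies in the root box alone.\<close>

lemma card_generation_boxes: "card {\<alpha>. length \<alpha> = j \<and> z \<in> carleson_box \<alpha>} \<le> 2"
proof (cases "z = 0")
  case True
  have "{\<alpha>. length \<alpha> = j \<and> z \<in> carleson_box \<alpha>} \<subseteq> {[]}"
  proof safe
    fix \<alpha> assume "z \<in> carleson_box \<alpha>"
    then have "1 - 1 / 2 ^ length \<alpha> \<le> (0::real)" using norm_carleson_box(1)[of z \<alpha>] True by simp
    then have "(2::real) ^ length \<alpha> \<le> 1" by (simp add: field_simps)
    show "\<alpha> = []"
    proof (rule ccontr)
      assume "\<alpha> \<noteq> []"
      then have "1 < (2::real) ^ length \<alpha>" by (intro one_less_power) auto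
      with \<open>(2::real) ^ length \<alpha> \<le> 1\<close> show False by simp
    qed
  qed
  from card_mono[OF _ this] show ?thesis by simp
next
  case False
  define x where "x = turn (sgn z)"
  define n where "n = nat \<lfloor>2 ^ j * x\<rfloor>"
  \<comment> \<open>The possible positions: \<open>n\<close> and its left neighbour, or for angle 0
    the first and the last arc, which meet across the cut.\<close>
  define S where "S = (if x = 0 then {0, 2 ^ j - 1} else {n, n - 1 :: nat})"
  have x: "0 \<le> x" "x < 1" using turn_bounds by (auto simp: x_def)
  have sub: "arc_index ` {\<alpha>. length \<alpha> = j \<and> z \<in> carleson_box \<alpha>} \<subseteq> S"
  proof safe
    fix \<alpha> assume \<alpha>: "z \<in> carleson_box \<alpha>" "j = length \<alpha>"
    have "sgn z \<in> sphere 0 1" using False by (simp add: norm_sgn)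
    then have "x \<in> dyadic_interval \<alpha> \<or> x = 0 \<and> 1 \<in> dyadic_interval \<alpha>"
      using carleson_box_direction[OF \<alpha>(1) False] mem_arc_iff unfolding x_def by blast
    then show "arc_index \<alpha> \<in> S"
    proof
      assume "x \<in> dyadic_interval \<alpha>"
      then have b: "real (arc_index \<alpha>) \<le> 2 ^ j * x" "2 ^ j * x \<le> real (arc_index \<alpha>) + 1"
        using \<alpha>(2) by (auto simp: mem_dyadic_interval_iff)
      show ?thesis
      proof (cases "x = 0")
        case True
        with b show ?thesis by (simp add: S_def)
      next
        case False
        have "int (arc_index \<alpha>) \<le> \<lfloor>2 ^ j * x\<rfloor>" "\<lfloor>2 ^ j * x\<rfloor> \<le> int (arc_index \<alpha>) + 1"
          using b by linarith+
        then have "n = arc_index \<alpha> \<or> n = arc_index \<alpha> + 1" unfolding n_def by linarith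
        with False show ?thesis by (auto simp: S_def)
      qed
    next
      assume *: "x = 0 \<and> 1 \<in> dyadic_interval \<alpha>"
      then have "2 ^ j \<le> real (arc_index \<alpha>) + 1" using \<alpha>(2) by (auto simp: mem_dyadic_interval_iff)
      then have "real (2 ^ j) \<le> real (arc_index \<alpha> + 1)" by simp
      then have "2 ^ j \<le> arc_index \<alpha> + 1" by (simp only: of_nat_le_iff)
      moreover have "arc_index \<alpha> < 2 ^ j" using arc_index_less[of \<alpha>] \<alpha>(2) by simp
      ultimately show ?thesis using * by (auto simp: S_def)
    qed
  qed
  have "card {\<alpha>. length \<alpha> = j \<and> z \<in> carleson_box \<alpha>} = card (arc_index ` {\<alpha>. length \<alpha> = j \<and> z \<in> carleson_box \<alpha>})"
    by (rule card_image[symmetric]) (rule inj_on_subset[OF inj_on_arc_index[of j]], auto)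
  also have "\<dots> \<le> card S" by (rule card_mono[OF _ sub]) (simp add: S_def)
  also have "\<dots> \<le> 2" by (auto simp: S_def card_insert_if)
  finally show ?thesis .
qed

lemma cell_weight_le_1: "cell_weight i z \<le> 1"
proof (cases i)
  case (Inr b)
  have "ennreal (1/2) \<le> ennreal 1" by (rule ennreal_leI) simp
  then show ?thesis using Inr by (auto simp: indicator_def)
qed (auto simp: indicator_def)

text \<open>Boxes of two consecutive generations with two arcs in each, and two ends: six cells at
  most.\<close>

lemma cell_weight_sum_le: "(\<integral>\<^sup>+i. cell_weight i z \<partial>count_space UNIV) \<le> 6"
proof -
  \<comment> \<open>The radial ranges of boxes are closed, so a point on a common edge belongs to
    two consecutive generations. A point of modulus at least 1 lies in no box, and any
    \<open>j0\<close> serves.\<close>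
  obtain j0 where j0: "\<And>\<alpha>. z \<in> whitney_box \<alpha> \<Longrightarrow> length \<alpha> = j0 \<or> length \<alpha> = Suc j0"
  proof (cases "cmod z < 1")
    case True
    then have "0 < 1 - cmod z" "1 - cmod z \<le> 1" by auto
    then obtain j where j: "1 / 2 ^ Suc j \<le> 1 - cmod z" "\<And>i. 1 / 2 ^ Suc i \<le> 1 - cmod z \<Longrightarrow> j \<le> i"
      by (rule dyadic_scale) blast
    have "length \<alpha> = j \<or> length \<alpha> = Suc j" if "z \<in> whitney_box \<alpha>" for \<alpha>
    proof -
      have "j \<le> length \<alpha>" using norm_whitney_box(2)[OF that] by (intro j(2)) linarith
      moreover have "(1::real) / 2 ^ Suc j \<le> 1 / 2 ^ length \<alpha>"
        using norm_whitney_box(1)[OF that] j(1) by linarith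
      then have "(2::real) ^ length \<alpha> \<le> 2 ^ Suc j" by (simp add: field_simps)
      then have "length \<alpha> \<le> Suc j" by (rule power_le_imp_le_exp[rotated]) simp
      ultimately show ?thesis by linarith
    qed
    then show ?thesis by (rule that)
  next
    case False
    then show ?thesis using norm_whitney_box(3) that by blast
  qed
  define A where "A j = {\<alpha>. length \<alpha> = j \<and> z \<in> carleson_box \<alpha>}" for j
  define B where "B = Inl ` A j0 \<union> Inl ` A (Suc j0) \<union> range (Inr :: bool \<Rightarrow> vertex + bool)"
  have finA: "finite (A j)" for j using finite_subset[OF _ finite_generation[of j]] by (auto simp: A_def)
  have cardA: "card (A j) \<le> 2" for j unfolding A_def by (rule card_generation_boxes)
  have fin: "finite B" using finA by (auto simp: B_def intro!: finite_imageI)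
  have "card B \<le> card (A j0) + card (A (Suc j0)) + card (range (Inr :: bool \<Rightarrow> vertex + bool))"
    unfolding B_def
    by (intro order_trans[OF card_Un_le] add_mono card_image_le finA order_refl)
  also have "card (range (Inr :: bool \<Rightarrow> vertex + bool)) = 2" by (subst card_image) auto
  finally have card: "card B \<le> 6" using cardA[of j0] cardA[of "Suc j0"] by linarith
  have "(\<integral>\<^sup>+i. cell_weight i z \<partial>count_space UNIV) = (\<Sum>i\<in>B. cell_weight i z)"
  proof (rule nn_integral_count_space'[OF fin])
    fix i :: "vertex + bool" assume i: "i \<notin> B"
    show "cell_weight i z = 0"
    proof (cases i)
      case (Inl \<alpha>)
      have "z \<notin> whitney_box \<alpha>"
      proof
        assume z: "z \<in> whitney_box \<alpha>"
        then have "z \<in> carleson_box \<alpha>" using whitney_box_subset_carleson_box by blast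
        with j0[OF z] i Inl show False by (auto simp: B_def A_def)
      qed
      with Inl show ?thesis by simp
    qed (use i in \<open>auto simp: B_def\<close>)
  qed auto
  also have "\<dots> \<le> (\<Sum>i\<in>B. 1)" by (rule sum_mono) (rule cell_weight_le_1)
  also have "\<dots> \<le> 6"
  proof -
    have "of_nat (card B) \<le> (of_nat 6 :: ennreal)" using card by (simp only: of_nat_le_iff)
    then show ?thesis by simp
  qed
  finally show ?thesis .
qed

text \<open>36 is the bound 6 on the total weight of the cells over a point, once for each
  coordinate.\<close>

lemma nn_integral_tree_measure_le:
  assumes \<mu>: "closed_bidisc_measure \<mu>" and g: "g \<in> borel_measurable borel" and G: "G \<in> borel_measurable \<mu>"
    and le: "\<And>i j z w. cell_weight i z \<noteq> 0 \<Longrightarrow> cell_weight j w \<noteq> 0 \<Longrightarrow> g (cell_point i z, cell_point j w) \<le> G (z, w)"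
  shows "(\<integral>\<^sup>+y. g y \<partial>tree_measure \<mu>) \<le> 36 * (\<integral>\<^sup>+z. G z \<partial>\<mu>)"
proof -
  have "(\<integral>\<^sup>+y. g y \<partial>tree_measure \<mu>) \<le> (\<integral>\<^sup>+z. 36 * G z \<partial>\<mu>)"
    unfolding nn_integral_tree_measure_swap[OF \<mu> g]
  proof (rule nn_integral_mono)
    fix z
    have "(\<integral>\<^sup>+k. cell_weight (fst k) (fst z) * cell_weight (snd k) (snd z) *
       g (cell_point (fst k) (fst z), cell_point (snd k) (snd z)) \<partial>count_space UNIV) \<le>
      (\<integral>\<^sup>+k. G z * (cell_weight (fst k) (fst z) * cell_weight (snd k) (snd z)) \<partial>count_space UNIV)"
    proof (rule nn_integral_mono)
      fix k :: "(vertex + bool) \<times> (vertex + bool)"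
      show "cell_weight (fst k) (fst z) * cell_weight (snd k) (snd z) *
       g (cell_point (fst k) (fst z), cell_point (snd k) (snd z)) \<le> G z * (cell_weight (fst k) (fst z) * cell_weight (snd k) (snd z))"
      proof (cases "cell_weight (fst k) (fst z) = 0 \<or> cell_weight (snd k) (snd z) = 0")
        case False
        then have "g (cell_point (fst k) (fst z), cell_point (snd k) (snd z)) \<le> G z"
          using le[of "fst k" "fst z" "snd k" "snd z"] by simp
        then show ?thesis by (subst mult.commute) (rule mult_right_mono, simp_all)
      qed auto
    qed
    also have "\<dots> = G z * ((\<integral>\<^sup>+i. cell_weight i (fst z) \<partial>count_space UNIV) * (\<integral>\<^sup>+j. cell_weight j (snd z) \<partial>count_space UNIV))"
      unfolding cell_weight_pair_sum[symmetric] by (rule nn_integral_cmult) simp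
    also have "\<dots> \<le> G z * (6 * 6)"
      by (intro mult_left_mono mult_mono cell_weight_sum_le) auto
    finally show "(\<integral>\<^sup>+k. cell_weight (fst k) (fst z) * cell_weight (snd k) (snd z) *
       g (cell_point (fst k) (fst z), cell_point (snd k) (snd z)) \<partial>count_space UNIV) \<le> 36 * G z"
      by (simp add: mult.commute)
  qed
  also have "\<dots> = 36 * (\<integral>\<^sup>+z. G z \<partial>\<mu>)" by (rule nn_integral_cmult[OF G])
  finally show ?thesis .
qed

lemma cell_point_below_imp_carleson_box:
  assumes w: "cell_weight i z \<noteq> 0" and d: "cell_point i z \<in> descendants \<alpha>"
  shows "z \<in> carleson_box \<alpha>"
proof (cases i)
  case (Inl \<beta>)
  with w have "z \<in> whitney_box \<beta>" by (auto simp: indicator_def split: if_splits)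
  moreover have "prefix \<alpha> \<beta>" using d Inl by (simp add: descendants_def)
  ultimately show ?thesis using whitney_box_subset_carleson_box by blast
next
  case (Inr b)
  with w have z: "z \<in> sphere 0 1" by (auto simp: indicator_def split: if_splits)
  obtain \<omega> where \<omega>: "end_section b z = End \<omega>" by (auto simp: end_section_def)
  with d Inr obtain j where "\<alpha> = end_vertex \<omega> j" by (auto simp: descendants_def)
  then have "z \<in> arc \<alpha>" using end_section_arc[OF z \<omega>] by simp
  then have "of_real 1 * z \<in> carleson_box \<alpha>" unfolding carleson_box_def by (auto intro!: exI[of _ 1] exI[of _ z])
  then show ?thesis by simp
qed

subsection \<open>A logarithmic kernel\<close>

text \<open>The coefficients of \<open>6 - Ln (1 - s)\<close>. The bound 6 for their products with
  the Dirichlet weight \<open>n + 1\<close> is attained at \<open>n = 0\<close>.\<close>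

definition log_coeff :: "nat \<Rightarrow> real" where
  "log_coeff n = (if n = 0 then 6 else 1 / real n)"

lemma log_coeff_nonneg: "0 \<le> log_coeff n"
  by (simp add: log_coeff_def)

lemma log_coeff_le: "log_coeff n * (real n + 1) \<le> 6"
  by (cases n) (auto simp: log_coeff_def field_simps)

lemma log_coeff_sums:
  assumes "cmod s < 1"
  shows "(\<lambda>n. of_real (log_coeff n) * s ^ n) sums (6 - Ln (1 - s))"
proof -
  have "(\<lambda>n. (-1) ^ Suc n / of_nat n * (- s) ^ n) sums Ln (1 + - s)"
    by (rule Ln_series) (use assms in simp)
  then have "(\<lambda>n. - ((-1) ^ Suc n / of_nat n * (- s) ^ n)) sums - Ln (1 + - s)"
    by (rule sums_minus)
  moreover have "- ((-1) ^ Suc n / of_nat n * (- s) ^ n) = s ^ n / of_nat n" for n :: nat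
  proof -
    have "(-1) ^ n * (- s) ^ n = s ^ n" unfolding power_mult_distrib[symmetric] by simp
    moreover have "- ((-1) ^ Suc n / of_nat n * (- s) ^ n) = ((-1) ^ n * (- s) ^ n) / of_nat n" by simp
    ultimately show ?thesis by (simp only:)
  qed
  ultimately have "(\<lambda>n. s ^ n / of_nat n) sums - Ln (1 + - s)" by (simp only:)
  from sums_add[OF sums_single[of 0 "\<lambda>_. 6"] this]
  have "(\<lambda>n. (if n = 0 then 6 else 0) + s ^ n / of_nat n) sums (6 - Ln (1 - s))" by simp
  moreover have "(if n = 0 then 6 else 0) + s ^ n / of_nat n = of_real (log_coeff n) * s ^ n" for n
    by (simp add: log_coeff_def)
  ultimately show ?thesis by (simp only:)
qed

definition log_kernel :: "nat \<Rightarrow> complex \<Rightarrow> complex" where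
  "log_kernel L s = (\<Sum>n<L. of_real (log_coeff n) * s ^ n)"

text \<open>A single polynomial has to serve all pairs of points, whence the uniform approximation
  on a smaller disc. The tolerance 1/3 is part of the numerical slack in the bounds on real and
  imaginary parts.\<close>

lemma log_kernel_approx:
  assumes r: "0 \<le> r" "r < 1"
  obtains L where "\<And>s. cmod s \<le> r \<Longrightarrow> cmod (log_kernel L s - (6 - Ln (1 - s))) \<le> 1/3"
proof -
  have "uniform_limit {s. cmod s \<le> r} (\<lambda>L s. \<Sum>n<L. of_real (log_coeff n) * s ^ n)
      (\<lambda>s. \<Sum>n. of_real (log_coeff n) * s ^ n) sequentially"
  proof (rule Weierstrass_m_test)
    show "summable (\<lambda>n. 6 * r ^ n)" using r by (intro summable_mult summable_geometric) auto
    fix n and s :: complex assume "s \<in> {s. cmod s \<le> r}"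
    moreover have "log_coeff n \<le> 6" by (auto simp: log_coeff_def field_simps)
    ultimately show "cmod (of_real (log_coeff n) * s ^ n) \<le> 6 * r ^ n"
      using log_coeff_nonneg[of n] by (auto simp: norm_mult norm_power intro!: mult_mono power_mono)
  qed
  then have "\<forall>\<^sub>F L in sequentially. \<forall>s\<in>{s. cmod s \<le> r}.
      dist (\<Sum>n<L. of_real (log_coeff n) * s ^ n) (\<Sum>n. of_real (log_coeff n) * s ^ n) < 1/3"
    by (rule uniform_limitD) simp
  then obtain L where L: "\<And>s. cmod s \<le> r \<Longrightarrow>
      dist (\<Sum>n<L. of_real (log_coeff n) * s ^ n) (\<Sum>n. of_real (log_coeff n) * s ^ n) < 1/3"
    by (auto simp: eventually_sequentially)
  show ?thesis
  proof
    fix s assume s: "cmod s \<le> r"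
    then have "(\<Sum>n. of_real (log_coeff n) * s ^ n) = 6 - Ln (1 - s)"
      using log_coeff_sums[of s] r by (simp add: sums_iff)
    with L[OF s] show "cmod (log_kernel L s - (6 - Ln (1 - s))) \<le> 1/3"
      by (simp add: log_kernel_def dist_norm)
  qed
qed

text \<open>\<open>1 - s\<close> has positive real part, so its argument is below pi / 2 < 2 in
  modulus, and the tolerance makes this 7/3. Its modulus is at most 2, so the real part is at least
  \<open>6 - ln 2 - 1/3\<close>. Near the diagonal, \<open>ln 16 \<le> 4\<close> and
  \<open>ln 2 \<ge> 2/3\<close> leave \<open>2/3 * J + 5/3\<close>.\<close>

lemma log_kernel_bounds:
  assumes s: "cmod s < 1" and approx: "cmod (k - (6 - Ln (1 - s))) \<le> 1/3"
  shows "4 \<le> Re k" "\<bar>Im k\<bar> \<le> 7/3"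
    and "cmod (1 - s) \<le> 16 / 2 ^ J \<Longrightarrow> 2/3 * (real J + 1) \<le> Re k"
proof -
  have s1: "1 - s \<noteq> 0" using s by auto
  have "Re s < 1" using s complex_Re_le_cmod[of s] by linarith
  then have "\<bar>Im (Ln (1 - s))\<bar> < pi / 2" by (intro Re_Ln_pos_lt_imp) simp
  then have im: "\<bar>Im (Ln (1 - s))\<bar> < 2" using pi_less_4 by linarith
  have re: "\<bar>Re k - (6 - ln (cmod (1 - s)))\<bar> \<le> 1/3"
    using abs_Re_le_cmod[of "k - (6 - Ln (1 - s))"] approx s1 by (simp add: Re_Ln)
  have "\<bar>Im k + Im (Ln (1 - s))\<bar> \<le> 1/3"
    using abs_Im_le_cmod[of "k - (6 - Ln (1 - s))"] approx by simp
  with im show "\<bar>Im k\<bar> \<le> 7/3" by linarith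
  have pos: "0 < cmod (1 - s)" using s1 by simp
  have "cmod (1 - s) \<le> 2" using norm_triangle_ineq4[of 1 s] s by simp
  then have "ln (cmod (1 - s)) \<le> ln 2" using pos by simp
  then show "4 \<le> Re k" using re ln_2_less_1 by linarith
  assume "cmod (1 - s) \<le> 16 / 2 ^ J"
  then have "ln (cmod (1 - s)) \<le> ln (16 / 2 ^ J)" using pos by simp
  also have "\<dots> = ln (2 ^ 4) - ln (2 ^ J)" by (subst ln_div) auto
  also have "\<dots> = 4 * ln 2 - real J * ln 2" by (simp only: ln_realpow of_nat_numeral)
  also have "\<dots> \<le> 4 * 1 - real J * (2/3)"
    using ln_2_less_1 ln2_ge_two_thirds by (intro diff_mono mult_left_mono) auto
  finally have "ln (cmod (1 - s)) \<le> 4 - 2/3 * real J" by simp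
  moreover have "6 - ln (cmod (1 - s)) - 1/3 \<le> Re k" using re by linarith
  ultimately show "2/3 * (real J + 1) \<le> Re k" unfolding distrib_left by linarith
qed

text \<open>The product of the imaginary parts is at most 49/9, less than half of 16 and hence of
  \<open>Re k * Re l\<close>. So \<open>Re (k * l)\<close> keeps at least half of that product,
  which is itself at least \<open>4/9 * a * b\<close>.\<close>

lemma log_kernel_product:
  fixes k l :: complex
  assumes k: "4 \<le> Re k" "\<bar>Im k\<bar> \<le> 7/3" "2/3 * a \<le> Re k" and l: "4 \<le> Re l" "\<bar>Im l\<bar> \<le> 7/3" "2/3 * b \<le> Re l"
    and ab: "0 \<le> a" "0 \<le> b"
  shows "a * b \<le> 9/2 * Re (k * l)"
proof -
  have "Im k * Im l \<le> \<bar>Im k\<bar> * \<bar>Im l\<bar>" by (metis abs_ge_self abs_mult)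
  also have "\<dots> \<le> 7/3 * (7/3)" using k l by (intro mult_mono) auto
  finally have im: "Im k * Im l \<le> 49/9" by simp
  have "4 * 4 \<le> Re k * Re l" using k l by (intro mult_mono) auto
  moreover have "2/3 * a * (2/3 * b) \<le> Re k * Re l" using k l ab by (intro mult_mono) auto
  ultimately show ?thesis using im by simp
qed

text \<open>With \<open>t = 1 / 2 ^ length \<alpha>\<close> the radial defects of \<open>r\<close>,
  \<open>z\<close> and \<open>w\<close> contribute at most \<open>t\<close> each and the angle at
  most \<open>8 * t\<close>. The total of 11 is rounded up to a power of two, convenient for the
  logarithm.\<close>

lemma carleson_box_kernel_arg:
  assumes z: "z \<in> carleson_box \<alpha>" and w: "w \<in> carleson_box \<alpha>" and r: "0 \<le> r" "1 - 1 / 2 ^ length \<alpha> \<le> r" "r \<le> 1"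
  shows "cmod (1 - of_real r * (z * cnj w)) \<le> 16 / 2 ^ length \<alpha>"
proof -
  define t :: real where "t = 1 / 2 ^ length \<alpha>"
  obtain \<rho> u where zu: "z = of_real \<rho> * u" "u \<in> arc \<alpha>" "1 - t \<le> \<rho>" "\<rho> \<le> 1"
    using z by (auto simp: carleson_box_def t_def)
  obtain \<sigma> v where wv: "w = of_real \<sigma> * v" "v \<in> arc \<alpha>" "1 - t \<le> \<sigma>" "\<sigma> \<le> 1"
    using w by (auto simp: carleson_box_def t_def)
  have t: "0 < t" "t \<le> 1" by (auto simp: t_def)
  have u: "cmod u = 1" "cmod v = 1" using zu(2) wv(2) arc_subset_sphere by force+
  define x where "x = r * \<rho> * \<sigma>"
  have pos: "0 \<le> \<rho>" "0 \<le> \<sigma>" using zu(3) wv(3) t by linarith+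
  have x: "0 \<le> x" "x \<le> 1" using pos r zu(4) wv(4) by (auto simp: x_def intro!: mult_le_one)
  have "1 - x = (1 - r) + r * (1 - \<rho>) + r * \<rho> * (1 - \<sigma>)" by (simp add: x_def algebra_simps)
  also have "\<dots> \<le> t + 1 * t + 1 * t"
    using r zu wv pos t unfolding t_def[symmetric]
    by (intro add_mono mult_mono mult_le_one) auto
  finally have x1: "1 - x \<le> 3 * t" by simp
  have vv: "v * cnj v = 1" using u by (simp add: complex_norm_square[symmetric])
  have "1 - of_real r * (z * cnj w) = of_real (1 - x) + of_real x * (1 - u * cnj v)"
    by (simp add: zu(1) wv(1) x_def algebra_simps)
  also have "1 - u * cnj v = (v - u) * cnj v" by (simp add: algebra_simps vv)
  finally have "cmod (1 - of_real r * (z * cnj w)) \<le> cmod (of_real (1 - x)) + cmod (of_real x * ((v - u) * cnj v))"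
    by (metis norm_triangle_ineq)
  also have "\<dots> = (1 - x) + x * cmod (v - u)"
    using x u by (simp only: norm_mult norm_of_real complex_mod_cnj)
  also have "\<dots> \<le> 3 * t + 1 * (8 * t)"
  proof (intro add_mono x1 mult_mono)
    have "cmod (v - u) \<le> 2 * pi * t" using norm_diff_arc_le[OF wv(2) zu(2)] by (simp add: t_def)
    also have "\<dots> \<le> 8 * t" using pi_less_4 t by (intro mult_right_mono) auto
    finally show "cmod (v - u) \<le> 8 * t" .
  qed (use x in auto)
  also have "\<dots> \<le> 16 * t" using t by simp
  finally show ?thesis by (simp add: t_def)
qed

text \<open>The cut-off at generation \<open>N\<close> keeps the count finite: a point of the circle
  lies in boxes of every generation.\<close>

definition overlap :: "nat \<Rightarrow> complex \<Rightarrow> complex \<Rightarrow> real" where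
  "overlap N z w = (\<Sum>\<alpha> | length \<alpha> \<le> N. indicator (carleson_box \<alpha>) z * indicator (carleson_box \<alpha>) w)"

lemma finite_vertices_le: "finite {\<alpha> :: vertex. length \<alpha> \<le> N}"
  using finite_lists_length_le[of "UNIV :: bool set" N] by simp

lemma root_carleson_box:
  assumes "z \<in> cball 0 1" shows "z \<in> carleson_box []"
proof -
  have "turn z \<in> dyadic_interval []"
    using turn_bounds[of z] by (simp add: mem_dyadic_interval_iff)
  then have "cis (2 * pi * turn z) \<in> arc []" unfolding arc_eq by blast
  then have "of_real (cmod z) * cis (2 * pi * turn z) \<in> carleson_box []"
    unfolding carleson_box_def using assms
    by (intro CollectI exI[of _ "cmod z"] exI[of _ "cis (2 * pi * turn z)"]) auto
  then show ?thesis unfolding cis_turn .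
qed

text \<open>A common box of greatest generation bounds the depth of all the others, and each
  generation up to it contributes at most two.\<close>

lemma overlap_le:
  assumes z: "z \<in> cball 0 1" and w: "w \<in> cball 0 1"
  obtains \<alpha> where "length \<alpha> \<le> N" "z \<in> carleson_box \<alpha>" "w \<in> carleson_box \<alpha>" "overlap N z w \<le> 2 * (real (length \<alpha>) + 1)"
proof -
  define W where "W = {\<alpha>. length \<alpha> \<le> N \<and> z \<in> carleson_box \<alpha> \<and> w \<in> carleson_box \<alpha>}"
  have fin: "finite W" unfolding W_def by (rule finite_subset[OF _ finite_vertices_le[of N]]) auto
  have "[] \<in> W" using root_carleson_box z w by (simp add: W_def)
  then have "Max (length ` W) \<in> length ` W" using fin by (intro Max_in) auto
  then obtain \<alpha> where "\<alpha> \<in> W" "Max (length ` W) = length \<alpha>" by auto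
  moreover have "length \<beta> \<le> Max (length ` W)" if "\<beta> \<in> W" for \<beta>
    using that fin by (intro Max_ge) auto
  ultimately have \<alpha>: "\<alpha> \<in> W" "\<And>\<beta>. \<beta> \<in> W \<Longrightarrow> length \<beta> \<le> length \<alpha>" by auto
  have "overlap N z w = (\<Sum>\<alpha> | length \<alpha> \<le> N. if \<alpha> \<in> W then 1 else 0)"
    unfolding overlap_def by (intro sum.cong refl) (auto simp: W_def indicator_def)
  also have "\<dots> = real (card ({\<alpha>. length \<alpha> \<le> N} \<inter> W))"
    using finite_vertices_le[of N] by (simp add: sum.If_cases)
  also have "{\<alpha>. length \<alpha> \<le> N} \<inter> W = W" by (auto simp: W_def)
  also have "card W \<le> card (\<Union>j\<le>length \<alpha>. {\<beta>. length \<beta> = j \<and> z \<in> carleson_box \<beta>})"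
  proof (rule card_mono)
    show "finite (\<Union>j\<le>length \<alpha>. {\<beta>. length \<beta> = j \<and> z \<in> carleson_box \<beta>})"
      using finite_generation by (auto intro: finite_subset)
    show "W \<subseteq> (\<Union>j\<le>length \<alpha>. {\<beta>. length \<beta> = j \<and> z \<in> carleson_box \<beta>})"
      using \<alpha>(2) by (auto simp: W_def)
  qed
  also have "\<dots> \<le> (\<Sum>j\<le>length \<alpha>. card {\<beta>. length \<beta> = j \<and> z \<in> carleson_box \<beta>})"
    by (rule card_UN_le) simp
  also have "\<dots> \<le> (\<Sum>j\<le>length \<alpha>. 2)" by (rule sum_mono) (rule card_generation_boxes)
  finally have "overlap N z w \<le> 2 * (real (length \<alpha>) + 1)" by simp
  with \<alpha>(1) that show ?thesis by (auto simp: W_def)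
qed

lemma overlap_le_log_kernel:
  obtains r L where "0 \<le> r" "r < 1"
    and "\<And>z1 z2 w1 w2. z1 \<in> cball 0 1 \<Longrightarrow> z2 \<in> cball 0 1 \<Longrightarrow> w1 \<in> cball 0 1 \<Longrightarrow> w2 \<in> cball 0 1 \<Longrightarrow>
      overlap N z1 w1 * overlap N z2 w2 \<le>
      18 * Re (log_kernel L (of_real r * (z1 * cnj w1)) * log_kernel L (of_real r * (z2 * cnj w2)))"
proof -
  \<comment> \<open>Below 1 for uniform convergence, yet within
    \<open>1 / 2 ^ length \<alpha>\<close> of 1 for every box counted, so that the factor
    \<open>r\<close> does not spoil the closeness of two points of a common box.\<close>
  define r :: real where "r = 1 - 1 / 2 ^ Suc N"
  have "(1::real) / 2 ^ Suc N \<le> 1" "0 < (1::real) / 2 ^ Suc N"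
    using one_le_power[of "2::real" "Suc N"] by auto
  then have r: "0 \<le> r" "r < 1" unfolding r_def by linarith+
  obtain L where L: "\<And>s. cmod s \<le> r \<Longrightarrow> cmod (log_kernel L s - (6 - Ln (1 - s))) \<le> 1/3"
    using log_kernel_approx[OF r] by blast
  have one: "\<exists>J. 4 \<le> Re k \<and> \<bar>Im k\<bar> \<le> 7/3 \<and> 2/3 * (real J + 1) \<le> Re k \<and> overlap N z w \<le> 2 * (real J + 1)"
    if z: "z \<in> cball 0 1" and w: "w \<in> cball 0 1" and k: "k = log_kernel L (of_real r * (z * cnj w))" for z w k
  proof -
    define s where "s = of_real r * (z * cnj w)"
    have "cmod (z * cnj w) \<le> 1" using z w by (simp add: norm_mult mult_le_one)
    then have "r * cmod (z * cnj w) \<le> r * 1" using r by (intro mult_left_mono) auto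
    then have s: "cmod s \<le> r" using r by (simp only: s_def norm_mult norm_of_real abs_of_nonneg mult_1_right)
    obtain \<alpha> where \<alpha>: "length \<alpha> \<le> N" "z \<in> carleson_box \<alpha>" "w \<in> carleson_box \<alpha>"
      "overlap N z w \<le> 2 * (real (length \<alpha>) + 1)"
      by (rule overlap_le[OF z w])
    have "(2::real) ^ length \<alpha> \<le> 2 ^ Suc N" using \<alpha>(1) by (intro power_increasing) auto
    then have "1 - 1 / 2 ^ length \<alpha> \<le> r" unfolding r_def by (intro diff_left_mono divide_left_mono) auto
    from carleson_box_kernel_arg[OF \<alpha>(2,3) r(1) this] r
    have "cmod (1 - s) \<le> 16 / 2 ^ length \<alpha>" by (simp add: s_def)
    with log_kernel_bounds[OF le_less_trans[OF s r(2)] L[OF s]] \<alpha>(4) show ?thesis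
      unfolding k s_def[symmetric] by blast
  qed
  show ?thesis
  proof (rule that[OF r])
    fix z1 z2 w1 w2 :: complex
    assume in_disc: "z1 \<in> cball 0 1" "z2 \<in> cball 0 1" "w1 \<in> cball 0 1" "w2 \<in> cball 0 1"
    define k where "k = log_kernel L (of_real r * (z1 * cnj w1))"
    define l where "l = log_kernel L (of_real r * (z2 * cnj w2))"
    obtain J where J: "4 \<le> Re k" "\<bar>Im k\<bar> \<le> 7/3" "2/3 * (real J + 1) \<le> Re k" "overlap N z1 w1 \<le> 2 * (real J + 1)"
      using one[OF in_disc(1,3) k_def] by blast
    obtain J' where J': "4 \<le> Re l" "\<bar>Im l\<bar> \<le> 7/3" "2/3 * (real J' + 1) \<le> Re l" "overlap N z2 w2 \<le> 2 * (real J' + 1)"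
      using one[OF in_disc(2,4) l_def] by blast
    have "0 \<le> overlap N z2 w2" unfolding overlap_def by (intro sum_nonneg) auto
    then have "overlap N z1 w1 * overlap N z2 w2 \<le> 2 * (real J + 1) * (2 * (real J' + 1))"
      using J(4) J'(4) by (intro mult_mono) auto
    \<comment> \<open>A factor 2 from each overlap bound and 9/2 from the product of kernels make
      18.\<close>
    also have "\<dots> = 4 * ((real J + 1) * (real J' + 1))" by (simp add: algebra_simps)
    also have "\<dots> \<le> 4 * (9/2 * Re (k * l))"
      using log_kernel_product[OF J(1-3) J'(1-3)] by (intro mult_left_mono) auto
    finally show "overlap N z1 w1 * overlap N z2 w2 \<le>
      18 * Re (log_kernel L (of_real r * (z1 * cnj w1)) * log_kernel L (of_real r * (z2 * cnj w2)))"
      unfolding k_def l_def by simp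
  qed
qed

subsection \<open>Comparing quadratic forms\<close>

text \<open>The kernel inequality is multiplied by \<open>\<Phi> x * \<Phi> y \<ge> 0\<close> and
  integrated in both variables. As the sums are finite, this is done one variable at a time, with
  the integrals over the other already evaluated to the constants \<open>a\<close> and
  \<open>b\<close>; no product measure enters.\<close>

lemma kernel_domination:
  fixes q :: "'j \<Rightarrow> 'a \<Rightarrow> real" and p :: "'i \<Rightarrow> 'a \<Rightarrow> complex"
  assumes \<Phi>: "\<And>x. x \<in> space M \<Longrightarrow> 0 \<le> \<Phi> x"
    and q: "\<And>j. j \<in> J \<Longrightarrow> integrable M (\<lambda>x. \<Phi> x * q j x)"
    and p: "\<And>i. i \<in> I \<Longrightarrow> integrable M (\<lambda>x. of_real (\<Phi> x) * p i x)"
    and le: "\<And>x y. x \<in> space M \<Longrightarrow> y \<in> space M \<Longrightarrow> (\<Sum>j\<in>J. q j x * q j y) \<le> Re (\<Sum>i\<in>I. p i x * cnj (p i y))"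
  shows "(\<Sum>j\<in>J. (\<integral>x. \<Phi> x * q j x \<partial>M)\<^sup>2) \<le> (\<Sum>i\<in>I. (cmod (\<integral>x. of_real (\<Phi> x) * p i x \<partial>M))\<^sup>2)"
proof -
  define a where "a j = (\<integral>x. \<Phi> x * q j x \<partial>M)" for j
  define b where "b i = (\<integral>x. of_real (\<Phi> x) * p i x \<partial>M)" for i
  have step: "(\<Sum>j\<in>J. q j x * a j) \<le> Re (\<Sum>i\<in>I. p i x * cnj (b i))" if x: "x \<in> space M" for x
  proof -
    have "(\<Sum>j\<in>J. q j x * a j) = (\<integral>y. (\<Sum>j\<in>J. q j x * (\<Phi> y * q j y)) \<partial>M)"
      unfolding a_def using q by (subst Bochner_Integration.integral_sum) auto
    also have "\<dots> \<le> (\<integral>y. Re (\<Sum>i\<in>I. p i x * cnj (of_real (\<Phi> y) * p i y)) \<partial>M)"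
    proof (rule integral_mono)
      show "integrable M (\<lambda>y. \<Sum>j\<in>J. q j x * (\<Phi> y * q j y))"
        using q by (intro Bochner_Integration.integrable_sum integrable_mult_right) auto
      show "integrable M (\<lambda>y. Re (\<Sum>i\<in>I. p i x * cnj (of_real (\<Phi> y) * p i y)))"
        using p by (intro integrable_Re Bochner_Integration.integrable_sum integrable_mult_right) (simp only: integrable_cnj)
      fix y assume y: "y \<in> space M"
      have "(\<Sum>j\<in>J. q j x * (\<Phi> y * q j y)) = \<Phi> y * (\<Sum>j\<in>J. q j x * q j y)"
        by (simp add: sum_distrib_left mult_ac)
      also have "\<dots> \<le> \<Phi> y * Re (\<Sum>i\<in>I. p i x * cnj (p i y))"
        by (intro mult_left_mono le \<Phi> x y)
      also have "\<dots> = Re (of_real (\<Phi> y) * (\<Sum>i\<in>I. p i x * cnj (p i y)))" by simp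
      also have "of_real (\<Phi> y) * (\<Sum>i\<in>I. p i x * cnj (p i y)) = (\<Sum>i\<in>I. p i x * cnj (of_real (\<Phi> y) * p i y))"
        by (simp add: sum_distrib_left mult_ac)
      finally show "(\<Sum>j\<in>J. q j x * (\<Phi> y * q j y)) \<le> Re (\<Sum>i\<in>I. p i x * cnj (of_real (\<Phi> y) * p i y))" .
    qed
    also have "\<dots> = Re (\<Sum>i\<in>I. p i x * cnj (b i))"
    proof -
      have int: "integrable M (\<lambda>y. p i x * cnj (of_real (\<Phi> y) * p i y))" if "i \<in> I" for i
        using p[OF that] by (intro integrable_mult_right) (simp only: integrable_cnj)
      have eq: "(\<integral>y. p i x * cnj (of_real (\<Phi> y) * p i y) \<partial>M) = p i x * cnj (b i)" for i
        unfolding b_def by (subst integral_mult_right_zero) (simp only: Bochner_Integration.integral_cnj)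
      have "(\<integral>y. Re (\<Sum>i\<in>I. p i x * cnj (of_real (\<Phi> y) * p i y)) \<partial>M) =
          Re (\<integral>y. (\<Sum>i\<in>I. p i x * cnj (of_real (\<Phi> y) * p i y)) \<partial>M)"
        by (intro integral_Re Bochner_Integration.integrable_sum int)
      also have "(\<integral>y. (\<Sum>i\<in>I. p i x * cnj (of_real (\<Phi> y) * p i y)) \<partial>M) =
          (\<Sum>i\<in>I. \<integral>y. p i x * cnj (of_real (\<Phi> y) * p i y) \<partial>M)"
        by (intro Bochner_Integration.integral_sum int)
      finally show ?thesis unfolding eq .
    qed
    finally show ?thesis .
  qed
  have "(\<Sum>j\<in>J. a j * a j) = (\<integral>x. (\<Sum>j\<in>J. (\<Phi> x * q j x) * a j) \<partial>M)"
    unfolding a_def using q by (subst Bochner_Integration.integral_sum) auto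
  also have "\<dots> \<le> (\<integral>x. Re (\<Sum>i\<in>I. (of_real (\<Phi> x) * p i x) * cnj (b i)) \<partial>M)"
  proof (rule integral_mono)
    show "integrable M (\<lambda>x. \<Sum>j\<in>J. (\<Phi> x * q j x) * a j)"
      using q by (intro Bochner_Integration.integrable_sum integrable_mult_left) auto
    show "integrable M (\<lambda>x. Re (\<Sum>i\<in>I. (of_real (\<Phi> x) * p i x) * cnj (b i)))"
      using p by (intro integrable_Re Bochner_Integration.integrable_sum integrable_mult_left) auto
    fix x assume x: "x \<in> space M"
    have "(\<Sum>j\<in>J. (\<Phi> x * q j x) * a j) = \<Phi> x * (\<Sum>j\<in>J. q j x * a j)"
      by (simp add: sum_distrib_left mult_ac)
    also have "\<dots> \<le> \<Phi> x * Re (\<Sum>i\<in>I. p i x * cnj (b i))"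
      by (intro mult_left_mono step \<Phi> x)
    also have "\<dots> = Re (of_real (\<Phi> x) * (\<Sum>i\<in>I. p i x * cnj (b i)))" by simp
    also have "of_real (\<Phi> x) * (\<Sum>i\<in>I. p i x * cnj (b i)) = (\<Sum>i\<in>I. (of_real (\<Phi> x) * p i x) * cnj (b i))"
      by (simp add: sum_distrib_left mult_ac)
    finally show "(\<Sum>j\<in>J. (\<Phi> x * q j x) * a j) \<le> Re (\<Sum>i\<in>I. (of_real (\<Phi> x) * p i x) * cnj (b i))" .
  qed
  also have "\<dots> = Re (\<Sum>i\<in>I. b i * cnj (b i))"
    using p unfolding b_def by (subst integral_Re) (auto simp: Bochner_Integration.integral_sum)
  also have "(\<Sum>i\<in>I. b i * cnj (b i)) = of_real (\<Sum>i\<in>I. (cmod (b i))\<^sup>2)"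
    unfolding of_real_sum complex_norm_square ..
  finally show ?thesis by (simp add: a_def b_def power2_eq_square)
qed

subsection \<open>Polynomials in the Dirichlet space\<close>

definition bipoly :: "nat \<Rightarrow> (nat \<Rightarrow> nat \<Rightarrow> complex) \<Rightarrow> complex \<Rightarrow> complex \<Rightarrow> complex" where
  "bipoly L A z w = (\<Sum>(m, n)\<in>{..<L} \<times> {..<L}. A m n * z ^ m * w ^ n)"

lemma bipoly_dirichlet:
  shows bipoly_in_dirichlet: "bipoly L A \<in> dirichlet_bidisc"
    and dirichlet_norm2_bipoly: "dirichlet_norm2 (bipoly L A) =
      ennreal (\<Sum>(m, n)\<in>{..<L} \<times> {..<L}. (cmod (A m n))\<^sup>2 * (real m + 1) * (real n + 1))"
proof -
  define A' where "A' m n = (if m < L \<and> n < L then A m n else 0)" for m n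
  have exp: "bidisc_expansion (bipoly L A) A'"
    unfolding bidisc_expansion_def
  proof (intro ballI)
    fix z w :: complex
    have "bipoly L A z w = (\<Sum>(m, n)\<in>{..<L} \<times> {..<L}. A' m n * z ^ m * w ^ n)"
      unfolding bipoly_def by (intro sum.cong refl) (auto simp: A'_def)
    then show "((\<lambda>(m, n). A' m n * z ^ m * w ^ n) has_sum bipoly L A z w) UNIV"
      by (intro has_sum_finite_neutralI[of "{..<L} \<times> {..<L}"]) (auto simp: A'_def split: if_splits)
  qed
  show norm: "dirichlet_norm2 (bipoly L A) =
      ennreal (\<Sum>(m, n)\<in>{..<L} \<times> {..<L}. (cmod (A m n))\<^sup>2 * (real m + 1) * (real n + 1))"
  proof -
    have "dirichlet_norm2 (bipoly L A) =
        (\<Sum>(m, n)\<in>{..<L} \<times> {..<L}. ennreal ((cmod (A' m n))\<^sup>2 * (real m + 1) * (real n + 1)))"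
      unfolding dirichlet_norm2_def taylor_coeff_eqI[OF exp]
      by (rule nn_integral_count_space') (auto simp: A'_def split: if_splits)
    also have "\<dots> = (\<Sum>(m, n)\<in>{..<L} \<times> {..<L}. ennreal ((cmod (A m n))\<^sup>2 * (real m + 1) * (real n + 1)))"
      by (intro sum.cong refl) (auto simp: A'_def)
    also have "\<dots> = ennreal (\<Sum>(m, n)\<in>{..<L} \<times> {..<L}. (cmod (A m n))\<^sup>2 * (real m + 1) * (real n + 1))"
      unfolding case_prod_unfold by (rule sum_ennreal) auto
    finally show ?thesis .
  qed
  have "bidisc_holomorphic (bipoly L A)"
    unfolding bidisc_holomorphic_def bipoly_def case_prod_unfold
    by (intro conjI ballI continuous_intros holomorphic_intros)
  with exp norm show "bipoly L A \<in> dirichlet_bidisc"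
    by (auto simp: dirichlet_bidisc_def)
qed

subsection \<open>Carleson measures bound the Hardy operator\<close>

definition box_indicator :: "vertex \<times> vertex \<Rightarrow> complex \<times> complex \<Rightarrow> real" where
  "box_indicator k \<zeta> = indicator (carleson_box (fst k)) (fst \<zeta>) * indicator (carleson_box (snd k)) (snd \<zeta>)"

definition vertex_pairs :: "nat \<Rightarrow> (vertex \<times> vertex) set" where
  "vertex_pairs N = {\<alpha>. length \<alpha> \<le> N} \<times> {\<beta>. length \<beta> \<le> N}"

lemma finite_vertex_pairs: "finite (vertex_pairs N)"
  unfolding vertex_pairs_def by (intro finite_cartesian_product finite_vertices_le)

lemma sum_box_indicator:
  "(\<Sum>k\<in>vertex_pairs N. box_indicator k \<zeta> * box_indicator k \<xi>) =
    overlap N (fst \<zeta>) (fst \<xi>) * overlap N (snd \<zeta>) (snd \<xi>)"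
  unfolding overlap_def sum_product sum.cartesian_product vertex_pairs_def box_indicator_def
  by (intro sum.cong refl) (auto simp: mult_ac)

text \<open>The square root puts half of each kernel coefficient, and of the factor 18, on either
  argument, so that the kernel is a sum of terms \<open>p x * cnj (p y)\<close>. Both arguments are
  dilated by \<open>R\<close>, hence the square of \<open>R\<close> in the kernel.\<close>

definition monomial :: "real \<Rightarrow> nat \<times> nat \<Rightarrow> complex \<times> complex \<Rightarrow> complex" where
  "monomial R k \<zeta> = of_real (sqrt (18 * log_coeff (fst k) * log_coeff (snd k))) *
     (of_real R * fst \<zeta>) ^ fst k * (of_real R * snd \<zeta>) ^ snd k"

lemma sum_monomial:
  "(\<Sum>k\<in>{..<L} \<times> {..<L}. monomial R k \<zeta> * cnj (monomial R k \<xi>)) =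
    18 * (log_kernel L (of_real (R\<^sup>2) * (fst \<zeta> * cnj (fst \<xi>))) * log_kernel L (of_real (R\<^sup>2) * (snd \<zeta> * cnj (snd \<xi>))))"
proof -
  have "monomial R k \<zeta> * cnj (monomial R k \<xi>) =
      18 * ((of_real (log_coeff (fst k)) * (of_real (R\<^sup>2) * (fst \<zeta> * cnj (fst \<xi>))) ^ fst k) *
        (of_real (log_coeff (snd k)) * (of_real (R\<^sup>2) * (snd \<zeta> * cnj (snd \<xi>))) ^ snd k))" for k
  proof -
    define c where "c = 18 * log_coeff (fst k) * log_coeff (snd k)"
    have "0 \<le> c" by (simp add: c_def log_coeff_nonneg)
    then have "complex_of_real (sqrt c) * of_real (sqrt c) = of_real c"
      by (simp flip: of_real_mult)
    moreover have "monomial R k \<zeta> * cnj (monomial R k \<xi>) = (complex_of_real (sqrt c) * of_real (sqrt c)) *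
      ((of_real (R\<^sup>2) * (fst \<zeta> * cnj (fst \<xi>))) ^ fst k * (of_real (R\<^sup>2) * (snd \<zeta> * cnj (snd \<xi>))) ^ snd k)"
      unfolding monomial_def c_def[symmetric]
      by (simp add: power_mult_distrib power2_eq_square mult_ac)
    ultimately show ?thesis unfolding c_def by (simp add: mult_ac)
  qed
  then show ?thesis
    unfolding log_kernel_def sum_product sum.cartesian_product
    by (simp add: sum_distrib_left case_prod_unfold)
qed

lemma norm_monomial_le:
  assumes "\<zeta> \<in> cball 0 1 \<times> cball 0 1" "0 \<le> R" "R \<le> 1"
  shows "cmod (monomial R k \<zeta>) \<le> sqrt (18 * log_coeff (fst k) * log_coeff (snd k))"
proof -
  have "cmod (of_real R * x) ^ n \<le> 1" if "x \<in> cball 0 1" for x :: complex and n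
    using that assms(2,3) by (intro power_le_one) (auto simp: norm_mult mult_le_one)
  then have "cmod (of_real R * fst \<zeta>) ^ fst k * cmod (of_real R * snd \<zeta>) ^ snd k \<le> 1"
    using assms(1) by (intro mult_le_one) auto
  then have "sqrt (18 * log_coeff (fst k) * log_coeff (snd k)) *
      (cmod (of_real R * fst \<zeta>) ^ fst k * cmod (of_real R * snd \<zeta>) ^ snd k) \<le>
      sqrt (18 * log_coeff (fst k) * log_coeff (snd k)) * 1"
    by (intro mult_left_mono) (auto simp: log_coeff_nonneg)
  moreover have "cmod (monomial R k \<zeta>) = sqrt (18 * log_coeff (fst k) * log_coeff (snd k)) *
      (cmod (of_real R * fst \<zeta>) ^ fst k * cmod (of_real R * snd \<zeta>) ^ snd k)"
    unfolding monomial_def norm_mult[of _ "_ ^ _"] norm_power norm_of_real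
    by (simp add: log_coeff_nonneg mult.assoc)
  ultimately show ?thesis by simp
qed

lemma box_indicator_measurable [measurable]: "box_indicator k \<in> borel_measurable borel"
proof -
  have [measurable]: "carleson_box \<alpha> \<in> sets borel" for \<alpha> by (intro borel_compact compact_carleson_box)
  show ?thesis unfolding box_indicator_def by measurable
qed

lemma monomial_measurable [measurable]: "monomial R k \<in> borel_measurable borel"
  unfolding monomial_def by measurable

text \<open>The weighted inequality of arithmetic and geometric means. With \<open>l\<close> the
  constant to be proved it replaces Cauchy-Schwarz: one of the two copies of the quantity on the
  left is absorbed by the right side.\<close>

lemma two_mult_le:
  fixes x y l :: real
  assumes "0 < l" shows "2 * (x * y) \<le> l * x\<^sup>2 + y\<^sup>2 / l"
proof -
  have "0 \<le> (l * x - y)\<^sup>2 / l" using assms by simp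
  also have "\<dots> = l * x\<^sup>2 - 2 * (x * y) + y\<^sup>2 / l"
    using assms by (simp add: power2_eq_square field_simps)
  finally show ?thesis by simp
qed

text \<open>A strictly positive real constant can be divided by. A Carleson constant 0 is reached by
  approximation from above, and \<open>top\<close> is a separate case.\<close>

locale carleson_measure =
  fixes \<mu> :: "(complex \<times> complex) measure" and M :: real
  assumes \<mu>: "closed_bidisc_measure \<mu>" and M: "0 < M"
    and carleson: "\<And>f R. f \<in> dirichlet_bidisc \<Longrightarrow> R \<in> {0..<1} \<Longrightarrow>
      (\<integral>\<^sup>+\<zeta>. ennreal ((cmod (f (of_real R * fst \<zeta>) (of_real R * snd \<zeta>)))\<^sup>2) \<partial>\<mu>) \<le> ennreal M * dirichlet_norm2 f"
begin

text \<open>The Carleson inequality for the constant function 1 bounds the total mass.\<close>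

lemma finite: "finite_measure \<mu>"
proof
  have "emeasure \<mu> (space \<mu>) = (\<integral>\<^sup>+\<zeta>. ennreal ((cmod (bipoly 1 (\<lambda>_ _. 1) (of_real 0 * fst \<zeta>) (of_real 0 * snd \<zeta>)))\<^sup>2) \<partial>\<mu>)"
    by (simp add: bipoly_def lessThan_Suc)
  also have "\<dots> \<le> ennreal M * dirichlet_norm2 (bipoly 1 (\<lambda>_ _. 1))"
    by (rule carleson[OF bipoly_in_dirichlet]) simp
  also have "\<dots> < top" by (simp add: dirichlet_norm2_bipoly lessThan_Suc ennreal_mult_less_top)
  finally show "emeasure \<mu> (space \<mu>) \<noteq> \<infinity>" by simp
qed

lemma integrable_bounded:
  fixes f :: "complex \<times> complex \<Rightarrow> 'b :: {banach, second_countable_topology}"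
  assumes "f \<in> borel_measurable borel" "\<And>\<zeta>. \<zeta> \<in> cball 0 1 \<times> cball 0 1 \<Longrightarrow> norm (f \<zeta>) \<le> B"
  shows "integrable \<mu> f"
proof (rule finite_measure.integrable_const_bound[OF finite])
  show "AE \<zeta> in \<mu>. norm (f \<zeta>) \<le> B"
    using assms(2) by (intro AE_I2) (auto simp: space_closed_bidisc_measure[OF \<mu>])
  show "f \<in> borel_measurable \<mu>" by (rule measurable_closed_bidisc_measure[OF \<mu> assms(1)])
qed

text \<open>The form \<open>\<Sum>\<^sub>k (\<integral> \<Phi> q\<^sub>k)\<^sup>2\<close> is dominated by \<open>E = \<Sum>\<^sub>k \<bar>\<integral> \<Phi> p\<^sub>k\<bar>\<^sup>2\<close> with the monomials \<open>p\<^sub>k\<close> of the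
  logarithmic kernel, and \<open>E = \<integral> \<Phi> F\<close> for a polynomial \<open>F\<close> whose Dirichlet norm is bounded by \<open>E\<close>.\<close>

lemma box_form_le:
  assumes \<Phi> [measurable]: "\<Phi> \<in> borel_measurable borel" and nonneg: "\<And>\<zeta>. 0 \<le> \<Phi> \<zeta>" and bounded: "\<And>\<zeta>. \<Phi> \<zeta> \<le> B"
  shows "(\<Sum>k\<in>vertex_pairs N. (\<integral>\<zeta>. \<Phi> \<zeta> * box_indicator k \<zeta> \<partial>\<mu>)\<^sup>2) \<le> 648 * M * (\<integral>\<zeta>. (\<Phi> \<zeta>)\<^sup>2 \<partial>\<mu>)"
proof -
  obtain r L where r: "0 \<le> r" "r < 1"
    and kernel: "\<And>z1 z2 w1 w2. z1 \<in> cball 0 1 \<Longrightarrow> z2 \<in> cball 0 1 \<Longrightarrow> w1 \<in> cball 0 1 \<Longrightarrow> w2 \<in> cball 0 1 \<Longrightarrow>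
      overlap N z1 w1 * overlap N z2 w2 \<le>
      18 * Re (log_kernel L (of_real r * (z1 * cnj w1)) * log_kernel L (of_real r * (z2 * cnj w2)))"
    using overlap_le_log_kernel[of N] by blast
  \<comment> \<open>The Carleson inequality is used at the radius \<open>R < 1\<close>, whose square
    is the \<open>r\<close> of the kernel.\<close>
  define R where "R = sqrt r"
  have R: "0 \<le> R" "R < 1" "R\<^sup>2 = r" using r by (auto simp: R_def)
  define K where "K = {..<L} \<times> {..<L}"
  define b where "b k = (\<integral>\<zeta>. of_real (\<Phi> \<zeta>) * monomial R k \<zeta> \<partial>\<mu>)" for k
  define E where "E = (\<Sum>k\<in>K. (cmod (b k))\<^sup>2)"
  define X where "X = (\<integral>\<zeta>. (\<Phi> \<zeta>)\<^sup>2 \<partial>\<mu>)"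
  have B: "0 \<le> B" using nonneg[of 0] bounded[of 0] by linarith
  have int_p: "integrable \<mu> (\<lambda>\<zeta>. of_real (\<Phi> \<zeta>) * monomial R k \<zeta>)" for k
  proof (rule integrable_bounded)
    fix \<zeta> :: "complex \<times> complex" assume "\<zeta> \<in> cball 0 1 \<times> cball 0 1"
    from norm_monomial_le[OF this, of R k] R
    show "norm (of_real (\<Phi> \<zeta>) * monomial R k \<zeta>) \<le> B * sqrt (18 * log_coeff (fst k) * log_coeff (snd k))"
      using nonneg[of \<zeta>] bounded[of \<zeta>] B by (auto simp: norm_mult intro!: mult_mono)
  qed measurable
  have int_q: "integrable \<mu> (\<lambda>\<zeta>. \<Phi> \<zeta> * box_indicator k \<zeta>)" for k
  proof (rule integrable_bounded)
    show "norm (\<Phi> \<zeta> * box_indicator k \<zeta>) \<le> B" for \<zeta>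
      using nonneg[of \<zeta>] bounded[of \<zeta>] B by (auto simp: box_indicator_def indicator_def)
  qed measurable
  have int_sq: "integrable \<mu> (\<lambda>\<zeta>. (\<Phi> \<zeta>)\<^sup>2)"
    by (rule integrable_bounded[where B = "B\<^sup>2"]) (use nonneg bounded in \<open>auto intro!: power_mono\<close>)
  have form_le: "(\<Sum>k\<in>vertex_pairs N. (\<integral>\<zeta>. \<Phi> \<zeta> * box_indicator k \<zeta> \<partial>\<mu>)\<^sup>2) \<le> E"
    unfolding E_def b_def
  proof (rule kernel_domination[OF nonneg int_q int_p])
    fix \<zeta> \<xi> assume "\<zeta> \<in> space \<mu>" "\<xi> \<in> space \<mu>"
    then have "fst \<zeta> \<in> cball 0 1" "snd \<zeta> \<in> cball 0 1" "fst \<xi> \<in> cball 0 1" "snd \<xi> \<in> cball 0 1"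
      by (auto simp: space_closed_bidisc_measure[OF \<mu>])
    from kernel[OF this] show "(\<Sum>k\<in>vertex_pairs N. box_indicator k \<zeta> * box_indicator k \<xi>) \<le>
        Re (\<Sum>k\<in>K. monomial R k \<zeta> * cnj (monomial R k \<xi>))"
      unfolding sum_box_indicator K_def sum_monomial R(3) by simp
  qed
  define s where "s k = sqrt (18 * log_coeff (fst k) * log_coeff (snd k))" for k :: "nat \<times> nat"
  define F where "F = bipoly L (\<lambda>m n. of_real (s (m, n)) * cnj (b (m, n)))"
  have F: "F (of_real R * fst \<zeta>) (of_real R * snd \<zeta>) = (\<Sum>k\<in>K. cnj (b k) * monomial R k \<zeta>)" for \<zeta>
    unfolding F_def bipoly_def K_def monomial_def s_def by (intro sum.cong refl) (auto simp: mult_ac)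
  have "dirichlet_norm2 F \<le> ennreal (648 * E)"
  proof -
    \<comment> \<open>648 = 18 * 6 * 6: the factor of the kernel, and in each variable the bound 6
      for \<open>log_coeff n * (n + 1)\<close>.\<close>
    have "(cmod (of_real (s (m, n)) * cnj (b (m, n))))\<^sup>2 * (real m + 1) * (real n + 1) \<le> 648 * (cmod (b (m, n)))\<^sup>2" for m n
    proof -
      have "0 \<le> 18 * log_coeff m * log_coeff n" by (simp add: log_coeff_nonneg)
      then have "(cmod (of_real (s (m, n)) * cnj (b (m, n))))\<^sup>2 * (real m + 1) * (real n + 1) =
          18 * ((log_coeff m * (real m + 1)) * (log_coeff n * (real n + 1))) * (cmod (b (m, n)))\<^sup>2"
        by (simp add: norm_mult power_mult_distrib s_def)
      also have "\<dots> \<le> 18 * (6 * 6) * (cmod (b (m, n)))\<^sup>2"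
        by (intro mult_right_mono mult_left_mono mult_mono log_coeff_le) (auto simp: log_coeff_nonneg)
      finally show ?thesis by simp
    qed
    then have "(\<Sum>(m, n)\<in>K. (cmod (of_real (s (m, n)) * cnj (b (m, n))))\<^sup>2 * (real m + 1) * (real n + 1)) \<le>
        (\<Sum>(m, n)\<in>K. 648 * (cmod (b (m, n)))\<^sup>2)"
      by (intro sum_mono) auto
    also have "\<dots> = 648 * E" by (simp add: E_def sum_distrib_left case_prod_unfold)
    finally show ?thesis
      unfolding F_def dirichlet_norm2_bipoly K_def by (rule ennreal_leI)
  qed
  then have "ennreal M * dirichlet_norm2 F \<le> ennreal M * ennreal (648 * E)"
    by (rule mult_left_mono) simp
  moreover have "(\<integral>\<^sup>+\<zeta>. ennreal ((cmod (F (of_real R * fst \<zeta>) (of_real R * snd \<zeta>)))\<^sup>2) \<partial>\<mu>) \<le> ennreal M * dirichlet_norm2 F"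
    using R unfolding F_def by (intro carleson bipoly_in_dirichlet) auto
  ultimately have F_le: "(\<integral>\<^sup>+\<zeta>. ennreal ((cmod (F (of_real R * fst \<zeta>) (of_real R * snd \<zeta>)))\<^sup>2) \<partial>\<mu>) \<le> ennreal (M * (648 * E))"
    using M by (simp add: ennreal_mult')
  have F_meas: "(\<lambda>\<zeta>. F (of_real R * fst \<zeta>) (of_real R * snd \<zeta>)) \<in> borel_measurable borel"
    unfolding F by measurable
  then have F_meas': "(\<lambda>\<zeta>. (cmod (F (of_real R * fst \<zeta>) (of_real R * snd \<zeta>)))\<^sup>2) \<in> borel_measurable \<mu>"
    by (intro measurable_closed_bidisc_measure[OF \<mu>]) measurable
  have int_F: "integrable \<mu> (\<lambda>\<zeta>. (cmod (F (of_real R * fst \<zeta>) (of_real R * snd \<zeta>)))\<^sup>2)"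
    by (rule integrableI_bounded[OF F_meas']) (use F_le in \<open>auto intro: le_less_trans\<close>)
  have "0 \<le> E" unfolding E_def by (intro sum_nonneg) auto
  then have F_int_le: "(\<integral>\<zeta>. (cmod (F (of_real R * fst \<zeta>) (of_real R * snd \<zeta>)))\<^sup>2 \<partial>\<mu>) \<le> M * (648 * E)"
    using F_le M by (subst (asm) nn_integral_eq_integral[OF int_F]) auto
  have int_\<Phi>F: "integrable \<mu> (\<lambda>\<zeta>. of_real (\<Phi> \<zeta>) * F (of_real R * fst \<zeta>) (of_real R * snd \<zeta>))"
  proof -
    have "integrable \<mu> (\<lambda>\<zeta>. \<Sum>k\<in>K. cnj (b k) * (of_real (\<Phi> \<zeta>) * monomial R k \<zeta>))"
      by (intro Bochner_Integration.integrable_sum integrable_mult_right int_p)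
    then show ?thesis unfolding F by (simp add: sum_distrib_left mult_ac)
  qed
  have "of_real E = (\<Sum>k\<in>K. cnj (b k) * b k)"
    unfolding E_def of_real_sum complex_norm_square by (simp add: mult.commute)
  also have "\<dots> = (\<Sum>k\<in>K. \<integral>\<zeta>. cnj (b k) * (of_real (\<Phi> \<zeta>) * monomial R k \<zeta>) \<partial>\<mu>)"
    unfolding b_def by (simp add: int_p)
  also have "\<dots> = (\<integral>\<zeta>. (\<Sum>k\<in>K. cnj (b k) * (of_real (\<Phi> \<zeta>) * monomial R k \<zeta>)) \<partial>\<mu>)"
    by (intro Bochner_Integration.integral_sum[symmetric] integrable_mult_right int_p)
  also have "\<dots> = (\<integral>\<zeta>. of_real (\<Phi> \<zeta>) * F (of_real R * fst \<zeta>) (of_real R * snd \<zeta>) \<partial>\<mu>)"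
    unfolding F by (simp add: sum_distrib_left mult_ac)
  finally have "E = Re (\<integral>\<zeta>. of_real (\<Phi> \<zeta>) * F (of_real R * fst \<zeta>) (of_real R * snd \<zeta>) \<partial>\<mu>)"
    by (metis Re_complex_of_real)
  then have E_eq: "E = (\<integral>\<zeta>. Re (of_real (\<Phi> \<zeta>) * F (of_real R * fst \<zeta>) (of_real R * snd \<zeta>)) \<partial>\<mu>)"
    using integral_Re[OF int_\<Phi>F] by simp
  \<comment> \<open>With this \<open>l\<close> the Carleson bound on the second term is exactly
    \<open>E\<close>, so \<open>2 * E \<le> l * X + E\<close> and one copy of \<open>E\<close>
    cancels.\<close>
  define l where "l = 648 * M"
  have l: "0 < l" using M by (simp add: l_def)
  have "2 * E = (\<integral>\<zeta>. 2 * Re (of_real (\<Phi> \<zeta>) * F (of_real R * fst \<zeta>) (of_real R * snd \<zeta>)) \<partial>\<mu>)"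
    by (subst E_eq) simp
  also have "\<dots> \<le> (\<integral>\<zeta>. l * (\<Phi> \<zeta>)\<^sup>2 + (cmod (F (of_real R * fst \<zeta>) (of_real R * snd \<zeta>)))\<^sup>2 / l \<partial>\<mu>)"
  proof (rule integral_mono)
    show "integrable \<mu> (\<lambda>\<zeta>. 2 * Re (of_real (\<Phi> \<zeta>) * F (of_real R * fst \<zeta>) (of_real R * snd \<zeta>)))"
      by (intro integrable_mult_right integrable_Re int_\<Phi>F)
    show "integrable \<mu> (\<lambda>\<zeta>. l * (\<Phi> \<zeta>)\<^sup>2 + (cmod (F (of_real R * fst \<zeta>) (of_real R * snd \<zeta>)))\<^sup>2 / l)"
      by (intro Bochner_Integration.integrable_add integrable_mult_right integrable_divide int_sq int_F)
    fix \<zeta>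
    let ?w = "F (of_real R * fst \<zeta>) (of_real R * snd \<zeta>)"
    have "Re (of_real (\<Phi> \<zeta>) * ?w) \<le> \<Phi> \<zeta> * cmod ?w"
      using nonneg[of \<zeta>] complex_Re_le_cmod[of ?w] by (simp add: mult_left_mono)
    with two_mult_le[OF l, of "\<Phi> \<zeta>" "cmod ?w"]
    show "2 * Re (of_real (\<Phi> \<zeta>) * ?w) \<le> l * (\<Phi> \<zeta>)\<^sup>2 + (cmod ?w)\<^sup>2 / l" by linarith
  qed
  also have "\<dots> = l * X + (\<integral>\<zeta>. (cmod (F (of_real R * fst \<zeta>) (of_real R * snd \<zeta>)))\<^sup>2 \<partial>\<mu>) / l"
    unfolding X_def using int_sq int_F by simp
  also have "\<dots> \<le> l * X + M * (648 * E) / l"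
    using l F_int_le by (intro add_left_mono divide_right_mono) auto
  also have "M * (648 * E) / l = E" using M by (simp add: l_def)
  finally have "E \<le> l * X" by simp
  with form_le show ?thesis by (simp add: l_def X_def)
qed

text \<open>Duality: the integral \<open>X\<close> of the square of \<open>\<Phi>\<close> is the
  pairing of \<open>\<phi>\<close> with the integrals \<open>a k\<close>, to which the form bound
  applies with the same \<open>\<Phi>\<close>. Then \<open>X\<close> occurs on both sides and
  cancels, being finite because the sum is truncated.\<close>

lemma box_sum_bound:
  assumes \<phi>: "\<And>k. 0 \<le> \<phi> k"
  shows "(\<integral>\<^sup>+\<zeta>. ennreal ((\<Sum>k\<in>vertex_pairs N. \<phi> k * box_indicator k \<zeta>)\<^sup>2) \<partial>\<mu>) \<le>
    ennreal (648 * M) * (\<integral>\<^sup>+k. ennreal ((\<phi> k)\<^sup>2) \<partial>count_space UNIV)"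
proof -
  let ?V = "vertex_pairs N"
  define \<Phi> where "\<Phi> \<zeta> = (\<Sum>k\<in>?V. \<phi> k * box_indicator k \<zeta>)" for \<zeta>
  define B where "B = (\<Sum>k\<in>?V. \<phi> k)"
  have q: "0 \<le> box_indicator k \<zeta>" "box_indicator k \<zeta> \<le> 1" for k \<zeta>
    by (auto simp: box_indicator_def indicator_def)
  have meas [measurable]: "\<Phi> \<in> borel_measurable borel" unfolding \<Phi>_def by measurable
  have nonneg: "0 \<le> \<Phi> \<zeta>" for \<zeta> unfolding \<Phi>_def using \<phi> q by (intro sum_nonneg) auto
  have bounded: "\<Phi> \<zeta> \<le> B" for \<zeta> unfolding \<Phi>_def B_def using \<phi> q by (intro sum_mono mult_left_le) auto
  have int_q: "integrable \<mu> (\<lambda>\<zeta>. \<Phi> \<zeta> * box_indicator k \<zeta>)" for k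
  proof (rule integrable_bounded)
    fix \<zeta> :: "complex \<times> complex"
    have "\<Phi> \<zeta> * box_indicator k \<zeta> \<le> B * 1"
      using order_trans[OF nonneg bounded] by (intro mult_mono bounded q) auto
    then show "norm (\<Phi> \<zeta> * box_indicator k \<zeta>) \<le> B * 1"
      using nonneg[of \<zeta>] q(1)[of k \<zeta>] by simp
  qed measurable
  have int_sq: "integrable \<mu> (\<lambda>\<zeta>. (\<Phi> \<zeta>)\<^sup>2)"
    by (rule integrable_bounded[where B = "B\<^sup>2"]) (use nonneg bounded in \<open>auto intro!: power_mono\<close>)
  define X where "X = (\<integral>\<zeta>. (\<Phi> \<zeta>)\<^sup>2 \<partial>\<mu>)"
  define S where "S = (\<Sum>k\<in>?V. (\<phi> k)\<^sup>2)"
  define a where "a k = (\<integral>\<zeta>. \<Phi> \<zeta> * box_indicator k \<zeta> \<partial>\<mu>)" for k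
  define l where "l = 648 * M"
  have l: "0 < l" using M by (simp add: l_def)
  have form: "(\<Sum>k\<in>?V. (a k)\<^sup>2) \<le> l * X"
    unfolding a_def l_def X_def by (rule box_form_le[OF meas nonneg bounded])
  have "X = (\<integral>\<zeta>. (\<Sum>k\<in>?V. \<phi> k * (\<Phi> \<zeta> * box_indicator k \<zeta>)) \<partial>\<mu>)"
    unfolding X_def
  proof (intro Bochner_Integration.integral_cong refl)
    fix \<zeta>
    have "(\<Phi> \<zeta>)\<^sup>2 = \<Phi> \<zeta> * (\<Sum>k\<in>?V. \<phi> k * box_indicator k \<zeta>)"
      unfolding power2_eq_square by (simp add: \<Phi>_def)
    then show "(\<Phi> \<zeta>)\<^sup>2 = (\<Sum>k\<in>?V. \<phi> k * (\<Phi> \<zeta> * box_indicator k \<zeta>))"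
      by (simp add: sum_distrib_left mult_ac)
  qed
  also have "\<dots> = (\<Sum>k\<in>?V. \<phi> k * a k)"
    unfolding a_def by (subst Bochner_Integration.integral_sum) (auto intro!: integrable_mult_right int_q)
  finally have "2 * X = (\<Sum>k\<in>?V. 2 * (\<phi> k * a k))" by (simp add: sum_distrib_left)
  also have "\<dots> \<le> (\<Sum>k\<in>?V. l * (\<phi> k)\<^sup>2 + (a k)\<^sup>2 / l)"
    by (intro sum_mono two_mult_le l)
  also have "\<dots> = l * S + (\<Sum>k\<in>?V. (a k)\<^sup>2) / l"
    unfolding S_def by (simp add: sum.distrib sum_distrib_left sum_divide_distrib)
  also have "\<dots> \<le> l * S + l * X / l"
    using l form by (intro add_left_mono divide_right_mono) auto
  finally have "X \<le> l * S" using l by simp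
  have "(\<integral>\<^sup>+\<zeta>. ennreal ((\<Phi> \<zeta>)\<^sup>2) \<partial>\<mu>) = ennreal X"
    unfolding X_def by (rule nn_integral_eq_integral[OF int_sq]) simp
  also have "\<dots> \<le> ennreal (l * S)" by (rule ennreal_leI) fact
  also have "\<dots> = ennreal l * (\<Sum>k\<in>?V. ennreal ((\<phi> k)\<^sup>2))"
    using l unfolding S_def by (subst ennreal_mult) (auto intro: sum_nonneg)
  also have "(\<Sum>k\<in>?V. ennreal ((\<phi> k)\<^sup>2)) = (\<integral>\<^sup>+k. ennreal ((\<phi> k)\<^sup>2) * indicator ?V k \<partial>count_space UNIV)"
    using finite_vertex_pairs[of N] by (subst nn_integral_count_space'[of ?V]) auto
  also have "\<dots> \<le> (\<integral>\<^sup>+k. ennreal ((\<phi> k)\<^sup>2) \<partial>count_space UNIV)"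
    by (intro nn_integral_mono) (auto simp: indicator_def)
  finally show ?thesis unfolding \<Phi>_def l_def by (simp add: mult_left_mono)
qed

text \<open>A vertex pair above a point of the bitree has a product of regions containing the
  underlying point of the bidisc, so the truncated Hardy sum is at most \<open>\<Phi>\<close>; 36 is
  the multiplicity of the cells.\<close>

lemma truncated_hardy_bound:
  assumes \<phi>: "\<And>k. 0 \<le> \<phi> k"
  shows "(\<integral>\<^sup>+y. (hardy (\<lambda>k. if k \<in> vertex_pairs N then \<phi> k else 0) y)\<^sup>2 \<partial>tree_measure \<mu>) \<le>
    36 * (ennreal (648 * M) * (\<integral>\<^sup>+k. ennreal ((\<phi> k)\<^sup>2) \<partial>count_space UNIV))"
proof -
  let ?V = "vertex_pairs N"
  define \<Phi> where "\<Phi> \<zeta> = (\<Sum>k\<in>?V. \<phi> k * box_indicator k \<zeta>)" for \<zeta>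
  have meas: "(\<lambda>\<zeta>. ennreal ((\<Phi> \<zeta>)\<^sup>2)) \<in> borel_measurable borel" unfolding \<Phi>_def by measurable
  have nonneg: "0 \<le> \<Phi> \<zeta>" for \<zeta> unfolding \<Phi>_def using \<phi> by (intro sum_nonneg) (auto simp: box_indicator_def)
  have "(\<integral>\<^sup>+y. (hardy (\<lambda>k. if k \<in> ?V then \<phi> k else 0) y)\<^sup>2 \<partial>tree_measure \<mu>) \<le> 36 * (\<integral>\<^sup>+\<zeta>. ennreal ((\<Phi> \<zeta>)\<^sup>2) \<partial>\<mu>)"
  proof (rule nn_integral_tree_measure_le[OF \<mu>])
    show "(\<lambda>y. (hardy (\<lambda>k. if k \<in> ?V then \<phi> k else 0) y)\<^sup>2) \<in> borel_measurable borel" by measurable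
    show "(\<lambda>\<zeta>. ennreal ((\<Phi> \<zeta>)\<^sup>2)) \<in> borel_measurable \<mu>" by (rule measurable_closed_bidisc_measure[OF \<mu> meas])
    fix i j z w assume ij: "cell_weight i z \<noteq> 0" "cell_weight j w \<noteq> 0"
    let ?D = "{(\<alpha>, \<beta>). (cell_point i z, cell_point j w) \<le> (Vertex \<alpha>, Vertex \<beta>)}"
    have "hardy (\<lambda>k. if k \<in> ?V then \<phi> k else 0) (cell_point i z, cell_point j w) =
        (\<integral>\<^sup>+k. ennreal (if k \<in> ?V then \<phi> k else 0) * indicator ?D k \<partial>count_space UNIV)"
      unfolding hardy_def by (rule nn_integral_count_space_indicator) simp
    also have "\<dots> = (\<Sum>k\<in>?V. ennreal (if k \<in> ?V then \<phi> k else 0) * indicator ?D k)"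
      by (rule nn_integral_count_space'[OF finite_vertex_pairs]) auto
    also have "\<dots> \<le> (\<Sum>k\<in>?V. ennreal (\<phi> k * box_indicator k (z, w)))"
    proof (rule sum_mono)
      fix k assume k: "k \<in> ?V"
      show "ennreal (if k \<in> ?V then \<phi> k else 0) * indicator ?D k \<le> ennreal (\<phi> k * box_indicator k (z, w))"
      proof (cases "k \<in> ?D")
        case True
        then have "cell_point i z \<in> descendants (fst k)" "cell_point j w \<in> descendants (snd k)"
          by (auto simp: descendants_def less_eq_prod_def)
        with cell_point_below_imp_carleson_box ij
        have "z \<in> carleson_box (fst k)" "w \<in> carleson_box (snd k)" by blast+
        then show ?thesis using k True by (simp add: box_indicator_def)
      qed simp
    qed
    also have "\<dots> = ennreal (\<Phi> (z, w))"
      unfolding \<Phi>_def using \<phi> by (intro sum_ennreal) (auto simp: box_indicator_def)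
    finally have "(hardy (\<lambda>k. if k \<in> ?V then \<phi> k else 0) (cell_point i z, cell_point j w))\<^sup>2 \<le> (ennreal (\<Phi> (z, w)))\<^sup>2"
      by (rule power_mono) simp
    then show "(hardy (\<lambda>k. if k \<in> ?V then \<phi> k else 0) (cell_point i z, cell_point j w))\<^sup>2 \<le> ennreal ((\<Phi> (z, w))\<^sup>2)"
      using nonneg by (simp add: ennreal_power)
  qed
  also have "\<dots> \<le> 36 * (ennreal (648 * M) * (\<integral>\<^sup>+k. ennreal ((\<phi> k)\<^sup>2) \<partial>count_space UNIV))"
    unfolding \<Phi>_def by (intro mult_left_mono box_sum_bound \<phi>) simp
  finally show ?thesis .
qed

text \<open>The truncated bound does not depend on \<open>N\<close>, so monotone convergence removes
  the truncation.\<close>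

lemma hardy_norm2_le: "hardy_norm2 (tree_measure \<mu>) \<le> ennreal (36 * 648 * M)"
  unfolding hardy_norm2_def
proof (rule Inf_lower, intro CollectI allI impI)
  fix \<phi> :: "vertex \<times> vertex \<Rightarrow> real" assume \<phi>: "\<forall>\<alpha>. 0 \<le> \<phi> \<alpha>"
  define h where "h N = hardy (\<lambda>k. if k \<in> vertex_pairs N then \<phi> k else 0)" for N
  have inc_trunc: "(if k \<in> vertex_pairs N then \<phi> k else 0) \<le> (if k \<in> vertex_pairs N' then \<phi> k else 0)"
    if "N \<le> N'" for k N N'
    using that \<phi> by (auto simp: vertex_pairs_def)
  have inc: "h N \<zeta> \<le> h N' \<zeta>" if "N \<le> N'" for N N' \<zeta>
    unfolding h_def by (rule hardy_mono) (rule inc_trunc[OF that])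
  have sup: "hardy \<phi> \<zeta> = (SUP N. h N \<zeta>)" for \<zeta>
  proof -
    have "(SUP N. ennreal (if k \<in> vertex_pairs N then \<phi> k else 0)) = ennreal (\<phi> k)" for k
    proof (rule antisym)
      show "(SUP N. ennreal (if k \<in> vertex_pairs N then \<phi> k else 0)) \<le> ennreal (\<phi> k)"
        by (rule SUP_least) auto
      have "k \<in> vertex_pairs (max (length (fst k)) (length (snd k)))" by (auto simp: vertex_pairs_def mem_Times_iff)
      then show "ennreal (\<phi> k) \<le> (SUP N. ennreal (if k \<in> vertex_pairs N then \<phi> k else 0))"
        by (intro SUP_upper2[of "max (length (fst k)) (length (snd k))"]) auto
    qed
    then show ?thesis
      unfolding hardy_def h_def
    proof (subst nn_integral_monotone_convergence_SUP[symmetric])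
      show "incseq (\<lambda>N k. ennreal (if k \<in> vertex_pairs N then \<phi> k else 0))"
        unfolding incseq_def le_fun_def by (intro allI impI ennreal_leI inc_trunc)
    qed simp_all
  qed
  \<comment> \<open>Squaring commutes with the supremum, since two indices of the increasing family
    may be replaced by their maximum.\<close>
  have sq: "(hardy \<phi> \<zeta>)\<^sup>2 = (SUP N. (h N \<zeta>)\<^sup>2)" for \<zeta>
  proof (rule antisym)
    have "h N \<zeta> * h N' \<zeta> \<le> (SUP N. (h N \<zeta>)\<^sup>2)" for N N'
    proof -
      have "h N \<zeta> * h N' \<zeta> \<le> (h (max N N') \<zeta>)\<^sup>2"
        unfolding power2_eq_square by (intro mult_mono inc) auto
      also have "\<dots> \<le> (SUP N. (h N \<zeta>)\<^sup>2)" by (rule SUP_upper) simp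
      finally show ?thesis .
    qed
    then show "(hardy \<phi> \<zeta>)\<^sup>2 \<le> (SUP N. (h N \<zeta>)\<^sup>2)"
      unfolding sup power2_eq_square SUP_mult_left_ennreal SUP_mult_right_ennreal
      by (intro SUP_least) (simp add: power2_eq_square)
    show "(SUP N. (h N \<zeta>)\<^sup>2) \<le> (hardy \<phi> \<zeta>)\<^sup>2"
      unfolding sup by (intro SUP_least power_mono SUP_upper) auto
  qed
  have "(\<integral>\<^sup>+\<zeta>. (hardy \<phi> \<zeta>)\<^sup>2 \<partial>tree_measure \<mu>) = (SUP N. \<integral>\<^sup>+\<zeta>. (h N \<zeta>)\<^sup>2 \<partial>tree_measure \<mu>)"
    unfolding sq
  proof (rule nn_integral_monotone_convergence_SUP)
    show "incseq (\<lambda>N \<zeta>. (h N \<zeta>)\<^sup>2)" by (auto simp: incseq_def le_fun_def intro!: power_mono inc)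
    have "h N \<in> borel_measurable borel" for N unfolding h_def by measurable
    then show "(\<lambda>\<zeta>. (h N \<zeta>)\<^sup>2) \<in> borel_measurable (tree_measure \<mu>)" for N
      unfolding tree_measure_def by measurable
  qed
  also have "\<dots> \<le> ennreal (36 * 648 * M) * (\<integral>\<^sup>+k. ennreal ((\<phi> k)\<^sup>2) \<partial>count_space UNIV)"
  proof (rule SUP_least)
    fix N
    have "ennreal (36 * 648 * M) = 36 * ennreal (648 * M)"
      using M by (simp add: ennreal_mult mult.assoc[symmetric])
    then show "(\<integral>\<^sup>+\<zeta>. (h N \<zeta>)\<^sup>2 \<partial>tree_measure \<mu>) \<le> ennreal (36 * 648 * M) * (\<integral>\<^sup>+k. ennreal ((\<phi> k)\<^sup>2) \<partial>count_space UNIV)"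
      using truncated_hardy_bound[of \<phi> N] \<phi> unfolding h_def by (simp add: mult.assoc)
  qed
  finally show "(\<integral>\<^sup>+\<zeta>. (hardy \<phi> \<zeta>)\<^sup>2 \<partial>tree_measure \<mu>) \<le>
      ennreal (36 * 648 * M) * (\<integral>\<^sup>+k. ennreal ((\<phi> k)\<^sup>2) \<partial>count_space UNIV)" .
qed

end

theorem hardy_norm2_le_carleson_const:
  assumes \<mu>: "closed_bidisc_measure \<mu>"
  shows "hardy_norm2 (tree_measure \<mu>) \<le> ennreal (36 * 648) * carleson_const \<mu>"
proof (cases "carleson_const \<mu> = top")
  case True
  then show ?thesis by (simp add: ennreal_mult_top)
next
  case False
  then obtain c where c: "carleson_const \<mu> = ennreal c" "0 \<le> c" by (cases "carleson_const \<mu>") auto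
  have bound: "(\<integral>\<^sup>+\<zeta>. ennreal ((cmod (f (of_real R * fst \<zeta>) (of_real R * snd \<zeta>)))\<^sup>2) \<partial>\<mu>) \<le> ennreal c * dirichlet_norm2 f"
    if f: "f \<in> dirichlet_bidisc" and R: "R \<in> {0..<1}" for f and R :: real
  proof (cases "dirichlet_norm2 f = 0")
    case True
    have "(\<integral>\<^sup>+\<zeta>. ennreal ((cmod (f (of_real R * fst \<zeta>) (of_real R * snd \<zeta>)))\<^sup>2) \<partial>\<mu>) = (\<integral>\<^sup>+\<zeta>. 0 \<partial>\<mu>)"
      using dirichlet_norm2_zero[OF f True] closed_bidisc_scaled_in_ball[OF \<mu> _ R]
      by (intro nn_integral_cong) auto
    then show ?thesis by simp
  next
    case False
    show ?thesis
      unfolding c(1)[symmetric] carleson_const_def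
    proof (rule le_Inf_mult_ennreal[OF False])
      show "dirichlet_norm2 f \<noteq> top" using f by (auto simp: dirichlet_bidisc_def)
      fix C assume "C \<in> {C. \<forall>f\<in>dirichlet_bidisc. (SUP R\<in>{0..<1::real}. \<integral>\<^sup>+(\<zeta>1, \<zeta>2).
        ennreal ((cmod (f (of_real R * \<zeta>1) (of_real R * \<zeta>2)))\<^sup>2) \<partial>\<mu>) \<le> C * dirichlet_norm2 f}"
      then have "(SUP R\<in>{0..<1::real}. \<integral>\<^sup>+(\<zeta>1, \<zeta>2).
        ennreal ((cmod (f (of_real R * \<zeta>1) (of_real R * \<zeta>2)))\<^sup>2) \<partial>\<mu>) \<le> C * dirichlet_norm2 f" using f by blast
      from order_trans[OF SUP_upper[OF R] this]
      show "(\<integral>\<^sup>+\<zeta>. ennreal ((cmod (f (of_real R * fst \<zeta>) (of_real R * snd \<zeta>)))\<^sup>2) \<partial>\<mu>) \<le> C * dirichlet_norm2 f"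
        by (simp add: case_prod_unfold)
    qed
  qed
  show ?thesis
  proof (rule ennreal_le_epsilon)
    fix e :: real assume e: "0 < e"
    \<comment> \<open>The shift makes \<open>M\<close> positive even when the Carleson constant is
      0; multiplied by \<open>36 * 648\<close> it becomes the error \<open>e\<close>.\<close>
    define M where "M = c + e / (36 * 648)"
    have "carleson_measure \<mu> M"
    proof
      show "0 < M" using c e by (simp add: M_def add_nonneg_pos)
      fix f and R :: real assume f: "f \<in> dirichlet_bidisc" and R: "R \<in> {0..<1}"
      have "ennreal c * dirichlet_norm2 f \<le> ennreal M * dirichlet_norm2 f"
        using e by (intro mult_right_mono ennreal_leI) (auto simp: M_def)
      with bound[OF f R] show "(\<integral>\<^sup>+\<zeta>. ennreal ((cmod (f (of_real R * fst \<zeta>) (of_real R * snd \<zeta>)))\<^sup>2) \<partial>\<mu>) \<le>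
          ennreal M * dirichlet_norm2 f" by (rule order_trans)
    qed (fact \<mu>)
    then have "hardy_norm2 (tree_measure \<mu>) \<le> ennreal (36 * 648 * M)"
      by (rule carleson_measure.hardy_norm2_le)
    also have "36 * 648 * M = 36 * 648 * c + e" by (simp add: M_def field_simps)
    also have "ennreal \<dots> = ennreal (36 * 648) * carleson_const \<mu> + ennreal e"
      using c e by (simp add: ennreal_mult)
    finally show "hardy_norm2 (tree_measure \<mu>) \<le> ennreal (36 * 648) * carleson_const \<mu> + ennreal e" .
  qed
qed

theorem theorem1p3:
  "(\<exists>C1 C2 :: real. C1 > 0 \<and> C2 > 0 \<and>
      (\<forall>\<mu> :: (complex \<times> complex) measure.
         sets \<mu> = sets (restrict_space borel (cball 0 1 \<times> cball 0 1)) \<longrightarrow>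
           ennreal C1 * carleson_const \<mu> \<le> hardy_norm2 (pullback \<mu>) \<and>
           hardy_norm2 (pullback \<mu>) \<le> ennreal C2 * carleson_const \<mu>)) \<and>
   (\<exists>C1 C2 :: real. C1 > 0 \<and> C2 > 0 \<and>
      (\<forall>\<mu> :: (complex \<times> complex) measure.
         sets \<mu> = sets (restrict_space borel (cball 0 1 \<times> cball 0 1)) \<longrightarrow>
           ennreal C1 * variation_const \<mu> \<le> hardy_norm2 (pullback \<mu>) \<and>
           hardy_norm2 (pullback \<mu>) \<le> ennreal C2 * variation_const \<mu>)) \<and>
   (\<forall>\<mu> :: (complex \<times> complex) measure.
      sets \<mu> = sets (restrict_space borel (cball 0 1 \<times> cball 0 1)) \<longrightarrow>
        carleson_const \<mu> \<le> variation_const \<mu>)"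
proof -
  let ?K = "16 * (4 * 257 * 257 * 64 * 400) :: real" and ?K' = "36 * 648 :: real"
  \<comment> \<open>Three inequalities in a cycle: each of the three quantities is bounded by the
    next up to a constant, so every other comparison follows by composition.\<close>
  have V: "variation_const \<mu> \<le> ennreal ?K * hardy_norm2 (pullback \<mu>)"
    and H: "hardy_norm2 (pullback \<mu>) \<le> ennreal ?K' * carleson_const \<mu>"
    and C: "carleson_const \<mu> \<le> variation_const \<mu>"
    if "sets \<mu> = sets (restrict_space borel (cball 0 1 \<times> cball 0 1))" for \<mu> :: "(complex \<times> complex) measure"
  proof -
    have \<mu>: "closed_bidisc_measure \<mu>" using that unfolding closed_bidisc_measure_def .
    show "variation_const \<mu> \<le> ennreal ?K * hardy_norm2 (pullback \<mu>)"
      unfolding pullback_eq_tree_measure[OF \<mu>] by (rule variation_const_le_hardy_norm2[OF \<mu>])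
    show "hardy_norm2 (pullback \<mu>) \<le> ennreal ?K' * carleson_const \<mu>"
      unfolding pullback_eq_tree_measure[OF \<mu>] by (rule hardy_norm2_le_carleson_const[OF \<mu>])
    show "carleson_const \<mu> \<le> variation_const \<mu>"
      by (rule carleson_const_le_variation_const[OF \<mu>])
  qed
  have inv: "ennreal (1 / ?K) * x \<le> y" if "x \<le> ennreal ?K * y" for x y :: ennreal
  proof -
    have "ennreal (1 / ?K) * x \<le> ennreal (1 / ?K) * (ennreal ?K * y)" by (rule mult_left_mono[OF that]) simp
    also have "\<dots> = (ennreal (1 / ?K) * ennreal ?K) * y" by (rule mult.assoc[symmetric])
    also have "ennreal (1 / ?K) * ennreal ?K = 1" by (subst ennreal_mult[symmetric]) auto
    finally show ?thesis by simp
  qed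
  define K1 K2 where "K1 = 1 / ?K" and "K2 = ?K'"
  have K: "K1 > 0" "K2 > 0" by (simp_all add: K1_def K2_def)
  have V': "ennreal K1 * variation_const \<mu> \<le> hardy_norm2 (pullback \<mu>)"
    and H': "hardy_norm2 (pullback \<mu>) \<le> ennreal K2 * carleson_const \<mu>"
    if "sets \<mu> = sets (restrict_space borel (cball 0 1 \<times> cball 0 1))" for \<mu> :: "(complex \<times> complex) measure"
    unfolding K1_def K2_def by (rule inv[OF V[OF that]], rule H[OF that])
  have C': "ennreal K1 * carleson_const \<mu> \<le> hardy_norm2 (pullback \<mu>)"
      "hardy_norm2 (pullback \<mu>) \<le> ennreal K2 * variation_const \<mu>"
    if "sets \<mu> = sets (restrict_space borel (cball 0 1 \<times> cball 0 1))" for \<mu> :: "(complex \<times> complex) measure"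
    by (rule order_trans[OF mult_left_mono[OF C[OF that]] V'[OF that]], simp,
        rule order_trans[OF H'[OF that] mult_left_mono[OF C[OF that]]], simp)
  show ?thesis using K V' H' C' C by blast
qed

end
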